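(* Let $\Omega\subset\mathbb R^N$ be a bounded domain which is convex or of class $C^2$, $\nu,\kappa>0$, $T_1>0$, $J=[0,T_1]$, $\tilde F\in C(J;L^2(\Omega))$, $G=(u_0,v_0)\in\mathcal H=H^1_0(\Omega)\times L^2(\Omega)$. For $n\ge1$ let $$V_n(t)=T(t)G_n+\int_0^tT(t-s)F_n(s)\,ds,\qquad G_n=(Q_nu_0,\tilde Q_nv_0),\quad F_n=(0,\tilde P_n\tilde F).$$ Then $V_n\in\mathcal P_n\times\tilde{\mathcal P}_n$, i.e. both components of $V_n$ are continuous functions from $J$ into the span of the first $n$ eigenfunctions $\phi_1,\dots,\phi_n$ of $-\kappa\nabla^2$. In particular, any weak solution $V=(u,u_t)$ of the linear inhomogeneous problem with data $\tilde F$, $G$ can be approximated in $C(J;\mathcal H)$ by eigenfunctions via a standard Galerkin procedure, namely by the $V_n$: $V_n\to V$ in $C(J;\mathcal H)$ as $n\to\infty$.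
   Context: $H^1_0(\Omega)$ carries the inner product $(u,w)_{H^1_0}=\kappa(\nabla u,\nabla w)_{L^2}$. $T(t)$, $t\ge0$, is the strongly continuous contraction semigroup on $\mathcal H$ generated by $U(u,v)=(v,\kappa\nabla^2u-\nu v)$ with domain $D(U)=(H^2(\Omega)\cap H^1_0(\Omega))\times H^1_0(\Omega)$. $\{\phi_n\}_{n\ge1}$ are the eigenfunctions of $-\kappa\nabla^2$ with homogeneous Dirichlet boundary conditions, orthonormal and complete in $L^2(\Omega)$, and complete orthogonal in $H^1_0(\Omega)$. $Q_n$ and $\tilde Q_n$ are the orthogonal projections in $H^1_0(\Omega)$, respectively $L^2(\Omega)$, onto $\mathcal M_n=\operatorname{span}\{\phi_1,\dots,\phi_n\}$. $\mathcal P_n=\{\sum_{k=1}^n\alpha_k(t)\phi_k(\mathbf x):\alpha_k\in C(J)\}$ as a subspace of $C(J;H^1_0(\Omega))$, and $\tilde{\mathcal P}_n$ is the same set as a subspace of $C(J;L^2(\Omega))$; $\tilde P_n$ is the projection of $C(J;L^2(\Omega))$ onto $\tilde{\mathcal P}_n$ given by $(\tilde P_nf)(t)=\tilde Q_n(f(t))$. Weak solution of the linear inhomogeneous problem with data $\tilde F$, $G$: a function $u$ with $(u,u_t)\in C(J;\mathcal H)$, $u_{tt}\in C(J;H^{-1}(\Omega))$, $(u(0),u_t(0))=(u_0,v_0)$, and for all $\phi\in C(J;H^1_0(\Omega))$ and $0<t\le T_1$: $(u_{tt},\phi)_{L^2}=-\nu(u_t,\phi)_{L^2}-\kappa(\nabla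 u,\nabla\phi)_{L^2}+(\tilde F,\phi)_{L^2}$ (the left side being the $H^{-1}$–$H^1_0$ pairing). *)

theory Defs
  imports "HOL-Analysis.Analysis"
begin

section \<open>The Hilbert space \<open>L\<^sup>2\<close>\<close>

definition square_integrable :: "('a::euclidean_space \<Rightarrow> real) \<Rightarrow> bool" where
  "square_integrable f \<longleftrightarrow>
     f \<in> borel_measurable lborel \<and> integrable lborel (\<lambda>x. (f x)\<^sup>2)"

definition L2_eq :: "('a::euclidean_space \<Rightarrow> real) \<Rightarrow> ('a \<Rightarrow> real) \<Rightarrow> bool" where
  "L2_eq f g \<longleftrightarrow>
     square_integrable f \<and> square_integrable g \<and> (AE x in lborel. f x = g x)"

lemma square_integrable_zero: "square_integrable (\<lambda>_. 0)"
  by (simp add: square_integrable_def)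

lemma square_integrable_mult:
  assumes "square_integrable f" "square_integrable g"
  shows "integrable lborel (\<lambda>x. f x * g x)"
proof (rule Bochner_Integration.integrable_bound)
  show "integrable lborel (\<lambda>x. (f x)\<^sup>2 + (g x)\<^sup>2)"
    using assms by (auto simp: square_integrable_def)
  show "(\<lambda>x. f x * g x) \<in> borel_measurable lborel"
    using assms by (auto simp: square_integrable_def)
  have "\<bar>a * b\<bar> \<le> a\<^sup>2 + b\<^sup>2" for a b :: real
  proof -
    have "2 * \<bar>a\<bar> * \<bar>b\<bar> \<le> \<bar>a\<bar>\<^sup>2 + \<bar>b\<bar>\<^sup>2" by (rule sum_squares_bound)
    moreover have "0 \<le> \<bar>a\<bar> * \<bar>b\<bar>" by simp
    ultimately show ?thesis unfolding abs_mult power2_abs by linarith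
  qed
  then show "AE x in lborel. norm (f x * g x) \<le> norm ((f x)\<^sup>2 + (g x)\<^sup>2)"
    by simp
qed

lemma square_integrable_add:
  assumes "square_integrable f" "square_integrable g"
  shows "square_integrable (\<lambda>x. f x + g x)"
proof -
  have "integrable lborel (\<lambda>x. (f x)\<^sup>2 + (g x)\<^sup>2 + 2 * (f x * g x))"
    using assms square_integrable_mult[OF assms]
    by (intro Bochner_Integration.integrable_add integrable_mult_right)
       (auto simp: square_integrable_def)
  then show ?thesis
    using assms by (auto simp: square_integrable_def power2_sum mult.assoc)
qed

lemma square_integrable_cmult:
  assumes "square_integrable f"
  shows "square_integrable (\<lambda>x. c * f x)"
  using assms by (auto simp: square_integrable_def power_mult_distrib)

quotient_type (overloaded) 'a L2 = "'a::euclidean_space \<Rightarrow> real" / partial: L2_eq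
proof (rule part_equivpI)
  show "\<exists>f. L2_eq f (f :: 'a \<Rightarrow> real)"
    using square_integrable_zero by (auto simp: L2_eq_def)
  show "symp (L2_eq :: ('a \<Rightarrow> real) \<Rightarrow> _)"
    by (rule sympI) (auto simp: L2_eq_def elim!: eventually_mono)
  show "transp (L2_eq :: ('a \<Rightarrow> real) \<Rightarrow> _)"
    by (rule transpI) (auto simp: L2_eq_def elim!: eventually_elim2)
qed

instantiation L2 :: (euclidean_space) real_inner
begin

lift_definition zero_L2 :: "'a L2" is "\<lambda>_. 0"
  by (simp add: L2_eq_def square_integrable_zero)

lift_definition plus_L2 :: "'a L2 \<Rightarrow> 'a L2 \<Rightarrow> 'a L2" is "\<lambda>f g x. f x + g x"
  by (auto simp: L2_eq_def square_integrable_add elim!: eventually_elim2)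

lift_definition uminus_L2 :: "'a L2 \<Rightarrow> 'a L2" is "\<lambda>f x. - f x"
  using square_integrable_cmult[where c = "-1"]
  by (auto simp: L2_eq_def elim!: eventually_mono)

lift_definition scaleR_L2 :: "real \<Rightarrow> 'a L2 \<Rightarrow> 'a L2" is "\<lambda>c f x. c * f x"
  by (auto simp: L2_eq_def square_integrable_cmult elim!: eventually_mono)

lift_definition inner_L2 :: "'a L2 \<Rightarrow> 'a L2 \<Rightarrow> real" is
  "\<lambda>f g. \<integral>x. f x * g x \<partial>lborel"
  by (rule integral_cong_AE)
     (auto simp: L2_eq_def square_integrable_def elim!: eventually_elim2)

definition "f - g = f + - (g :: 'a L2)"
definition "norm f = sqrt (inner f (f :: 'a L2))"
definition "sgn f = inverse (norm f) *\<^sub>R (f :: 'a L2)"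
definition "dist f g = norm (f - g :: 'a L2)"
definition "(uniformity :: ('a L2 \<times> 'a L2) filter) =
  (INF e\<in>{0<..}. principal {(f, g). dist f g < e})"
definition "open S \<longleftrightarrow>
  (\<forall>f\<in>S. eventually (\<lambda>(f', g). f' = f \<longrightarrow> g \<in> S) (uniformity :: ('a L2 \<times> 'a L2) filter))"

instance
proof
  fix f g h :: "'a L2" and a b :: real
  show "f + g + h = f + (g + h)"
    by transfer (auto simp: L2_eq_def square_integrable_add add.assoc)
  show "f + g = g + f"
    by transfer (auto simp: L2_eq_def square_integrable_add add.commute)
  show "0 + f = f"
    by transfer (auto simp: L2_eq_def)
  show "- f + f = 0"
    by transfer (auto simp: L2_eq_def square_integrable_zero)
  show "f - g = f + - g" by (fact minus_L2_def)
  show "a *\<^sub>R (f + g) = a *\<^sub>R f + a *\<^sub>R g"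
    by transfer
       (auto simp: L2_eq_def algebra_simps intro!: square_integrable_add square_integrable_cmult)
  show "(a + b) *\<^sub>R f = a *\<^sub>R f + b *\<^sub>R f"
    by transfer
       (auto simp: L2_eq_def algebra_simps intro!: square_integrable_add square_integrable_cmult)
  show "a *\<^sub>R b *\<^sub>R f = (a * b) *\<^sub>R f"
    by transfer (auto simp: L2_eq_def mult.assoc[symmetric] square_integrable_cmult)
  show "1 *\<^sub>R f = f"
    by transfer (auto simp: L2_eq_def)
  show "inner f g = inner g f"
    by transfer (simp add: mult.commute)
  show "inner (f + g) h = inner f h + inner g h"
    by transfer (auto simp: L2_eq_def distrib_right square_integrable_mult)
  show "inner (a *\<^sub>R f) g = a * inner f g"
    by transfer (auto simp: mult.assoc)
  show "0 \<le> inner f f"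
    by transfer simp
  show "inner f f = 0 \<longleftrightarrow> f = 0"
  proof transfer
    fix f :: "'a \<Rightarrow> real"
    assume f: "L2_eq f f"
    then have "(\<integral>x. f x * f x \<partial>lborel) = 0 \<longleftrightarrow> (AE x in lborel. f x * f x = 0)"
      by (intro integral_nonneg_eq_0_iff_AE) (auto simp: L2_eq_def square_integrable_mult)
    with f show "(\<integral>x. f x * f x \<partial>lborel) = 0 \<longleftrightarrow> L2_eq f (\<lambda>_. 0)"
      by (simp add: L2_eq_def square_integrable_zero)
  qed
qed (fact sgn_L2_def dist_L2_def uniformity_L2_def open_L2_def norm_L2_def)+

end

text \<open>
  A type cannot depend on \<open>\<Omega>\<close>, so \<open>L\<^sup>2(\<Omega>)\<close> is the closed subspace of \<open>L\<^sup>2(\<real>\<^sup>N)\<close> of (classes of)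
  functions vanishing outside \<open>\<Omega>\<close>; norm and inner product are those of \<open>L\<^sup>2(\<Omega>)\<close>.
\<close>

definition L2_on :: "'a::euclidean_space set \<Rightarrow> 'a L2 set" where
  "L2_on \<Omega> = {f. AE x in lborel. x \<notin> \<Omega> \<longrightarrow> rep_L2 f x = 0}"


section \<open>Domains and Sobolev spaces\<close>

primrec C_diff :: "nat \<Rightarrow> ('a::euclidean_space \<Rightarrow> real) \<Rightarrow> bool" where
  "C_diff 0 f \<longleftrightarrow> continuous_on UNIV f"
| "C_diff (Suc k) f \<longleftrightarrow> (\<forall>x. f differentiable (at x)) \<and>
     (\<forall>i\<in>Basis. C_diff k (\<lambda>x. frechet_derivative f (at x) i))"

definition bounded_domain :: "'a::euclidean_space set \<Rightarrow> bool" where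
  "bounded_domain \<Omega> \<longleftrightarrow> open \<Omega> \<and> connected \<Omega> \<and> bounded \<Omega> \<and> \<Omega> \<noteq> {}"

text \<open>
  Near each boundary point, \<open>\<Omega>\<close> is the region above the graph of a \<open>C\<^sup>k\<close> function over the hyperplane
  orthogonal to some unit vector \<open>e\<close>. The function \<open>\<gamma>\<close> lives on the whole space, but only its values
  on that hyperplane matter.
\<close>

definition class_C :: "nat \<Rightarrow> 'a::euclidean_space set \<Rightarrow> bool" where
  "class_C k \<Omega> \<longleftrightarrow> (\<forall>p\<in>frontier \<Omega>. \<exists>r>0. \<exists>e \<gamma>. norm e = 1 \<and> C_diff k \<gamma> \<and>
     \<Omega> \<inter> ball p r = {x \<in> ball p r. \<gamma> (x - (x \<bullet> e) *\<^sub>R e) < x \<bullet> e})"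

definition test_function :: "'a::euclidean_space set \<Rightarrow> ('a \<Rightarrow> real) \<Rightarrow> bool" where
  "test_function \<Omega> \<psi> \<longleftrightarrow> (\<forall>k. C_diff k \<psi>) \<and>
     compact (closure {x. \<psi> x \<noteq> 0}) \<and> closure {x. \<psi> x \<noteq> 0} \<subseteq> \<Omega>"

definition is_weak_partial ::
  "'a::euclidean_space set \<Rightarrow> 'a \<Rightarrow> 'a L2 \<Rightarrow> 'a L2 \<Rightarrow> bool" where
  "is_weak_partial \<Omega> i f g \<longleftrightarrow> (\<forall>\<psi>. test_function \<Omega> \<psi> \<longrightarrow>
     (LINT x:\<Omega>|lborel. rep_L2 f x * frechet_derivative \<psi> (at x) i) =
     - (LINT x:\<Omega>|lborel. rep_L2 g x * \<psi> x))"

definition weak_partial :: "'a::euclidean_space set \<Rightarrow> 'a \<Rightarrow> 'a L2 \<Rightarrow> 'a L2" where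
  "weak_partial \<Omega> i f = (THE g. g \<in> L2_on \<Omega> \<and> is_weak_partial \<Omega> i f g)"

definition H1 :: "'a::euclidean_space set \<Rightarrow> 'a L2 set" where
  "H1 \<Omega> = {u \<in> L2_on \<Omega>. \<forall>i\<in>Basis. \<exists>g\<in>L2_on \<Omega>. is_weak_partial \<Omega> i u g}"

definition H1_norm :: "'a::euclidean_space set \<Rightarrow> 'a L2 \<Rightarrow> real" where
  "H1_norm \<Omega> u = sqrt ((norm u)\<^sup>2 + (\<Sum>i\<in>Basis. (norm (weak_partial \<Omega> i u))\<^sup>2))"

definition H2 :: "'a::euclidean_space set \<Rightarrow> 'a L2 set" where
  "H2 \<Omega> = {u \<in> H1 \<Omega>. \<forall>i\<in>Basis. weak_partial \<Omega> i u \<in> H1 \<Omega>}"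

definition H10 :: "'a::euclidean_space set \<Rightarrow> 'a L2 set" where
  "H10 \<Omega> = {u \<in> H1 \<Omega>. \<forall>e>0. \<exists>\<psi>. test_function \<Omega> \<psi> \<and> H1_norm \<Omega> (u - abs_L2 \<psi>) < e}"

definition grad_inner :: "'a::euclidean_space set \<Rightarrow> 'a L2 \<Rightarrow> 'a L2 \<Rightarrow> real" where
  "grad_inner \<Omega> u w = (\<Sum>i\<in>Basis. weak_partial \<Omega> i u \<bullet> weak_partial \<Omega> i w)"

definition H10_inner :: "'a::euclidean_space set \<Rightarrow> real \<Rightarrow> 'a L2 \<Rightarrow> 'a L2 \<Rightarrow> real" where
  "H10_inner \<Omega> \<kappa> u w = \<kappa> * grad_inner \<Omega> u w"

definition H10_norm :: "'a::euclidean_space set \<Rightarrow> real \<Rightarrow> 'a L2 \<Rightarrow> real" where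
  "H10_norm \<Omega> \<kappa> u = sqrt (H10_inner \<Omega> \<kappa> u u)"

definition laplacian :: "'a::euclidean_space set \<Rightarrow> 'a L2 \<Rightarrow> 'a L2" where
  "laplacian \<Omega> u = (\<Sum>i\<in>Basis. weak_partial \<Omega> i (weak_partial \<Omega> i u))"

text \<open>
  \<open>H\<^sup>-\<^sup>1(\<Omega>)\<close> is the dual of \<open>H\<^sup>1\<^sub>0(\<Omega>)\<close>. Its elements are represented by functions on the ambient type, of
  which only the restriction to \<open>H\<^sup>1\<^sub>0(\<Omega>)\<close> matters; \<open>f \<in> L\<^sup>2(\<Omega>)\<close> is the functional \<open>w \<mapsto> f \<bullet> w\<close>.
\<close>

definition Hm1 :: "'a::euclidean_space set \<Rightarrow> real \<Rightarrow> ('a L2 \<Rightarrow> real) set" where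
  "Hm1 \<Omega> \<kappa> = {l. (\<forall>v\<in>H10 \<Omega>. \<forall>w\<in>H10 \<Omega>. l (v + w) = l v + l w) \<and>
     (\<forall>c. \<forall>w\<in>H10 \<Omega>. l (c *\<^sub>R w) = c * l w) \<and>
     (\<exists>C. \<forall>w\<in>H10 \<Omega>. \<bar>l w\<bar> \<le> C * H10_norm \<Omega> \<kappa> w)}"

definition Hm1_norm :: "'a::euclidean_space set \<Rightarrow> real \<Rightarrow> ('a L2 \<Rightarrow> real) \<Rightarrow> real" where
  "Hm1_norm \<Omega> \<kappa> l = (SUP w\<in>{w \<in> H10 \<Omega>. H10_norm \<Omega> \<kappa> w \<le> 1}. \<bar>l w\<bar>)"

definition energy_space :: "'a::euclidean_space set \<Rightarrow> ('a L2 \<times> 'a L2) set" where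
  "energy_space \<Omega> = H10 \<Omega> \<times> L2_on \<Omega>"

definition energy_norm :: "'a::euclidean_space set \<Rightarrow> real \<Rightarrow> 'a L2 \<times> 'a L2 \<Rightarrow> real" where
  "energy_norm \<Omega> \<kappa> = (\<lambda>(u, v). sqrt (H10_inner \<Omega> \<kappa> u u + v \<bullet> v))"


section \<open>Calculus in a normed space given by a carrier \<open>X\<close> and a norm \<open>nrm\<close>\<close>

definition C_on :: "real set \<Rightarrow> 'b::minus set \<Rightarrow> ('b \<Rightarrow> real) \<Rightarrow> (real \<Rightarrow> 'b) set" where
  "C_on J X nrm = {f. (\<forall>t\<in>J. f t \<in> X) \<and>
     (\<forall>t\<in>J. ((\<lambda>s. nrm (f s - f t)) \<longlongrightarrow> 0) (at t within J))}"

text \<open>The library's gauge integral (cf. \<open>has_integral\<close>), with respect to \<open>nrm\<close>.\<close>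

definition has_integral_wrt ::
  "('b::real_vector \<Rightarrow> real) \<Rightarrow> (real \<Rightarrow> 'b) \<Rightarrow> 'b \<Rightarrow> real \<Rightarrow> real \<Rightarrow> bool" where
  "has_integral_wrt nrm f I a b \<longleftrightarrow> (\<forall>e>0. \<exists>\<gamma>. gauge \<gamma> \<and>
     (\<forall>p. p tagged_division_of {a..b} \<and> \<gamma> fine p \<longrightarrow>
        nrm ((\<Sum>(x, K)\<in>p. measure lborel K *\<^sub>R f x) - I) < e))"

definition integral_wrt ::
  "'b::real_vector set \<Rightarrow> ('b \<Rightarrow> real) \<Rightarrow> real \<Rightarrow> real \<Rightarrow> (real \<Rightarrow> 'b) \<Rightarrow> 'b" where
  "integral_wrt X nrm a b f = (THE I. I \<in> X \<and> has_integral_wrt nrm f I a b)"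

definition contraction_semigroup ::
  "'b::real_vector set \<Rightarrow> ('b \<Rightarrow> real) \<Rightarrow> (real \<Rightarrow> 'b \<Rightarrow> 'b) \<Rightarrow> bool" where
  "contraction_semigroup X nrm T \<longleftrightarrow>
     (\<forall>t\<ge>0. \<forall>x\<in>X. T t x \<in> X \<and> nrm (T t x) \<le> nrm x) \<and>
     (\<forall>t\<ge>0. \<forall>x\<in>X. \<forall>y\<in>X. T t (x + y) = T t x + T t y) \<and>
     (\<forall>t\<ge>0. \<forall>c. \<forall>x\<in>X. T t (c *\<^sub>R x) = c *\<^sub>R T t x) \<and>
     (\<forall>x\<in>X. T 0 x = x) \<and>
     (\<forall>s\<ge>0. \<forall>t\<ge>0. \<forall>x\<in>X. T (s + t) x = T s (T t x)) \<and>
     (\<forall>x\<in>X. ((\<lambda>t. nrm (T t x - x)) \<longlongrightarrow> 0) (at_right 0))"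

definition is_generator ::
  "'b::real_vector set \<Rightarrow> ('b \<Rightarrow> real) \<Rightarrow> (real \<Rightarrow> 'b \<Rightarrow> 'b) \<Rightarrow> 'b set \<Rightarrow> ('b \<Rightarrow> 'b) \<Rightarrow> bool" where
  "is_generator X nrm T D A \<longleftrightarrow> (\<forall>x\<in>X. \<forall>y\<in>X.
     ((\<lambda>h. nrm (inverse h *\<^sub>R (T h x - x) - y)) \<longlongrightarrow> 0) (at_right 0) \<longleftrightarrow> x \<in> D \<and> y = A x) \<and>
     D \<subseteq> X \<and> A ` D \<subseteq> X"

definition orthogonal_projection ::
  "('b \<Rightarrow> 'b \<Rightarrow> real) \<Rightarrow> 'b::real_vector set \<Rightarrow> 'b \<Rightarrow> 'b" where
  "orthogonal_projection ip M x = (THE q. q \<in> M \<and> (\<forall>w\<in>M. ip (x - q) w = 0))"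


section \<open>The damped wave equation\<close>

definition wave_domain :: "'a::euclidean_space set \<Rightarrow> ('a L2 \<times> 'a L2) set" where
  "wave_domain \<Omega> = (H2 \<Omega> \<inter> H10 \<Omega>) \<times> H10 \<Omega>"

definition wave_operator ::
  "'a::euclidean_space set \<Rightarrow> real \<Rightarrow> real \<Rightarrow> 'a L2 \<times> 'a L2 \<Rightarrow> 'a L2 \<times> 'a L2" where
  "wave_operator \<Omega> \<kappa> \<nu> = (\<lambda>(u, v). (v, \<kappa> *\<^sub>R laplacian \<Omega> u - \<nu> *\<^sub>R v))"

definition wave_semigroup ::
  "'a::euclidean_space set \<Rightarrow> real \<Rightarrow> real \<Rightarrow> (real \<Rightarrow> 'a L2 \<times> 'a L2 \<Rightarrow> 'a L2 \<times> 'a L2) \<Rightarrow> bool" where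
  "wave_semigroup \<Omega> \<kappa> \<nu> T \<longleftrightarrow>
     contraction_semigroup (energy_space \<Omega>) (energy_norm \<Omega> \<kappa>) T \<and>
     is_generator (energy_space \<Omega>) (energy_norm \<Omega> \<kappa>) T (wave_domain \<Omega>) (wave_operator \<Omega> \<kappa> \<nu>)"

text \<open>
  A weak solution is given together with its time derivative \<open>ut\<close>, taken in \<open>L\<^sup>2(\<Omega>)\<close>; the second time
  derivative \<open>utt\<close> is the derivative of \<open>ut\<close> in \<open>H\<^sup>-\<^sup>1(\<Omega>)\<close>. Derivatives at the end points of
  \<open>J\<close> are one-sided.
\<close>

definition weak_solution ::
  "'a::euclidean_space set \<Rightarrow> real \<Rightarrow> real \<Rightarrow> real \<Rightarrow> (real \<Rightarrow> 'a L2) \<Rightarrow> 'a L2 \<times> 'a L2 \<Rightarrow>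
    (real \<Rightarrow> 'a L2) \<Rightarrow> (real \<Rightarrow> 'a L2) \<Rightarrow> bool" where
  "weak_solution \<Omega> \<kappa> \<nu> T1 F G u ut \<longleftrightarrow>
     (\<forall>t\<in>{0..T1}. (u has_vector_derivative ut t) (at t within {0..T1})) \<and>
     (\<lambda>t. (u t, ut t)) \<in> C_on {0..T1} (energy_space \<Omega>) (energy_norm \<Omega> \<kappa>) \<and>
     (u 0, ut 0) = G \<and>
     (\<exists>utt. utt \<in> C_on {0..T1} (Hm1 \<Omega> \<kappa>) (Hm1_norm \<Omega> \<kappa>) \<and>
       (\<forall>t\<in>{0..T1}. ((\<lambda>s. Hm1_norm \<Omega> \<kappa> (\<lambda>w. inverse (s - t) * ((ut s - ut t) \<bullet> w) - utt t w))
          \<longlongrightarrow> 0) (at t within {0..T1})) \<and>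
       (\<forall>\<psi>\<in>C_on {0..T1} (H10 \<Omega>) (H10_norm \<Omega> \<kappa>). \<forall>t\<in>{0<..T1}.
          utt t (\<psi> t) = - \<nu> * (ut t \<bullet> \<psi> t) - \<kappa> * grad_inner \<Omega> (u t) (\<psi> t) + F t \<bullet> \<psi> t))"


section \<open>Eigenfunctions and Galerkin approximation\<close>

text \<open>
  Eigenfunctions of \<open>-\<kappa>\<nabla>\<^sup>2\<close> as an operator with domain \<open>H\<^sup>2(\<Omega>) \<inter> H\<^sup>1\<^sub>0(\<Omega>)\<close>.
\<close>

definition dirichlet_eigenfunction :: "'a::euclidean_space set \<Rightarrow> real \<Rightarrow> 'a L2 \<Rightarrow> bool" where
  "dirichlet_eigenfunction \<Omega> \<kappa> f \<longleftrightarrow> f \<in> H2 \<Omega> \<inter> H10 \<Omega> \<and> f \<noteq> 0 \<and>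
     (\<exists>l. - (\<kappa> *\<^sub>R laplacian \<Omega> f) = l *\<^sub>R f)"

definition eigenspan :: "(nat \<Rightarrow> 'b::real_vector) \<Rightarrow> nat \<Rightarrow> 'b set" where
  "eigenspan \<phi> n = span (\<phi> ` {1..n})"

definition complete_in ::
  "(nat \<Rightarrow> 'b::real_vector) \<Rightarrow> 'b set \<Rightarrow> ('b \<Rightarrow> real) \<Rightarrow> bool" where
  "complete_in \<phi> X nrm \<longleftrightarrow> \<phi> ` {1..} \<subseteq> X \<and>
     (\<forall>x\<in>X. \<forall>e>0. \<exists>w\<in>span (\<phi> ` {1..}). nrm (x - w) < e)"

definition dirichlet_eigenbasis :: "'a::euclidean_space set \<Rightarrow> real \<Rightarrow> (nat \<Rightarrow> 'a L2) \<Rightarrow> bool" where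
  "dirichlet_eigenbasis \<Omega> \<kappa> \<phi> \<longleftrightarrow>
     (\<forall>n\<ge>1. dirichlet_eigenfunction \<Omega> \<kappa> (\<phi> n)) \<and>
     (\<forall>m\<ge>1. \<forall>n\<ge>1. \<phi> m \<bullet> \<phi> n = (if m = n then 1 else 0)) \<and>
     complete_in \<phi> (L2_on \<Omega>) norm \<and>
     (\<forall>m\<ge>1. \<forall>n\<ge>1. m \<noteq> n \<longrightarrow> H10_inner \<Omega> \<kappa> (\<phi> m) (\<phi> n) = 0) \<and>
     complete_in \<phi> (H10 \<Omega>) (H10_norm \<Omega> \<kappa>)"

definition Q_proj :: "'a::euclidean_space set \<Rightarrow> real \<Rightarrow> (nat \<Rightarrow> 'a L2) \<Rightarrow> nat \<Rightarrow> 'a L2 \<Rightarrow> 'a L2" where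
  "Q_proj \<Omega> \<kappa> \<phi> n = orthogonal_projection (H10_inner \<Omega> \<kappa>) (eigenspan \<phi> n)"

definition Q_tilde :: "(nat \<Rightarrow> 'a::euclidean_space L2) \<Rightarrow> nat \<Rightarrow> 'a L2 \<Rightarrow> 'a L2" where
  "Q_tilde \<phi> n = orthogonal_projection inner (eigenspan \<phi> n)"

definition P_tilde ::
  "(nat \<Rightarrow> 'a::euclidean_space L2) \<Rightarrow> nat \<Rightarrow> (real \<Rightarrow> 'a L2) \<Rightarrow> real \<Rightarrow> 'a L2" where
  "P_tilde \<phi> n f = (\<lambda>t. Q_tilde \<phi> n (f t))"

definition eigen_combinations ::
  "real set \<Rightarrow> (nat \<Rightarrow> 'b::real_vector) \<Rightarrow> nat \<Rightarrow> (real \<Rightarrow> 'b) set" where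
  "eigen_combinations J \<phi> n = {f. \<exists>\<alpha>. (\<forall>k\<in>{1..n}. continuous_on J (\<alpha> k)) \<and>
     (\<forall>t\<in>J. f t = (\<Sum>k=1..n. \<alpha> k t *\<^sub>R \<phi> k))}"

text \<open>The spaces \<open>\<P>\<^sub>n\<close> and \<open>\<P>\<^sub>n\<close>-tilde, as subspaces of \<open>C(J; H\<^sup>1\<^sub>0(\<Omega>))\<close> and \<open>C(J; L\<^sup>2(\<Omega>))\<close>.\<close>

definition P_space ::
  "'a::euclidean_space set \<Rightarrow> real \<Rightarrow> real set \<Rightarrow> (nat \<Rightarrow> 'a L2) \<Rightarrow> nat \<Rightarrow> (real \<Rightarrow> 'a L2) set" where
  "P_space \<Omega> \<kappa> J \<phi> n = C_on J (H10 \<Omega>) (H10_norm \<Omega> \<kappa>) \<inter> eigen_combinations J \<phi> n"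

definition P_tilde_space ::
  "'a::euclidean_space set \<Rightarrow> real set \<Rightarrow> (nat \<Rightarrow> 'a L2) \<Rightarrow> nat \<Rightarrow> (real \<Rightarrow> 'a L2) set" where
  "P_tilde_space \<Omega> J \<phi> n = C_on J (L2_on \<Omega>) norm \<inter> eigen_combinations J \<phi> n"

definition galerkin ::
  "'a::euclidean_space set \<Rightarrow> real \<Rightarrow> (real \<Rightarrow> 'a L2 \<times> 'a L2 \<Rightarrow> 'a L2 \<times> 'a L2) \<Rightarrow> (nat \<Rightarrow> 'a L2) \<Rightarrow>
    (real \<Rightarrow> 'a L2) \<Rightarrow> 'a L2 \<times> 'a L2 \<Rightarrow> nat \<Rightarrow> real \<Rightarrow> 'a L2 \<times> 'a L2" where
  "galerkin \<Omega> \<kappa> T \<phi> F G n t =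
     T t (Q_proj \<Omega> \<kappa> \<phi> n (fst G), Q_tilde \<phi> n (snd G)) +
     integral_wrt (energy_space \<Omega>) (energy_norm \<Omega> \<kappa>) 0 t
       (\<lambda>s. T (t - s) (0, P_tilde \<phi> n F s))"

end

theory Submission
  imports Defs
begin

text \<open>
  On each plane spanned by \<open>(\<phi>\<^sub>k, 0)\<close> and \<open>(0, \<phi>\<^sub>k)\<close> the semigroup acts by the fundamental matrix of
  \<open>a' = b\<close>, \<open>b' = - \<lambda>\<^sub>k a - \<nu> b\<close>. Indeed, for \<open>x\<close> in the domain of the generator the coefficients of
  \<open>T t x\<close> along every \<open>\<phi>\<^sub>j\<close> solve this equation with \<open>\<lambda>\<^sub>j\<close>, so modes absent initially stay absent.
  Hence the coefficients of the Galerkin approximation are given by the scalar variation-of-constants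
  formula, which the coefficients of a weak solution satisfy as well (test with \<open>\<phi>\<^sub>k\<close>). So the
  \<open>n\<close>-th approximation is the orthogonal projection of the weak solution in the energy space, and the
  projections converge uniformly on the compact curve described by the solution.
\<close>

section \<open>Test functions\<close>

text \<open>\<open>weak_partial\<close>, \<open>orthogonal_projection\<close> and
  \<open>integral_wrt\<close> are definite descriptions, so each needs a uniqueness argument before
  it can be computed. For weak derivatives this is the density of the test functions; for
  projections and integrals in the \<open>H10\<close> and energy norms it is the Poincare
  inequality, which makes these seminorms definite. The same inequality bounds the norm of the
  product type by the energy norm, so that differentiability in the energy norm becomes ordinary
  differentiability and scalar calculus applies to the coefficients. Green's formula gives
  \<open>H10_inner \<Omega> \<kappa> u (\<phi> k) = lam k * (u \<bullet> \<phi> k)\<close>. Hence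
  the projections in \<open>H10\<close> and in L2 truncate the same expansion. The truncated data
  involve finitely many fixed vectors, so the vector integral in \<open>galerkin\<close> reduces to
  scalar gauge integrals. Pointwise convergence of the projections becomes uniform on the curve
  because the error maps are contractions.\<close>

lemma integral_translate_lborel:
  fixes f :: "'a::euclidean_space \<Rightarrow> real"
  assumes "f \<in> borel_measurable borel"
  shows "(\<integral>x. f (c + x) \<partial>lborel) = (\<integral>x. f x \<partial>lborel)"
proof -
  have "(\<integral>x. f x \<partial>lborel) = (\<integral>x. f x \<partial>(distr lborel borel ((+) c)))"
    by (simp add: lborel_distr_plus)
  also have "\<dots> = (\<integral>x. f (c + x) \<partial>lborel)"
    using assms by (intro integral_distr) auto
  finally show ?thesis by simp
qed

lemma bounded_of_compact_support:
  fixes f :: "'a::topological_space \<Rightarrow> real"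
  assumes "continuous_on UNIV f" "compact K" "\<And>x. x \<notin> K \<Longrightarrow> f x = 0"
  obtains M where "M \<ge> 0" "\<And>x. \<bar>f x\<bar> \<le> M"
proof -
  have "bounded (f ` K)"
    using assms(2) continuous_on_subset[OF assms(1)] by (intro compact_imp_bounded compact_continuous_image) auto
  then obtain M where M: "\<And>x. x \<in> K \<Longrightarrow> \<bar>f x\<bar> \<le> M"
    by (auto simp: bounded_iff)
  have "\<bar>f x\<bar> \<le> max M 0" for x
    using M[of x] assms(3)[of x] by (cases "x \<in> K") auto
  then show ?thesis using that[of "max M 0"] by auto
qed

text \<open>Translation invariance makes the integral of every difference quotient vanish; these quotients
  are dominated by the maximum of the derivative on a fixed ball.\<close>

lemma integral_directional_derivative_eq_0:
  fixes h :: "'a::euclidean_space \<Rightarrow> real"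
  assumes deriv: "\<And>x. (h has_derivative h' x) (at x)"
    and cont: "continuous_on UNIV (\<lambda>x. h' x i)"
    and K: "compact K" "\<And>x. x \<notin> K \<Longrightarrow> h x = 0" "\<And>x. x \<notin> K \<Longrightarrow> h' x i = 0"
  shows "(\<integral>x. h' x i \<partial>lborel) = 0"
proof -
  obtain R where R: "K \<subseteq> cball 0 R"
    using compact_imp_bounded[OF K(1)] by (auto simp: bounded_iff subset_iff)
  obtain M where M: "M \<ge> 0" "\<And>x. \<bar>h' x i\<bar> \<le> M"
    using bounded_of_compact_support[OF cont K(1) K(3)] by blast
  have conth: "continuous_on UNIV h"
    using deriv by (meson continuous_at_imp_continuous_on has_derivative_continuous)
  have hm: "h \<in> borel_measurable borel"
    using conth by (rule borel_measurable_continuous_onI)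
  have inth: "integrable lborel h"
  proof -
    have "integrable lborel (\<lambda>x. indicator K x *\<^sub>R h x)"
      using K(1) continuous_on_subset[OF conth] by (intro borel_integrable_compact) auto
    moreover have "(\<lambda>x. indicator K x *\<^sub>R h x) = h"
      by (intro ext) (auto simp: indicator_def K(2))
    ultimately show ?thesis by simp
  qed
  define q where "q = (\<lambda>n x. (h (inverse (real (Suc n)) *\<^sub>R i + x) - h x) * real (Suc n))"
  have q_deriv: "((\<lambda>t. h (x + t *\<^sub>R i)) has_real_derivative h' (x + t *\<^sub>R i) i) (at t)" for x t
  proof -
    have "((\<lambda>t. h (x + t *\<^sub>R i)) has_derivative (\<lambda>s. h' (x + t *\<^sub>R i) (s *\<^sub>R i))) (at t)"
      by (rule has_derivative_compose[OF _ deriv]) (auto intro!: derivative_eq_intros)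
    moreover have "h' (x + t *\<^sub>R i) (s *\<^sub>R i) = h' (x + t *\<^sub>R i) i * s" for s
      using has_derivative_bounded_linear[OF deriv]
      by (metis linear_scale bounded_linear.linear mult.commute real_scaleR_def)
    ultimately show ?thesis by (simp add: has_field_derivative_def)
  qed
  have q_bound: "\<bar>q n x\<bar> \<le> M" for n x
  proof -
    define d where "d = inverse (real (Suc n))"
    have "d > 0" by (simp add: d_def)
    then obtain z where "h (x + d *\<^sub>R i) - h (x + 0 *\<^sub>R i) = (d - 0) * h' (x + z *\<^sub>R i) i"
      using MVT2[of 0 d "\<lambda>t. h (x + t *\<^sub>R i)" "\<lambda>t. h' (x + t *\<^sub>R i) i"] q_deriv by blast
    then have "q n x = h' (x + z *\<^sub>R i) i"
      by (simp add: q_def d_def add.commute field_simps)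
    then show ?thesis using M by simp
  qed
  \<comment> \<open>The shifts have length at most \<open>norm i\<close>, so this one ball contains
    the supports of all quotients, as dominated convergence requires.\<close>
  have q_supp: "q n x = 0" if "x \<notin> cball 0 (R + norm i)" for n x
  proof -
    have "norm (inverse (real (Suc n)) *\<^sub>R i) \<le> norm i"
      by (simp add: field_simps mult_left_le)
    moreover have "norm x \<le> norm (inverse (real (Suc n)) *\<^sub>R i + x) + norm (inverse (real (Suc n)) *\<^sub>R i)"
      by (metis add_diff_cancel_left' norm_triangle_ineq4 )
    ultimately have "inverse (real (Suc n)) *\<^sub>R i + x \<notin> K" "x \<notin> K"
      using R that norm_ge_zero[of i] by (auto simp: subset_iff mem_cball_0 simp del: norm_ge_zero)
    then show ?thesis using K(2) by (simp add: q_def)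
  qed
  have "(\<lambda>n. \<integral>x. q n x \<partial>lborel) \<longlonglongrightarrow> (\<integral>x. h' x i \<partial>lborel)"
  proof (rule integral_dominated_convergence[where w = "\<lambda>x. indicator (cball 0 (R + norm i)) x *\<^sub>R M"])
    show "(\<lambda>x. h' x i) \<in> borel_measurable lborel"
      using cont by (simp add: borel_measurable_continuous_onI)
    show "q n \<in> borel_measurable lborel" for n
      using hm unfolding q_def by measurable
    show "integrable lborel (\<lambda>x::'a. indicator (cball 0 (R + norm i)) x *\<^sub>R M)"
      by (intro borel_integrable_compact) auto
    show "AE x in lborel. (\<lambda>n. q n x) \<longlonglongrightarrow> h' x i"
    proof (rule AE_I2)
      fix x
      have "((\<lambda>d. (h (x + d *\<^sub>R i) - h x) / d) \<longlongrightarrow> h' x i) (at 0)"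
        using q_deriv[of x 0] by (simp add: has_field_derivative_def DERIV_def field_has_derivative_at)
      moreover have "filterlim (\<lambda>n. inverse (real (Suc n))) (at 0) sequentially"
        using LIMSEQ_inverse_real_of_nat by (auto simp: filterlim_at)
      ultimately have "(\<lambda>n. (h (x + inverse (real (Suc n)) *\<^sub>R i) - h x) / inverse (real (Suc n))) \<longlonglongrightarrow> h' x i"
        by (rule filterlim_compose)
      then show "(\<lambda>n. q n x) \<longlonglongrightarrow> h' x i"
        by (simp add: q_def add.commute divide_inverse)
    qed
    show "AE x in lborel. norm (q n x) \<le> indicator (cball 0 (R + norm i)) x *\<^sub>R M" for n
      using q_bound q_supp by (auto simp: indicator_def)
  qed
  moreover have "(\<integral>x. q n x \<partial>lborel) = 0" for n
  proof -
    have "integrable lborel (\<lambda>x. h (inverse (real (Suc n)) *\<^sub>R i + x))"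
      using inth hm by (subst (asm) lborel_distr_plus[symmetric, of "inverse (real (Suc n)) *\<^sub>R i"])
        (simp add: integrable_distr_eq)
    then show ?thesis
      unfolding q_def using inth hm integral_translate_lborel[OF hm, of "inverse (real (Suc n)) *\<^sub>R i"] by simp
  qed
  ultimately show ?thesis by (simp add: LIMSEQ_const_iff)
qed

section \<open>Smoothness and the algebra of test functions\<close>

lemma has_derivative_frechet_derivative:
  assumes "(f has_derivative f') (at x)"
  shows "frechet_derivative f (at x) = f'"
  using frechet_derivative_at[OF assms] by simp

lemma C_diff_add: "C_diff k f \<Longrightarrow> C_diff k g \<Longrightarrow> C_diff k (\<lambda>x. f x + g x)"
proof (induction k arbitrary: f g)
  case 0
  then show ?case by (auto intro: continuous_on_add)
next
  case (Suc k)
  then have "frechet_derivative (\<lambda>x. f x + g x) (at x) =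
      (\<lambda>v. frechet_derivative f (at x) v + frechet_derivative g (at x) v)" for x
    by (intro has_derivative_frechet_derivative has_derivative_add)
      (auto simp: frechet_derivative_works)
  with Suc show ?case by auto
qed

lemma C_diff_cmult: "C_diff k f \<Longrightarrow> C_diff k (\<lambda>x. c * f x)"
proof (induction k arbitrary: f)
  case 0
  then show ?case by (auto intro: continuous_on_mult)
next
  case (Suc k)
  then have "frechet_derivative (\<lambda>x. c * f x) (at x) = (\<lambda>v. c * frechet_derivative f (at x) v)" for x
    by (intro has_derivative_frechet_derivative has_derivative_mult_right)
      (auto simp: frechet_derivative_works)
  with Suc show ?case by auto
qed

lemma test_function_C_diff: "test_function \<Omega> \<psi> \<Longrightarrow> C_diff k \<psi>"
  by (simp add: test_function_def)

lemma test_function_continuous: "test_function \<Omega> \<psi> \<Longrightarrow> continuous_on UNIV \<psi>"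
  using test_function_C_diff[of \<Omega> \<psi> 0] by simp

lemma test_function_has_derivative:
  "test_function \<Omega> \<psi> \<Longrightarrow> (\<psi> has_derivative frechet_derivative \<psi> (at x)) (at x)"
  using test_function_C_diff[of \<Omega> \<psi> 1] by (simp add: frechet_derivative_works)

lemma closure_support_mono:
  assumes "{x. f x \<noteq> 0} \<subseteq> closure {x. g x \<noteq> (0::real)}"
  shows "closure {x. f x \<noteq> 0} \<subseteq> closure {x. g x \<noteq> 0}"
  using closure_mono[OF assms] by simp

lemma test_function_subset_support:
  assumes "test_function \<Omega> \<psi>" "\<And>k. C_diff k f" "{x. f x \<noteq> 0} \<subseteq> closure {x. \<psi> x \<noteq> 0}"
  shows "test_function \<Omega> f"
proof -
  have "closure {x. f x \<noteq> 0} \<subseteq> closure {x. \<psi> x \<noteq> 0}"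
    using assms(3) by (rule closure_support_mono)
  moreover have "compact (closure {x. f x \<noteq> 0})"
    using calculation assms(1) unfolding test_function_def
    by (meson bounded_subset closed_closure compact_eq_bounded_closed)
  ultimately show ?thesis using assms by (auto simp: test_function_def)
qed

text \<open>The complement of the closed support is open, so \<psi> vanishes identically near
  \<open>x\<close>.\<close>

lemma frechet_derivative_outside_support:
  assumes "x \<notin> closure {x. \<psi> x \<noteq> (0::real)}"
  shows "frechet_derivative \<psi> (at x) = (\<lambda>_. 0)"
proof (rule has_derivative_frechet_derivative)
  show "(\<psi> has_derivative (\<lambda>_. 0)) (at x)"
  proof (rule has_derivative_transform_within_open[of "\<lambda>_. 0" _ x UNIV "- closure {x. \<psi> x \<noteq> 0}"])
    show "0 = \<psi> y" if "y \<in> - closure {x. \<psi> x \<noteq> 0}" for y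
      using that closure_subset[of "{x. \<psi> x \<noteq> 0}"] by auto
  qed (use assms in auto)
qed

lemma test_function_deriv:
  assumes "test_function \<Omega> \<psi>" "i \<in> Basis"
  shows "test_function \<Omega> (\<lambda>x. frechet_derivative \<psi> (at x) i)"
proof (rule test_function_subset_support[OF assms(1)])
  show "C_diff k (\<lambda>x. frechet_derivative \<psi> (at x) i)" for k
    using test_function_C_diff[OF assms(1), of "Suc k"] assms(2) by simp
  show "{x. frechet_derivative \<psi> (at x) i \<noteq> 0} \<subseteq> closure {x. \<psi> x \<noteq> 0}"
    by (auto simp: frechet_derivative_outside_support intro: ccontr)
qed

lemma test_function_cmult: "test_function \<Omega> \<psi> \<Longrightarrow> test_function \<Omega> (\<lambda>x. c * \<psi> x)"
  by (rule test_function_subset_support)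
    (use closure_subset[of "{x. \<psi> x \<noteq> 0}"] in \<open>auto intro: C_diff_cmult test_function_C_diff\<close>)

lemma test_function_add:
  assumes "test_function \<Omega> \<psi>" "test_function \<Omega> \<eta>"
  shows "test_function \<Omega> (\<lambda>x. \<psi> x + \<eta> x)"
proof -
  have sub: "closure {x. \<psi> x + \<eta> x \<noteq> 0} \<subseteq> closure {x. \<psi> x \<noteq> 0} \<union> closure {x. \<eta> x \<noteq> 0}"
    unfolding closure_Un[symmetric] by (rule closure_mono) auto
  moreover have "compact (closure {x. \<psi> x \<noteq> 0} \<union> closure {x. \<eta> x \<noteq> 0})"
    using assms by (auto simp: test_function_def)
  ultimately have "compact (closure {x. \<psi> x + \<eta> x \<noteq> 0})"
    by (meson bounded_subset closed_closure compact_eq_bounded_closed)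
  then show ?thesis using assms sub by (auto simp: test_function_def intro: C_diff_add)
qed

lemma test_function_zero: "test_function \<Omega> (\<lambda>_. 0)"
proof -
  have "C_diff k (\<lambda>_::'a. 0::real)" for k
    by (induction k) auto
  then show ?thesis by (simp add: test_function_def)
qed

lemma test_function_outside: "test_function \<Omega> \<psi> \<Longrightarrow> x \<notin> \<Omega> \<Longrightarrow> \<psi> x = 0"
  using closure_subset[of "{x. \<psi> x \<noteq> 0}"] by (auto simp: test_function_def)

text \<open>Stated beyond test functions because the Poincare inequality applies it to
  \<open>(x \<bullet> i) * \<psi> x\<close>.\<close>

lemma square_integrable_compact_support:
  assumes "continuous_on UNIV f" "compact K" "\<And>x. x \<notin> K \<Longrightarrow> f x = 0"
  shows "square_integrable f"
proof -
  have "integrable lborel (\<lambda>x. indicator K x *\<^sub>R (f x)\<^sup>2)"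
    using assms(2) continuous_on_subset[OF assms(1)]
    by (intro borel_integrable_compact continuous_on_power) auto
  moreover have "(\<lambda>x. indicator K x *\<^sub>R (f x)\<^sup>2) = (\<lambda>x. (f x)\<^sup>2)"
    by (intro ext) (auto simp: indicator_def assms(3))
  ultimately show ?thesis
    using assms(1) by (simp add: square_integrable_def borel_measurable_continuous_onI)
qed

lemma square_integrable_test_function:
  assumes "test_function \<Omega> \<psi>"
  shows "square_integrable \<psi>"
proof (rule square_integrable_compact_support)
  show "compact (closure {x. \<psi> x \<noteq> 0})"
    using assms by (simp add: test_function_def)
  show "\<psi> x = 0" if "x \<notin> closure {x. \<psi> x \<noteq> 0}" for x
    using that closure_subset[of "{x. \<psi> x \<noteq> 0}"] by auto
qed (rule test_function_continuous[OF assms])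

section \<open>Semi-inner products on a subspace\<close>

text \<open>The carriers depend on \<open>\<Omega>\<close> and so cannot be types; this locale
  supplies the inner product calculus for H1, H10, L2 and the energy space at once. Laws are
  required on \<open>X\<close> only, since weak derivatives are linear only where they exist.
  Definiteness is left out because for \<open>H10_inner\<close> it is a theorem, a consequence of
  the Poincare inequality; results that rely on it take it as the premise
  \<open>definite\<close>.\<close>

locale semi_inner =
  fixes X :: "'b::real_vector set" and ip :: "'b \<Rightarrow> 'b \<Rightarrow> real" and nrm :: "'b \<Rightarrow> real"
  assumes subspace_X: "subspace X"
    and ip_add_left: "\<lbrakk>x \<in> X; y \<in> X; z \<in> X\<rbrakk> \<Longrightarrow> ip (x + y) z = ip x z + ip y z"
    and ip_scaleR_left: "\<lbrakk>x \<in> X; y \<in> X\<rbrakk> \<Longrightarrow> ip (c *\<^sub>R x) y = c * ip x y"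
    and ip_commute: "\<lbrakk>x \<in> X; y \<in> X\<rbrakk> \<Longrightarrow> ip x y = ip y x"
    and ip_nonneg: "x \<in> X \<Longrightarrow> 0 \<le> ip x x"
    and nrm_eq_sqrt: "x \<in> X \<Longrightarrow> nrm x = sqrt (ip x x)"
begin

lemmas X_add = subspace_add[OF subspace_X]
  and X_diff = subspace_diff[OF subspace_X]
  and X_scaleR = subspace_scale[OF subspace_X]
  and X_0 = subspace_0[OF subspace_X]
  and X_sum = subspace_sum[OF subspace_X]

lemma ip_add_right: "\<lbrakk>x \<in> X; y \<in> X; z \<in> X\<rbrakk> \<Longrightarrow> ip x (y + z) = ip x y + ip x z"
  by (metis X_add ip_add_left ip_commute)

lemma ip_scaleR_right: "\<lbrakk>x \<in> X; y \<in> X\<rbrakk> \<Longrightarrow> ip x (c *\<^sub>R y) = c * ip x y"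
  by (metis X_scaleR ip_scaleR_left ip_commute)

lemma ip_diff_left: "\<lbrakk>x \<in> X; y \<in> X; z \<in> X\<rbrakk> \<Longrightarrow> ip (x - y) z = ip x z - ip y z"
  using ip_add_left[of x "(-1) *\<^sub>R y" z] X_scaleR[of y "-1"] ip_scaleR_left[of y z "-1"] by simp

lemma ip_diff_right: "\<lbrakk>x \<in> X; y \<in> X; z \<in> X\<rbrakk> \<Longrightarrow> ip x (y - z) = ip x y - ip x z"
  by (metis X_diff ip_diff_left ip_commute)

lemma ip_0_left: "y \<in> X \<Longrightarrow> ip 0 y = 0"
  using ip_scaleR_left[of 0 y 0] X_0 by simp

lemma nrm_nonneg: "x \<in> X \<Longrightarrow> 0 \<le> nrm x"
  by (simp add: nrm_eq_sqrt ip_nonneg)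

lemma nrm_power2: "x \<in> X \<Longrightarrow> (nrm x)\<^sup>2 = ip x x"
  by (simp add: nrm_eq_sqrt ip_nonneg)

lemma nrm_0: "nrm 0 = 0"
  by (simp add: nrm_eq_sqrt X_0 ip_0_left)

lemma nrm_scaleR: "x \<in> X \<Longrightarrow> nrm (c *\<^sub>R x) = \<bar>c\<bar> * nrm x"
  by (simp add: nrm_eq_sqrt X_scaleR ip_scaleR_left ip_scaleR_right real_sqrt_mult)

lemma nrm_minus_commute: "\<lbrakk>x \<in> X; y \<in> X\<rbrakk> \<Longrightarrow> nrm (x - y) = nrm (y - x)"
  using nrm_scaleR[of "y - x" "-1"] X_diff by simp

lemma ip_Cauchy_Schwarz:
  assumes "x \<in> X" "y \<in> X"
  shows "\<bar>ip x y\<bar> \<le> nrm x * nrm y"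
proof -
  have pos: "0 \<le> ip x x - 2 * t * ip x y + t\<^sup>2 * ip y y" for t
    using ip_nonneg[of "x - t *\<^sub>R y"] assms
    by (simp add: X_diff X_scaleR ip_diff_left ip_diff_right ip_scaleR_left ip_scaleR_right
        ip_commute[of y x] power2_eq_square algebra_simps)
  have "(ip x y)\<^sup>2 \<le> ip x x * ip y y"
  proof (cases "ip y y = 0")
    case True
    have "ip x y = 0"
    proof (rule ccontr)
      assume "ip x y \<noteq> 0"
      \<comment> \<open>With \<open>ip y y = 0\<close> the bound \<open>pos\<close> is affine in
        \<open>t\<close>; this \<open>t\<close> makes its value -1.\<close>
      then show False
        using pos[of "(ip x x + 1) / (2 * ip x y)"] True by simp
    qed
    then show ?thesis using True by simp
  next
    case False
    then have y: "ip y y > 0" using ip_nonneg[OF assms(2)] by simp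
    \<comment> \<open>\<open>ip x y / ip y y\<close> is the minimiser of the quadratic in
      \<open>pos\<close>.\<close>
    have "0 \<le> (ip x x - 2 * (ip x y / ip y y) * ip x y + (ip x y / ip y y)\<^sup>2 * ip y y) * ip y y"
      using pos[of "ip x y / ip y y"] y by (intro mult_nonneg_nonneg) auto
    also have "\<dots> = ip x x * ip y y - (ip x y)\<^sup>2"
      using y by (simp add: field_simps power2_eq_square)
    finally show ?thesis by simp
  qed
  then show ?thesis
    using assms by (simp add: nrm_eq_sqrt real_sqrt_mult[symmetric] real_le_rsqrt)
qed

lemma nrm_triangle:
  assumes "x \<in> X" "y \<in> X"
  shows "nrm (x + y) \<le> nrm x + nrm y"
proof (rule power2_le_imp_le)
  have "(nrm (x + y))\<^sup>2 = (nrm x)\<^sup>2 + 2 * ip x y + (nrm y)\<^sup>2"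
    using assms by (simp add: nrm_power2 X_add ip_add_left ip_add_right ip_commute[of y x])
  then show "(nrm (x + y))\<^sup>2 \<le> (nrm x + nrm y)\<^sup>2"
    using ip_Cauchy_Schwarz[OF assms] by (simp add: power2_sum)
qed (use assms nrm_nonneg in simp)

lemma nrm_triangle_between:
  assumes "x \<in> X" "y \<in> X" "z \<in> X"
  shows "nrm (x - z) \<le> nrm (x - y) + nrm (y - z)"
  using nrm_triangle[of "x - y" "y - z"] assms by (simp add: X_diff)

lemma nrm_sum_le: "(\<And>k. k \<in> A \<Longrightarrow> f k \<in> X) \<Longrightarrow> nrm (\<Sum>k\<in>A. f k) \<le> (\<Sum>k\<in>A. nrm (f k))"
proof (induction A rule: infinite_finite_induct)
  case (insert k A)
  then have "nrm (f k + (\<Sum>k\<in>A. f k)) \<le> nrm (f k) + nrm (\<Sum>k\<in>A. f k)"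
    by (intro nrm_triangle X_sum) auto
  with insert show ?case by fastforce
qed (auto simp: nrm_0)

text \<open>Pythagoras for \<open>x = (x - p) + p\<close>. Applied to a difference
  \<open>x - w\<close> it will give the best approximation property of the energy
  projection.\<close>

lemma nrm_diff_projection_le:
  assumes "x \<in> X" "p \<in> X" "ip (x - p) p = 0"
  shows "nrm (x - p) \<le> nrm x"
proof (rule power2_le_imp_le)
  have "ip x x = ip (x - p) (x - p) + 2 * ip (x - p) p + ip p p"
    using assms by (simp add: X_diff ip_diff_left ip_diff_right ip_commute[of p x])
  then show "(nrm (x - p))\<^sup>2 \<le> (nrm x)\<^sup>2"
    using assms by (simp add: nrm_power2 X_diff ip_nonneg)
qed (use assms nrm_nonneg in simp)

text \<open>The vectors \<open>e k\<close> are fixed, so continuity of the curve follows from that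
  of its coefficients, whichever norm the carrier has.\<close>

lemma C_on_sum_scaleR:
  assumes "finite A" "\<And>k. k \<in> A \<Longrightarrow> e k \<in> X" "\<And>k. k \<in> A \<Longrightarrow> continuous_on J (\<alpha> k)"
    and f: "\<And>t. t \<in> J \<Longrightarrow> f t = (\<Sum>k\<in>A. \<alpha> k t *\<^sub>R e k)"
  shows "f \<in> C_on J X nrm"
proof -
  have mem: "f t \<in> X" if "t \<in> J" for t
    using assms that by (simp add: X_sum X_scaleR)
  have "((\<lambda>s. nrm (f s - f t)) \<longlongrightarrow> 0) (at t within J)" if t: "t \<in> J" for t
  proof (rule tendsto_sandwich[of "\<lambda>_. 0" _ _ "\<lambda>s. \<Sum>k\<in>A. \<bar>\<alpha> k s - \<alpha> k t\<bar> * nrm (e k)"])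
    show "\<forall>\<^sub>F s in at t within J. 0 \<le> nrm (f s - f t)"
      using mem t by (auto simp: eventually_at_filter intro!: always_eventually nrm_nonneg X_diff)
    have "nrm (f s - f t) \<le> (\<Sum>k\<in>A. \<bar>\<alpha> k s - \<alpha> k t\<bar> * nrm (e k))" if "s \<in> J" for s
    proof -
      have "f s - f t = (\<Sum>k\<in>A. (\<alpha> k s - \<alpha> k t) *\<^sub>R e k)"
        using that t by (simp add: f scaleR_diff_left sum_subtractf)
      also have "nrm \<dots> \<le> (\<Sum>k\<in>A. nrm ((\<alpha> k s - \<alpha> k t) *\<^sub>R e k))"
        using assms(2) by (intro nrm_sum_le X_scaleR)
      finally show ?thesis using assms(2) by (simp add: nrm_scaleR)
    qed
    then show "\<forall>\<^sub>F s in at t within J. nrm (f s - f t) \<le> (\<Sum>k\<in>A. \<bar>\<alpha> k s - \<alpha> k t\<bar> * nrm (e k))"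
      by (auto simp: eventually_at_filter intro!: always_eventually)
    have "((\<lambda>s. \<Sum>k\<in>A. \<bar>\<alpha> k s - \<alpha> k t\<bar> * nrm (e k)) \<longlongrightarrow> (\<Sum>k\<in>A. \<bar>\<alpha> k t - \<alpha> k t\<bar> * nrm (e k))) (at t within J)"
      using assms(3) t by (intro tendsto_intros) (auto simp: continuous_on_def)
    then show "((\<lambda>s. \<Sum>k\<in>A. \<bar>\<alpha> k s - \<alpha> k t\<bar> * nrm (e k)) \<longlongrightarrow> 0) (at t within J)"
      by simp
  qed auto
  with mem show ?thesis by (auto simp: C_on_def)
qed

text \<open>By \<open>R_diff\<close> and \<open>R_le\<close> the maps \<open>R n\<close> are
  1-Lipschitz. Smallness at finitely many parameters therefore spreads to all of \<open>J\<close>,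
  because \<open>f\<close> varies by less than \<open>e / 2\<close> near each of them.\<close>

lemma uniform_limit_contractions:
  assumes J: "compact J" and f: "f \<in> C_on J X nrm"
    and R_mem: "\<And>n x. x \<in> X \<Longrightarrow> R n x \<in> X"
    and R_diff: "\<And>n x y. \<lbrakk>x \<in> X; y \<in> X\<rbrakk> \<Longrightarrow> R n (x - y) = R n x - R n y"
    and R_le: "\<And>n x. x \<in> X \<Longrightarrow> nrm (R n x) \<le> nrm x"
    and R_lim: "\<And>x. x \<in> X \<Longrightarrow> (\<lambda>n. nrm (R n x)) \<longlonglongrightarrow> 0"
  shows "uniform_limit J (\<lambda>n t. nrm (R n (f t))) (\<lambda>_. 0) sequentially"
proof (rule uniform_limitI)
  fix e :: real assume e: "e > 0"
  have mem: "f t \<in> X" if "t \<in> J" for t using f that by (simp add: C_on_def)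
  have "\<exists>d>0. \<forall>s\<in>J. dist s t < d \<longrightarrow> nrm (f s - f t) < e / 2" if t: "t \<in> J" for t
  proof -
    have "((\<lambda>s. nrm (f s - f t)) \<longlongrightarrow> 0) (at t within J)"
      using f t by (simp add: C_on_def)
    then have "\<forall>\<^sub>F s in at t within J. dist (nrm (f s - f t)) 0 < e / 2"
      using e by (intro tendstoD) auto
    then obtain d where d: "d > 0"
      "\<And>s. \<lbrakk>s \<in> J; s \<noteq> t; dist s t < d\<rbrakk> \<Longrightarrow> dist (nrm (f s - f t)) 0 < e / 2"
      unfolding eventually_at by blast
    \<comment> \<open>The filter says nothing about \<open>s = t\<close>; there the difference is
      0.\<close>
    have "nrm (f s - f t) < e / 2" if "s \<in> J" "dist s t < d" for s
      using d(2)[of s] that e nrm_0 by (cases "s = t") auto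
    with d(1) show ?thesis by blast
  qed
  then obtain d where d: "\<And>t. t \<in> J \<Longrightarrow> d t > 0"
    "\<And>t s. \<lbrakk>t \<in> J; s \<in> J; dist s t < d t\<rbrakk> \<Longrightarrow> nrm (f s - f t) < e / 2"
    by metis
  obtain C where C: "C \<subseteq> J" "finite C" "J \<subseteq> (\<Union>t\<in>C. ball t (d t))"
    using compactE_image[OF J, of J "\<lambda>t. ball t (d t)"] d(1) by force
  have "\<forall>\<^sub>F n in sequentially. nrm (R n (f t)) < e / 2" if "t \<in> C" for t
    using R_lim[OF mem, of t] C(1) that e
    by (intro order_tendstoD(2)[where y = 0]) auto
  then have "\<forall>\<^sub>F n in sequentially. \<forall>t\<in>C. nrm (R n (f t)) < e / 2"
    using C(2) by (simp add: eventually_ball_finite)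
  then show "\<forall>\<^sub>F n in sequentially. \<forall>t\<in>J. dist (nrm (R n (f t))) 0 < e"
  proof eventually_elim
    case (elim n)
    show ?case
    proof
      fix s assume s: "s \<in> J"
      then obtain t where t: "t \<in> C" "dist s t < d t"
        using C(3) by (auto simp: dist_commute)
      then have tJ: "t \<in> J" using C(1) by auto
      have "nrm (R n (f s)) = nrm (R n (f s - f t) + R n (f t))"
        using mem s tJ by (simp add: R_diff)
      also have "\<dots> \<le> nrm (R n (f s - f t)) + nrm (R n (f t))"
        using mem s tJ by (intro nrm_triangle R_mem X_diff)
      also have "nrm (R n (f s - f t)) \<le> nrm (f s - f t)"
        using mem s tJ by (intro R_le X_diff)
      also have "nrm (f s - f t) < e / 2"
        using d(2) s tJ t by blast
      also have "nrm (R n (f t)) < e / 2"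
        using elim t by blast
      finally show "dist (nrm (R n (f s))) 0 < e"
        using nrm_nonneg[OF R_mem[OF mem[OF s]]] by simp
    qed
  qed
qed

section \<open>Gauge integrals and projections for the norm of a carrier\<close>

lemma tagged_sum_mem:
  assumes "p tagged_division_of {a..b}" "\<And>s. s \<in> {a..b} \<Longrightarrow> f s \<in> X"
  shows "(\<Sum>(x, K)\<in>p. measure lborel K *\<^sub>R f x) \<in> X"
proof (rule X_sum, clarify)
  fix x K assume "(x, K) \<in> p"
  then have "x \<in> {a..b}"
    using tagged_division_ofD(2,3)[OF assms(1)] by blast
  then show "measure lborel K *\<^sub>R f x \<in> X"
    using assms(2) X_scaleR by blast
qed

text \<open>Every Riemann sum of \<open>\<lambda>s. c s *\<^sub>R e\<close> is a scalar Riemann sum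
  times \<open>e\<close>, so a gauge for the scalar integral works once the tolerance is scaled by
  \<open>nrm e\<close>.\<close>

lemma has_integral_wrt_scaleR:
  assumes "e \<in> X" and c: "(c has_integral C) {a..b}"
  shows "has_integral_wrt nrm (\<lambda>s. c s *\<^sub>R e) (C *\<^sub>R e) a b"
  unfolding has_integral_wrt_def
proof (intro allI impI)
  fix \<epsilon> :: real assume "\<epsilon> > 0"
  \<comment> \<open>The summand 1 keeps the denominator positive when
    \<open>nrm e = 0\<close>.\<close>
  then have pos: "\<epsilon> / (nrm e + 1) > 0"
    using nrm_nonneg[OF assms(1)] by simp
  obtain \<gamma> where \<gamma>: "gauge \<gamma>" "\<And>p. p tagged_division_of {a..b} \<Longrightarrow> \<gamma> fine p \<Longrightarrow>
      norm ((\<Sum>(x, K)\<in>p. measure lborel K *\<^sub>R c x) - C) < \<epsilon> / (nrm e + 1)"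
    using c pos unfolding has_integral_real has_integral by (metis box_real(2))
  have "nrm ((\<Sum>(x, K)\<in>p. measure lborel K *\<^sub>R c x *\<^sub>R e) - C *\<^sub>R e) < \<epsilon>"
    if p: "p tagged_division_of {a..b}" "\<gamma> fine p" for p
  proof -
    have "(\<Sum>(x, K)\<in>p. measure lborel K *\<^sub>R c x *\<^sub>R e) - C *\<^sub>R e =
        ((\<Sum>(x, K)\<in>p. measure lborel K *\<^sub>R c x) - C) *\<^sub>R e"
      by (simp add: scaleR_diff_left scaleR_sum_left case_prod_unfold)
    then have "nrm ((\<Sum>(x, K)\<in>p. measure lborel K *\<^sub>R c x *\<^sub>R e) - C *\<^sub>R e) =
        \<bar>(\<Sum>(x, K)\<in>p. measure lborel K *\<^sub>R c x) - C\<bar> * nrm e"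
      using assms(1) by (simp add: nrm_scaleR)
    also have "\<dots> \<le> \<epsilon> / (nrm e + 1) * nrm e"
      using \<gamma>(2)[OF p] nrm_nonneg[OF assms(1)] by (intro mult_right_mono) auto
    also have "\<dots> < \<epsilon>"
      using \<open>\<epsilon> > 0\<close> nrm_nonneg[OF assms(1)] by (simp add: field_simps)
    finally show ?thesis .
  qed
  then show "\<exists>\<gamma>. gauge \<gamma> \<and> (\<forall>p. p tagged_division_of {a..b} \<and> \<gamma> fine p \<longrightarrow>
      nrm ((\<Sum>(x, K)\<in>p. measure lborel K *\<^sub>R c x *\<^sub>R e) - C *\<^sub>R e) < \<epsilon>)"
    using \<gamma>(1) by blast
qed

lemma has_integral_wrt_add:
  assumes f: "has_integral_wrt nrm f I a b" "I \<in> X" "\<And>s. s \<in> {a..b} \<Longrightarrow> f s \<in> X"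
    and g: "has_integral_wrt nrm g J a b" "J \<in> X" "\<And>s. s \<in> {a..b} \<Longrightarrow> g s \<in> X"
  shows "has_integral_wrt nrm (\<lambda>s. f s + g s) (I + J) a b"
  unfolding has_integral_wrt_def
proof (intro allI impI)
  fix \<epsilon> :: real assume "\<epsilon> > 0"
  then obtain \<gamma> \<delta> where \<gamma>: "gauge \<gamma>" "\<And>p. p tagged_division_of {a..b} \<Longrightarrow> \<gamma> fine p \<Longrightarrow>
      nrm ((\<Sum>(x, K)\<in>p. measure lborel K *\<^sub>R f x) - I) < \<epsilon> / 2"
    and \<delta>: "gauge \<delta>" "\<And>p. p tagged_division_of {a..b} \<Longrightarrow> \<delta> fine p \<Longrightarrow>
      nrm ((\<Sum>(x, K)\<in>p. measure lborel K *\<^sub>R g x) - J) < \<epsilon> / 2"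
    using f(1) g(1) half_gt_zero unfolding has_integral_wrt_def by metis
  have "nrm ((\<Sum>(x, K)\<in>p. measure lborel K *\<^sub>R (f x + g x)) - (I + J)) < \<epsilon>"
    if p: "p tagged_division_of {a..b}" "(\<lambda>x. \<gamma> x \<inter> \<delta> x) fine p" for p
  proof -
    let ?S = "\<lambda>h. \<Sum>(x, K)\<in>p. measure lborel K *\<^sub>R h x"
    have "?S (\<lambda>x. f x + g x) - (I + J) = (?S f - I) + (?S g - J)"
      by (simp add: scaleR_add_right sum.distrib case_prod_unfold)
    also have "nrm \<dots> \<le> nrm (?S f - I) + nrm (?S g - J)"
      using f g p by (intro nrm_triangle X_diff tagged_sum_mem)
    also have "\<dots> < \<epsilon>"
      using \<gamma>(2)[OF p(1)] \<delta>(2)[OF p(1)] p(2) by (fastforce simp: fine_Int)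
    finally show ?thesis .
  qed
  then show "\<exists>\<gamma>. gauge \<gamma> \<and> (\<forall>p. p tagged_division_of {a..b} \<and> \<gamma> fine p \<longrightarrow>
      nrm ((\<Sum>(x, K)\<in>p. measure lborel K *\<^sub>R (f x + g x)) - (I + J)) < \<epsilon>)"
    using gauge_Int[OF \<gamma>(1) \<delta>(1)] by blast
qed

lemma has_integral_wrt_sum_scaleR:
  assumes "finite A" "\<And>k. k \<in> A \<Longrightarrow> e k \<in> X" "\<And>k. k \<in> A \<Longrightarrow> (c k has_integral C k) {a..b}"
  shows "has_integral_wrt nrm (\<lambda>s. \<Sum>k\<in>A. c k s *\<^sub>R e k) (\<Sum>k\<in>A. C k *\<^sub>R e k) a b"
  using assms
proof (induction A rule: finite_induct)
  case empty
  then show ?case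
    using has_integral_wrt_scaleR[OF X_0, of "\<lambda>_. 0" 0 a b] by simp
next
  case (insert k A)
  then show ?case
    by (simp add: has_integral_wrt_add has_integral_wrt_scaleR X_sum X_scaleR)
qed

text \<open>A seminorm only permits the conclusion that the difference has norm 0;
  \<open>integral_wrt_eq\<close> adds definiteness.\<close>

lemma has_integral_wrt_unique:
  assumes "has_integral_wrt nrm f I a b" "I \<in> X" "has_integral_wrt nrm f J a b" "J \<in> X"
    and f: "\<And>s. s \<in> {a..b} \<Longrightarrow> f s \<in> X"
  shows "nrm (I - J) = 0"
proof (rule ccontr)
  assume "nrm (I - J) \<noteq> 0"
  then have pos: "nrm (I - J) / 2 > 0"
    using nrm_nonneg X_diff assms by (simp add: order_less_le)
  then obtain \<gamma> \<delta> where \<gamma>: "gauge \<gamma>" "\<And>p. p tagged_division_of {a..b} \<Longrightarrow> \<gamma> fine p \<Longrightarrow>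
      nrm ((\<Sum>(x, K)\<in>p. measure lborel K *\<^sub>R f x) - I) < nrm (I - J) / 2"
    and \<delta>: "gauge \<delta>" "\<And>p. p tagged_division_of {a..b} \<Longrightarrow> \<delta> fine p \<Longrightarrow>
      nrm ((\<Sum>(x, K)\<in>p. measure lborel K *\<^sub>R f x) - J) < nrm (I - J) / 2"
    using assms(1,3) unfolding has_integral_wrt_def by metis
  \<comment> \<open>Cousin's lemma provides a division fine for both gauges, so that
    \<open>I\<close> and \<open>J\<close> are compared with one Riemann sum.\<close>
  obtain p where p: "p tagged_division_of {a..b}" "(\<lambda>x. \<gamma> x \<inter> \<delta> x) fine p"
    using fine_division_exists_real[OF gauge_Int[OF \<gamma>(1) \<delta>(1)]] by blast
  let ?S = "\<Sum>(x, K)\<in>p. measure lborel K *\<^sub>R f x"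
  have S: "?S \<in> X" using p f by (intro tagged_sum_mem)
  have "nrm (I - J) \<le> nrm (I - ?S) + nrm (?S - J)"
    using S assms by (intro nrm_triangle_between)
  also have "\<dots> < nrm (I - J)"
    using \<gamma>(2)[OF p(1)] \<delta>(2)[OF p(1)] p(2) nrm_minus_commute[OF S assms(2)] by (simp add: fine_Int)
  finally show False by simp
qed

lemma integral_wrt_eq:
  assumes "has_integral_wrt nrm f I a b" "I \<in> X" "\<And>s. s \<in> {a..b} \<Longrightarrow> f s \<in> X"
    and definite: "\<And>x. \<lbrakk>x \<in> X; nrm x = 0\<rbrakk> \<Longrightarrow> x = 0"
  shows "integral_wrt X nrm a b f = I"
  unfolding integral_wrt_def
proof (rule the_equality)
  fix J assume J: "J \<in> X \<and> has_integral_wrt nrm f J a b"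
  then have "J - I = 0"
    using assms by (intro definite has_integral_wrt_unique[of f] X_diff) auto
  then show "J = I" by simp
qed (use assms in auto)

text \<open>Tags lie in \<open>{a..b}\<close>, so values elsewhere do not count. This matters
  because \<open>T (t - s)\<close> is controlled only for \<open>s \<le> t\<close>.\<close>

lemma has_integral_wrt_cong:
  assumes "\<And>s. s \<in> {a..b} \<Longrightarrow> f s = g s"
  shows "has_integral_wrt nrm f I a b = has_integral_wrt nrm g I a b"
proof -
  have "(\<Sum>(x, K)\<in>p. measure lborel K *\<^sub>R f x) = (\<Sum>(x, K)\<in>p. measure lborel K *\<^sub>R g x)"
    if "p tagged_division_of {a..b}" for p
  proof (rule sum.cong[OF refl], clarify)
    fix x K assume "(x, K) \<in> p"
    then have "x \<in> {a..b}"
      using tagged_division_ofD(2,3)[OF that] by blast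
    then show "measure lborel K *\<^sub>R f x = measure lborel K *\<^sub>R g x"
      by (simp add: assms)
  qed
  then show ?thesis
    unfolding has_integral_wrt_def by (simp cong: conj_cong imp_cong)
qed

text \<open>For a second candidate \<open>q\<close>, the vector \<open>q - p\<close> lies in
  \<open>M\<close> and both residuals are orthogonal to it, whence
  \<open>ip (q - p) (q - p) = 0\<close>. Existence is settled by exhibiting
  \<open>p\<close>.\<close>

lemma orthogonal_projection_eq:
  assumes M: "subspace M" "M \<subseteq> X" and x: "x \<in> X" "p \<in> M" "\<And>w. w \<in> M \<Longrightarrow> ip (x - p) w = 0"
    and definite: "\<And>y. \<lbrakk>y \<in> X; nrm y = 0\<rbrakk> \<Longrightarrow> y = 0"
  shows "orthogonal_projection ip M x = p"
  unfolding orthogonal_projection_def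
proof (rule the_equality)
  fix q assume q: "q \<in> M \<and> (\<forall>w\<in>M. ip (x - q) w = 0)"
  have d: "q - p \<in> M" using subspace_diff[OF M(1)] q x(2) by blast
  have X: "q \<in> X" "p \<in> X" "q - p \<in> X" using d q x(2) M(2) by auto
  have "ip (q - p) (q - p) = ip ((x - p) - (x - q)) (q - p)" by simp
  also have "\<dots> = ip (x - p) (q - p) - ip (x - q) (q - p)"
    using X x(1) by (intro ip_diff_left X_diff)
  also have "\<dots> = 0" using d q x(3) by simp
  finally have "q - p = 0" using X by (intro definite) (auto simp: nrm_eq_sqrt)
  then show "q = p" by simp
qed (use x in auto)

end

section \<open>Weak derivatives\<close>

lemma L2_eq_rep: "L2_eq (rep_L2 f) (rep_L2 f)"
  by (rule Quotient3_rep_reflp[OF Quotient3_L2])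

lemma square_integrable_rep: "square_integrable (rep_L2 f)"
  using L2_eq_rep by (auto simp: L2_eq_def)

lemma abs_rep_L2: "abs_L2 (rep_L2 f) = f"
  by (rule Quotient3_abs_rep[OF Quotient3_L2])

lemma L2_eq_refl: "square_integrable \<psi> \<Longrightarrow> L2_eq \<psi> \<psi>"
  by (simp add: L2_eq_def)

lemma rep_abs_L2: "square_integrable \<psi> \<Longrightarrow> AE x in lborel. rep_L2 (abs_L2 \<psi>) x = \<psi> x"
  using rep_abs_rsp[OF Quotient3_L2, of \<psi> \<psi>] L2_eq_refl[of \<psi>]
  by (metis L2_eq_def Quotient3_rep_abs Quotient3_L2)

lemma inner_abs_L2:
  assumes "square_integrable f" "square_integrable g"
  shows "abs_L2 f \<bullet> abs_L2 g = (\<integral>x. f x * g x \<partial>lborel)"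
  using assms by (intro inner_L2.abs_eq L2_eq_refl)

lemma abs_L2_add:
  "square_integrable f \<Longrightarrow> square_integrable g \<Longrightarrow> abs_L2 (\<lambda>x. f x + g x) = abs_L2 f + abs_L2 g"
  using plus_L2.abs_eq[of f g] by (simp add: L2_eq_refl)

lemma abs_L2_cmult: "square_integrable f \<Longrightarrow> abs_L2 (\<lambda>x. c * f x) = c *\<^sub>R abs_L2 f"
  using scaleR_L2.abs_eq[of f c] by (simp add: L2_eq_refl)

lemma rep_L2_add: "AE x in lborel. rep_L2 (f + g) x = rep_L2 f x + rep_L2 g x"
  using rep_abs_L2[OF square_integrable_add[OF square_integrable_rep square_integrable_rep], of f g]
  by (simp add: abs_L2_add square_integrable_rep abs_rep_L2)

lemma rep_L2_scaleR: "AE x in lborel. rep_L2 (c *\<^sub>R f) x = c * rep_L2 f x"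
  using rep_abs_L2[OF square_integrable_cmult[OF square_integrable_rep], of c f]
  by (simp add: abs_L2_cmult square_integrable_rep abs_rep_L2)

lemma rep_L2_zero: "AE x in lborel. rep_L2 0 x = 0"
  using rep_abs_L2[OF square_integrable_zero] by (simp add: zero_L2.abs_eq)

lemma subspace_L2_on: "subspace (L2_on \<Omega>)"
proof (rule subspaceI)
  show "0 \<in> L2_on \<Omega>"
    using rep_L2_zero by (auto simp: L2_on_def elim: eventually_mono)
  show "f + g \<in> L2_on \<Omega>" if "f \<in> L2_on \<Omega>" "g \<in> L2_on \<Omega>" for f g
    using that rep_L2_add[of f g] unfolding L2_on_def mem_Collect_eq
    by eventually_elim auto
  show "c *\<^sub>R f \<in> L2_on \<Omega>" if "f \<in> L2_on \<Omega>" for c f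
    using that rep_L2_scaleR[of c f] unfolding L2_on_def mem_Collect_eq
    by eventually_elim auto
qed

lemma abs_L2_mem_L2_on:
  assumes "square_integrable \<psi>" "\<And>x. x \<notin> \<Omega> \<Longrightarrow> \<psi> x = 0"
  shows "abs_L2 \<psi> \<in> L2_on \<Omega>"
  using rep_abs_L2[OF assms(1)] assms(2) by (auto simp: L2_on_def elim: eventually_mono)

lemma abs_test_function_mem_L2_on: "test_function \<Omega> \<psi> \<Longrightarrow> abs_L2 \<psi> \<in> L2_on \<Omega>"
  by (intro abs_L2_mem_L2_on square_integrable_test_function test_function_outside)

lemma set_integral_rep_mult:
  assumes "square_integrable \<psi>" "\<And>x. x \<notin> \<Omega> \<Longrightarrow> \<psi> x = 0"
  shows "(LINT x:\<Omega>|lborel. rep_L2 f x * \<psi> x) = f \<bullet> abs_L2 \<psi>"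
proof -
  have "(\<lambda>x. indicator \<Omega> x *\<^sub>R (rep_L2 f x * \<psi> x)) = (\<lambda>x. rep_L2 f x * \<psi> x)"
    by (intro ext) (auto simp: indicator_def assms(2))
  moreover have "f \<bullet> abs_L2 \<psi> = (\<integral>x. rep_L2 f x * \<psi> x \<partial>lborel)"
    using inner_abs_L2[OF square_integrable_rep[of f] assms(1)] by (simp add: abs_rep_L2)
  ultimately show ?thesis by (simp add: set_lebesgue_integral_def)
qed

abbreviation test_partial :: "'a::euclidean_space \<Rightarrow> ('a \<Rightarrow> real) \<Rightarrow> 'a \<Rightarrow> real" where
  "test_partial i \<psi> \<equiv> \<lambda>x. frechet_derivative \<psi> (at x) i"

text \<open>Replaces integrals of representatives by inner products, which makes the condition
  visibly linear in \<open>f\<close> and \<open>g\<close>.\<close>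

lemma is_weak_partial_iff:
  assumes "i \<in> Basis"
  shows "is_weak_partial \<Omega> i f g \<longleftrightarrow>
    (\<forall>\<psi>. test_function \<Omega> \<psi> \<longrightarrow> f \<bullet> abs_L2 (test_partial i \<psi>) = - (g \<bullet> abs_L2 \<psi>))"
proof -
  have "(LINT x:\<Omega>|lborel. rep_L2 f x * \<psi> x) = f \<bullet> abs_L2 \<psi>" if "test_function \<Omega> \<psi>" for f \<psi>
    using that by (intro set_integral_rep_mult square_integrable_test_function test_function_outside)
  then show ?thesis
    using test_function_deriv[OF _ assms] by (simp add: is_weak_partial_def)
qed

text \<open>The derivative of \<open>\<lambda>x. \<psi> x * \<eta> x\<close> along \<open>i\<close>
  integrates to 0; the support of \<psi> serves as the compact set.\<close>

lemma integral_by_parts_test_function: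
  assumes "test_function \<Omega> \<psi>" "test_function \<Omega> \<eta>" "i \<in> Basis"
  shows "abs_L2 \<psi> \<bullet> abs_L2 (test_partial i \<eta>) = - (abs_L2 (test_partial i \<psi>) \<bullet> abs_L2 \<eta>)"
proof -
  have si: "square_integrable \<psi>" "square_integrable \<eta>"
    "square_integrable (test_partial i \<psi>)" "square_integrable (test_partial i \<eta>)"
    using assms square_integrable_test_function test_function_deriv by blast+
  have "(\<integral>x. \<psi> x * test_partial i \<eta> x + test_partial i \<psi> x * \<eta> x \<partial>lborel) = 0"
  proof (rule integral_directional_derivative_eq_0[where K = "closure {x. \<psi> x \<noteq> 0}"])
    show "((\<lambda>x. \<psi> x * \<eta> x) has_derivative (\<lambda>v. \<psi> x * frechet_derivative \<eta> (at x) v +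
        frechet_derivative \<psi> (at x) v * \<eta> x)) (at x)" for x
      using assms by (intro has_derivative_mult test_function_has_derivative)
    show "continuous_on UNIV (\<lambda>x. \<psi> x * test_partial i \<eta> x + test_partial i \<psi> x * \<eta> x)"
      using assms test_function_continuous test_function_deriv
      by (intro continuous_on_add continuous_on_mult) blast+
    show "compact (closure {x. \<psi> x \<noteq> 0})"
      using assms by (simp add: test_function_def)
    fix x assume x: "x \<notin> closure {x. \<psi> x \<noteq> 0}"
    then have "\<psi> x = 0"
      using closure_subset[of "{x. \<psi> x \<noteq> 0}"] by auto
    then show "\<psi> x * \<eta> x = 0" "\<psi> x * test_partial i \<eta> x + test_partial i \<psi> x * \<eta> x = 0"
      using frechet_derivative_outside_support[OF x] by auto
  qed
  then show ?thesis
    using si by (simp add: inner_abs_L2 square_integrable_mult)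
qed

text \<open>The identity \<open>|\<psi>|\<^sup>2 = - 2 \<integral> x\<^sub>i \<psi> \<partial>\<^sub>i\<psi>\<close> is integration by parts with \<open>1 = \<partial>\<^sub>i x\<^sub>i\<close>.\<close>

lemma poincare_test_function:
  assumes \<psi>: "test_function \<Omega> \<psi>" and i: "i \<in> Basis" and R: "\<And>x. x \<in> \<Omega> \<Longrightarrow> norm x \<le> R"
  shows "norm (abs_L2 \<psi>) \<le> 2 * \<bar>R\<bar> * norm (abs_L2 (test_partial i \<psi>))"
proof -
  let ?K = "closure {x. \<psi> x \<noteq> 0}"
  define g where "g = (\<lambda>x. (x \<bullet> i) * \<psi> x)"
  have K: "compact ?K" using \<psi> by (simp add: test_function_def)
  have K0: "\<psi> x = 0" if "x \<notin> ?K" for x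
    using that closure_subset[of "{x. \<psi> x \<noteq> 0}"] by auto
  have cont: "continuous_on UNIV \<psi>" "continuous_on UNIV (test_partial i \<psi>)"
    using \<psi> i test_function_continuous test_function_deriv by blast+
  have "continuous_on UNIV g"
    unfolding g_def by (intro continuous_intros cont)
  then have g: "square_integrable g"
    by (rule square_integrable_compact_support[OF _ K]) (auto simp: g_def dest: K0)
  have si: "square_integrable \<psi>" "square_integrable (test_partial i \<psi>)"
    using \<psi> i square_integrable_test_function test_function_deriv by blast+
  have "(\<integral>x. (i \<bullet> i) * (\<psi> x * \<psi> x) + 2 * (g x * test_partial i \<psi> x) \<partial>lborel) = 0"
  proof (rule integral_directional_derivative_eq_0[where h = "\<lambda>x. (x \<bullet> i) * (\<psi> x * \<psi> x)"
        and h' = "\<lambda>x v. (v \<bullet> i) * (\<psi> x * \<psi> x) + 2 * (g x * frechet_derivative \<psi> (at x) v)",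
        OF _ _ K])
    show "((\<lambda>x. (x \<bullet> i) * (\<psi> x * \<psi> x)) has_derivative (\<lambda>v. (v \<bullet> i) * (\<psi> x * \<psi> x) +
        2 * (g x * frechet_derivative \<psi> (at x) v))) (at x)" for x
      using test_function_has_derivative[OF \<psi>, of x]
      by (auto intro!: derivative_eq_intros simp: g_def algebra_simps)
    show "continuous_on UNIV (\<lambda>x. (i \<bullet> i) * (\<psi> x * \<psi> x) + 2 * (g x * test_partial i \<psi> x))"
      unfolding g_def by (intro continuous_intros cont)
  qed (auto simp: g_def dest: K0)
  then have "(\<integral>x. \<psi> x * \<psi> x + 2 * (g x * test_partial i \<psi> x) \<partial>lborel) = 0"
    using i by (simp add: inner_Basis)
  then have "abs_L2 \<psi> \<bullet> abs_L2 \<psi> = - 2 * (abs_L2 g \<bullet> abs_L2 (test_partial i \<psi>))"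
    using g si by (simp add: inner_abs_L2 square_integrable_mult)
  also have "\<dots> \<le> 2 * (norm (abs_L2 g) * norm (abs_L2 (test_partial i \<psi>)))"
    using Cauchy_Schwarz_ineq2[of "abs_L2 g" "abs_L2 (test_partial i \<psi>)"] by simp
  \<comment> \<open>On \<open>\<Omega>\<close> the weight satisfies
    \<open>\<bar>x \<bullet> i\<bar> \<le> norm x \<le> R\<close>. The absolute value of
    \<open>R\<close> covers an empty \<open>\<Omega>\<close>, for which \<open>R\<close> may be
    negative.\<close>
  also have "norm (abs_L2 g) \<le> \<bar>R\<bar> * norm (abs_L2 \<psi>)"
  proof -
    have "(\<integral>x. g x * g x \<partial>lborel) \<le> (\<integral>x. R\<^sup>2 * (\<psi> x * \<psi> x) \<partial>lborel)"
    proof (rule integral_mono)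
      show "g x * g x \<le> R\<^sup>2 * (\<psi> x * \<psi> x)" for x
      proof (cases "x \<in> \<Omega>")
        case True
        have "\<bar>x \<bullet> i\<bar> \<le> norm x"
          by (rule Basis_le_norm[OF i])
        then have "(x \<bullet> i)\<^sup>2 \<le> R\<^sup>2"
          using R[OF True] by (intro abs_le_square_iff[THEN iffD1]) linarith
        then have "(x \<bullet> i)\<^sup>2 * (\<psi> x)\<^sup>2 \<le> R\<^sup>2 * (\<psi> x)\<^sup>2"
          by (intro mult_right_mono) auto
        then show ?thesis by (simp add: g_def power2_eq_square algebra_simps)
      qed (use \<psi> in \<open>simp add: g_def test_function_outside\<close>)
    qed (use g si in \<open>auto intro: square_integrable_mult\<close>)
    then have "abs_L2 g \<bullet> abs_L2 g \<le> R\<^sup>2 * (abs_L2 \<psi> \<bullet> abs_L2 \<psi>)"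
      using g si by (simp add: inner_abs_L2)
    then have "(norm (abs_L2 g))\<^sup>2 \<le> (\<bar>R\<bar> * norm (abs_L2 \<psi>))\<^sup>2"
      by (simp add: power2_norm_eq_inner power_mult_distrib)
    then show ?thesis by (rule power2_le_imp_le) simp
  qed
  finally have "norm (abs_L2 \<psi>) * norm (abs_L2 \<psi>) \<le>
      norm (abs_L2 \<psi>) * (2 * \<bar>R\<bar> * norm (abs_L2 (test_partial i \<psi>)))"
    by (simp add: mult_right_mono mult_ac dot_square_norm power2_eq_square)
  then show ?thesis
    by (cases "norm (abs_L2 \<psi>) = 0") (auto simp: mult_le_cancel_left)
qed

text \<open>An approximant \<open>w\<close> closer to \<open>g\<close> than \<open>norm g\<close>
  contradicts \<open>norm g * norm g = g \<bullet> (g - w)\<close> by Cauchy-Schwarz. Serves both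
  the uniqueness of weak derivatives and the completeness of the eigenfunctions.\<close>

lemma eq_0_if_orthogonal_to_approximants:
  fixes g :: "'b::real_inner"
  assumes "\<And>e. e > 0 \<Longrightarrow> \<exists>w. norm (g - w) < e \<and> g \<bullet> w = 0"
  shows "g = 0"
proof (rule ccontr)
  assume "g \<noteq> 0"
  then obtain w where w: "norm (g - w) < norm g" "g \<bullet> w = 0"
    using assms[of "norm g"] by auto
  have "norm g * norm g = g \<bullet> (g - w)"
    using w(2) by (simp add: inner_diff_right dot_square_norm power2_eq_square)
  also have "\<dots> \<le> norm g * norm (g - w)" by (rule norm_cauchy_schwarz)
  finally have "norm g \<le> norm (g - w)" using \<open>g \<noteq> 0\<close> by simp
  with w(1) show False by simp
qed

lemma norm_le_H1_norm: "norm u \<le> H1_norm \<Omega> u"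
  unfolding H1_norm_def by (rule real_le_rsqrt) (simp add: sum_nonneg)

lemma norm_weak_partial_le_H1_norm:
  assumes "i \<in> Basis"
  shows "norm (weak_partial \<Omega> i u) \<le> H1_norm \<Omega> u"
  unfolding H1_norm_def
proof (rule real_le_rsqrt)
  have "(norm (weak_partial \<Omega> i u))\<^sup>2 \<le> (\<Sum>i\<in>Basis. (norm (weak_partial \<Omega> i u))\<^sup>2)"
    using assms by (intro member_le_sum) auto
  then show "(norm (weak_partial \<Omega> i u))\<^sup>2 \<le>
      (norm u)\<^sup>2 + (\<Sum>i\<in>Basis. (norm (weak_partial \<Omega> i u))\<^sup>2)"
    by (simp add: add_increasing)
qed

text \<open>Density of the test functions in \<open>L\<^sup>2(\<Omega>)\<close> makes weak derivatives unique. It is assumed here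
  because it comes for free with an eigenbasis, whose members are limits of test functions.\<close>

locale sobolev_domain =
  fixes \<Omega> :: "'a::euclidean_space set"
  assumes bounded_Omega: "bounded \<Omega>"
    and test_functions_dense:
      "\<lbrakk>f \<in> L2_on \<Omega>; e > 0\<rbrakk> \<Longrightarrow> \<exists>\<psi>. test_function \<Omega> \<psi> \<and> norm (f - abs_L2 \<psi>) < e"
begin

text \<open>Two candidates for the derivative differ by an element orthogonal to every test
  function, and these are dense. This is how \<open>weak_partial\<close> is evaluated from here
  on.\<close>

lemma weak_partial_eqI:
  assumes "i \<in> Basis" "g \<in> L2_on \<Omega>" "is_weak_partial \<Omega> i f g"
  shows "weak_partial \<Omega> i f = g"
  unfolding weak_partial_def
proof (rule the_equality)
  fix h assume h: "h \<in> L2_on \<Omega> \<and> is_weak_partial \<Omega> i f h"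
  have "h - g = 0"
  proof (rule eq_0_if_orthogonal_to_approximants)
    fix e :: real assume "e > 0"
    then obtain \<psi> where \<psi>: "test_function \<Omega> \<psi>" "norm (h - g - abs_L2 \<psi>) < e"
      using test_functions_dense[of "h - g" e] h assms subspace_diff[OF subspace_L2_on] by blast
    moreover have "(h - g) \<bullet> abs_L2 \<psi> = 0"
      using \<psi>(1) h assms by (simp add: is_weak_partial_iff inner_diff_left)
    ultimately show "\<exists>w. norm (h - g - w) < e \<and> (h - g) \<bullet> w = 0" by blast
  qed
  then show "h = g" by simp
qed (use assms in auto)

lemma weak_partial_H1:
  assumes "u \<in> H1 \<Omega>" "i \<in> Basis"
  shows "weak_partial \<Omega> i u \<in> L2_on \<Omega>" "is_weak_partial \<Omega> i u (weak_partial \<Omega> i u)"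
proof -
  obtain g where "g \<in> L2_on \<Omega>" "is_weak_partial \<Omega> i u g"
    using assms by (auto simp: H1_def)
  then show "weak_partial \<Omega> i u \<in> L2_on \<Omega>" "is_weak_partial \<Omega> i u (weak_partial \<Omega> i u)"
    using weak_partial_eqI[OF assms(2)] by auto
qed

lemma is_weak_partial_add:
  "\<lbrakk>i \<in> Basis; is_weak_partial \<Omega> i f g; is_weak_partial \<Omega> i f' g'\<rbrakk> \<Longrightarrow>
    is_weak_partial \<Omega> i (f + f') (g + g')"
  by (simp add: is_weak_partial_iff inner_add_left)

lemma is_weak_partial_scaleR:
  "\<lbrakk>i \<in> Basis; is_weak_partial \<Omega> i f g\<rbrakk> \<Longrightarrow> is_weak_partial \<Omega> i (c *\<^sub>R f) (c *\<^sub>R g)"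
  by (simp add: is_weak_partial_iff)

lemma subspace_H1: "subspace (H1 \<Omega>)"
proof (rule subspaceI)
  show "0 \<in> H1 \<Omega>"
    using subspace_0[OF subspace_L2_on] by (auto simp: H1_def is_weak_partial_iff intro!: bexI[of _ 0])
  show "u + w \<in> H1 \<Omega>" if "u \<in> H1 \<Omega>" "w \<in> H1 \<Omega>" for u w
    using that subspace_add[OF subspace_L2_on] is_weak_partial_add unfolding H1_def by blast
  show "c *\<^sub>R u \<in> H1 \<Omega>" if "u \<in> H1 \<Omega>" for c u
    using that subspace_scale[OF subspace_L2_on] is_weak_partial_scaleR unfolding H1_def by blast
qed

lemma weak_partial_add:
  "\<lbrakk>i \<in> Basis; u \<in> H1 \<Omega>; w \<in> H1 \<Omega>\<rbrakk> \<Longrightarrow>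
    weak_partial \<Omega> i (u + w) = weak_partial \<Omega> i u + weak_partial \<Omega> i w"
  by (intro weak_partial_eqI is_weak_partial_add subspace_add[OF subspace_L2_on] weak_partial_H1)

lemma weak_partial_scaleR:
  "\<lbrakk>i \<in> Basis; u \<in> H1 \<Omega>\<rbrakk> \<Longrightarrow> weak_partial \<Omega> i (c *\<^sub>R u) = c *\<^sub>R weak_partial \<Omega> i u"
  by (intro weak_partial_eqI is_weak_partial_scaleR subspace_scale[OF subspace_L2_on] weak_partial_H1)

lemma weak_partial_diff:
  "\<lbrakk>i \<in> Basis; u \<in> H1 \<Omega>; w \<in> H1 \<Omega>\<rbrakk> \<Longrightarrow>
    weak_partial \<Omega> i (u - w) = weak_partial \<Omega> i u - weak_partial \<Omega> i w"
  using weak_partial_add[of i u "(-1) *\<^sub>R w"] weak_partial_scaleR[of i w "-1"]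
    subspace_scale[OF subspace_H1, of w "-1"] by simp

lemma weak_partial_0: "i \<in> Basis \<Longrightarrow> weak_partial \<Omega> i 0 = 0"
  using weak_partial_scaleR[of i 0 0] subspace_0[OF subspace_H1] by simp

lemma laplacian_0: "laplacian \<Omega> 0 = 0"
  by (simp add: laplacian_def weak_partial_0)

lemma grad_inner_add_left:
  "\<lbrakk>u \<in> H1 \<Omega>; v \<in> H1 \<Omega>\<rbrakk> \<Longrightarrow> grad_inner \<Omega> (u + v) w = grad_inner \<Omega> u w + grad_inner \<Omega> v w"
  by (simp add: grad_inner_def weak_partial_add inner_add_left sum.distrib)

lemma grad_inner_scaleR_left: "u \<in> H1 \<Omega> \<Longrightarrow> grad_inner \<Omega> (c *\<^sub>R u) w = c * grad_inner \<Omega> u w"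
  by (simp add: grad_inner_def weak_partial_scaleR sum_distrib_left)

lemma grad_inner_commute: "grad_inner \<Omega> u w = grad_inner \<Omega> w u"
  by (simp add: grad_inner_def inner_commute)

lemma grad_inner_nonneg: "0 \<le> grad_inner \<Omega> u u"
  by (simp add: grad_inner_def sum_nonneg)

text \<open>Supplies the triangle inequality for \<open>H1_norm\<close> by which
  \<open>H10 \<Omega>\<close> is a subspace.\<close>

sublocale H1: semi_inner "H1 \<Omega>" "\<lambda>u w. u \<bullet> w + grad_inner \<Omega> u w" "H1_norm \<Omega>"
proof
  show "subspace (H1 \<Omega>)" by (rule subspace_H1)
  fix u assume "u \<in> H1 \<Omega>"
  show "H1_norm \<Omega> u = sqrt (u \<bullet> u + grad_inner \<Omega> u u)"
    by (simp add: H1_norm_def grad_inner_def power2_norm_eq_inner)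
qed (auto simp: grad_inner_add_left grad_inner_scaleR_left inner_add_left inner_add_right distrib_left inner_commute
    grad_inner_nonneg intro: grad_inner_commute)

lemma test_function_weak_partial:
  assumes "test_function \<Omega> \<psi>" "i \<in> Basis"
  shows "weak_partial \<Omega> i (abs_L2 \<psi>) = abs_L2 (test_partial i \<psi>)"
    and "is_weak_partial \<Omega> i (abs_L2 \<psi>) (abs_L2 (test_partial i \<psi>))"
proof -
  show "is_weak_partial \<Omega> i (abs_L2 \<psi>) (abs_L2 (test_partial i \<psi>))"
    using assms by (simp add: is_weak_partial_iff integral_by_parts_test_function)
  then show "weak_partial \<Omega> i (abs_L2 \<psi>) = abs_L2 (test_partial i \<psi>)"
    using assms by (intro weak_partial_eqI abs_test_function_mem_L2_on test_function_deriv)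
qed

lemma test_function_mem_H1: "test_function \<Omega> \<psi> \<Longrightarrow> abs_L2 \<psi> \<in> H1 \<Omega>"
  using abs_test_function_mem_L2_on test_function_weak_partial(2) test_function_deriv
  unfolding H1_def by blast

lemma H10_mem_H1: "u \<in> H10 \<Omega> \<Longrightarrow> u \<in> H1 \<Omega>"
  by (simp add: H10_def)

lemma H10_mem_L2_on: "u \<in> H10 \<Omega> \<Longrightarrow> u \<in> L2_on \<Omega>"
  by (simp add: H10_def H1_def)

lemma H10_approx:
  assumes "u \<in> H10 \<Omega>" "e > 0"
  obtains \<psi> where "test_function \<Omega> \<psi>" "H1_norm \<Omega> (u - abs_L2 \<psi>) < e"
  using assms by (auto simp: H10_def)

lemma subspace_H10: "subspace (H10 \<Omega>)"
proof (rule subspaceI)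
  have "abs_L2 (\<lambda>_. 0) = (0 :: 'a L2)" by (simp add: zero_L2.abs_eq)
  then show "0 \<in> H10 \<Omega>"
    using H1.X_0 H1.nrm_0 test_function_zero[of \<Omega>]
    by (auto simp: H10_def intro!: exI[of _ "\<lambda>_. 0"])
next
  fix u w assume uw: "u \<in> H10 \<Omega>" "w \<in> H10 \<Omega>"
  have "\<exists>\<psi>. test_function \<Omega> \<psi> \<and> H1_norm \<Omega> (u + w - abs_L2 \<psi>) < e" if e: "e > 0" for e
  proof -
    obtain \<psi> where \<psi>: "test_function \<Omega> \<psi>" "H1_norm \<Omega> (u - abs_L2 \<psi>) < e / 2"
      using H10_approx[OF uw(1) half_gt_zero[OF e]] by blast
    obtain \<eta> where \<eta>: "test_function \<Omega> \<eta>" "H1_norm \<Omega> (w - abs_L2 \<eta>) < e / 2"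
      using H10_approx[OF uw(2) half_gt_zero[OF e]] by blast
    have eq: "u + w - abs_L2 (\<lambda>x. \<psi> x + \<eta> x) = (u - abs_L2 \<psi>) + (w - abs_L2 \<eta>)"
      using \<psi> \<eta> by (simp add: abs_L2_add square_integrable_test_function)
    have "H1_norm \<Omega> (u + w - abs_L2 (\<lambda>x. \<psi> x + \<eta> x)) \<le>
        H1_norm \<Omega> (u - abs_L2 \<psi>) + H1_norm \<Omega> (w - abs_L2 \<eta>)"
      unfolding eq using uw \<psi> \<eta> by (intro H1.nrm_triangle H1.X_diff H10_mem_H1 test_function_mem_H1)
    also have "\<dots> < e" using \<psi>(2) \<eta>(2) by linarith
    finally have "H1_norm \<Omega> (u + w - abs_L2 (\<lambda>x. \<psi> x + \<eta> x)) < e" .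
    then show ?thesis using test_function_add[OF \<psi>(1) \<eta>(1)] by blast
  qed
  then show "u + w \<in> H10 \<Omega>"
    using uw H1.X_add by (simp add: H10_def)
next
  fix c u assume u: "u \<in> H10 \<Omega>"
  have "\<exists>\<psi>. test_function \<Omega> \<psi> \<and> H1_norm \<Omega> (c *\<^sub>R u - abs_L2 \<psi>) < e" if e: "e > 0" for e
  proof -
    obtain \<psi> where \<psi>: "test_function \<Omega> \<psi>" "H1_norm \<Omega> (u - abs_L2 \<psi>) < e / (\<bar>c\<bar> + 1)"
      using H10_approx[OF u, of "e / (\<bar>c\<bar> + 1)"] e by (metis abs_ge_zero add_nonneg_pos divide_pos_pos zero_less_one)
    have mem: "u - abs_L2 \<psi> \<in> H1 \<Omega>"
      using u \<psi> by (intro H1.X_diff H10_mem_H1 test_function_mem_H1)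
    have "c *\<^sub>R u - abs_L2 (\<lambda>x. c * \<psi> x) = c *\<^sub>R (u - abs_L2 \<psi>)"
      using \<psi> by (simp add: abs_L2_cmult square_integrable_test_function scaleR_diff_right)
    then have "H1_norm \<Omega> (c *\<^sub>R u - abs_L2 (\<lambda>x. c * \<psi> x)) = \<bar>c\<bar> * H1_norm \<Omega> (u - abs_L2 \<psi>)"
      using mem by (simp add: H1.nrm_scaleR)
    also have "\<dots> \<le> \<bar>c\<bar> * (e / (\<bar>c\<bar> + 1))"
      using \<psi>(2) by (intro mult_left_mono) auto
    also have "\<dots> < e" using e by (simp add: field_simps)
    finally show ?thesis using test_function_cmult[OF \<psi>(1)] by blast
  qed
  then show "c *\<^sub>R u \<in> H10 \<Omega>"
    using u H1.X_scaleR by (simp add: H10_def)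
qed

text \<open>Passes from test functions to their limits in \<open>H1_norm\<close>; a single direction
  \<open>i\<close> already controls \<open>norm u\<close>.\<close>

lemma poincare:
  obtains C where "C > 0" "\<And>u i. \<lbrakk>u \<in> H10 \<Omega>; i \<in> Basis\<rbrakk> \<Longrightarrow> norm u \<le> C * norm (weak_partial \<Omega> i u)"
proof -
  obtain R where R: "\<And>x. x \<in> \<Omega> \<Longrightarrow> norm x \<le> R"
    using bounded_Omega by (auto simp: bounded_iff)
  \<comment> \<open>The additional 1 makes the constant positive even when
    \<open>R = 0\<close>.\<close>
  have "norm u \<le> (2 * \<bar>R\<bar> + 1) * norm (weak_partial \<Omega> i u)" if u: "u \<in> H10 \<Omega>" and i: "i \<in> Basis" for u i
  proof -
    have "norm u \<le> 2 * \<bar>R\<bar> * norm (weak_partial \<Omega> i u)"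
    proof (rule field_le_epsilon)
      fix e :: real assume "e > 0"
      \<comment> \<open>The error \<open>?d\<close> enters once through
        \<open>u - abs_L2 \<psi>\<close> and once, with factor \<open>2 * \<bar>R\<bar>\<close>,
        through its derivative.\<close>
      then obtain \<psi> where \<psi>: "test_function \<Omega> \<psi>" "H1_norm \<Omega> (u - abs_L2 \<psi>) < e / (1 + 2 * \<bar>R\<bar>)"
        using H10_approx[OF u, of "e / (1 + 2 * \<bar>R\<bar>)"] by auto
      let ?d = "H1_norm \<Omega> (u - abs_L2 \<psi>)" and ?D = "weak_partial \<Omega> i"
      have "?D (u - abs_L2 \<psi>) = ?D u - ?D (abs_L2 \<psi>)"
        using u i \<psi> by (intro weak_partial_diff H10_mem_H1 test_function_mem_H1)
      then have "norm (?D (abs_L2 \<psi>)) \<le> norm (?D u) + ?d"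
        using norm_weak_partial_le_H1_norm[OF i, of \<Omega> "u - abs_L2 \<psi>"]
          norm_triangle_ineq4[of "?D u" "?D u - ?D (abs_L2 \<psi>)"] by simp
      then have "2 * \<bar>R\<bar> * norm (?D (abs_L2 \<psi>)) \<le> 2 * \<bar>R\<bar> * (norm (?D u) + ?d)"
        by (intro mult_left_mono) auto
      moreover have "norm u \<le> ?d + norm (abs_L2 \<psi>)"
        using norm_le_H1_norm[of "u - abs_L2 \<psi>" \<Omega>] norm_triangle_ineq[of "u - abs_L2 \<psi>" "abs_L2 \<psi>"] by simp
      moreover have "norm (abs_L2 \<psi>) \<le> 2 * \<bar>R\<bar> * norm (?D (abs_L2 \<psi>))"
        using poincare_test_function[OF \<psi>(1) i R] test_function_weak_partial(1)[OF \<psi>(1) i] by simp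
      ultimately have "norm u \<le> 2 * \<bar>R\<bar> * norm (?D u) + (1 + 2 * \<bar>R\<bar>) * ?d"
        by (simp add: algebra_simps)
      also have "(1 + 2 * \<bar>R\<bar>) * ?d \<le> e"
        using \<psi>(2) by (simp add: field_simps)
      finally show "norm u \<le> 2 * \<bar>R\<bar> * norm (?D u) + e" by simp
    qed
    then show ?thesis by (simp add: algebra_simps add_increasing)
  qed
  then show ?thesis using that[of "2 * \<bar>R\<bar> + 1"] by auto
qed

text \<open>For a test function \<open>v\<close> this is the definition of the weak derivative. Both
  sides are continuous in \<open>v\<close> for \<open>H1_norm\<close>, and elements of
  \<open>H10 \<Omega>\<close> are limits of test functions.\<close>

lemma weak_partial_by_parts:
  assumes w: "w \<in> H1 \<Omega>" and v: "v \<in> H10 \<Omega>" and i: "i \<in> Basis"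
  shows "w \<bullet> weak_partial \<Omega> i v = - (weak_partial \<Omega> i w \<bullet> v)"
proof -
  let ?D = "weak_partial \<Omega> i"
  have "\<bar>w \<bullet> ?D v + ?D w \<bullet> v\<bar> \<le> 0"
  proof (rule field_le_epsilon)
    fix e :: real assume "e > 0"
    \<comment> \<open>The two Cauchy-Schwarz bounds below contribute \<open>norm w\<close> and
      \<open>norm (?D w)\<close>; the 1 makes \<open>?c\<close> positive.\<close>
    let ?c = "norm w + norm (?D w) + 1"
    have c: "?c > 0" by (simp add: add_nonneg_pos)
    obtain \<psi> where \<psi>: "test_function \<Omega> \<psi>" "H1_norm \<Omega> (v - abs_L2 \<psi>) < e / ?c"
      using H10_approx[OF v, of "e / ?c"] \<open>e > 0\<close> c by auto
    let ?d = "v - abs_L2 \<psi>"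
    have "?D ?d = ?D v - ?D (abs_L2 \<psi>)"
      using v i \<psi> by (intro weak_partial_diff H10_mem_H1 test_function_mem_H1)
    moreover have "w \<bullet> ?D (abs_L2 \<psi>) = - (?D w \<bullet> abs_L2 \<psi>)"
      using weak_partial_H1(2)[OF w i] \<psi>(1) i
      by (simp add: is_weak_partial_iff test_function_weak_partial(1))
    ultimately have "w \<bullet> ?D v + ?D w \<bullet> v = w \<bullet> ?D ?d + ?D w \<bullet> ?d"
      by (simp add: inner_diff_right)
    also have "\<bar>\<dots>\<bar> \<le> norm w * norm (?D ?d) + norm (?D w) * norm ?d"
      using Cauchy_Schwarz_ineq2[of w "?D ?d"] Cauchy_Schwarz_ineq2[of "?D w" ?d] by linarith
    also have "\<dots> \<le> norm w * H1_norm \<Omega> ?d + norm (?D w) * H1_norm \<Omega> ?d"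
      using i by (intro add_mono mult_left_mono norm_le_H1_norm norm_weak_partial_le_H1_norm) auto
    also have "\<dots> \<le> ?c * H1_norm \<Omega> ?d"
      using order_trans[OF norm_ge_zero[of ?d] norm_le_H1_norm[of ?d \<Omega>]] by (simp add: algebra_simps)
    also have "\<dots> \<le> e"
      using \<psi>(2) c by (simp add: field_simps)
    finally show "\<bar>w \<bullet> ?D v + ?D w \<bullet> v\<bar> \<le> 0 + e" by simp
  qed
  then show ?thesis by simp
qed

text \<open>Integration by parts with the partial derivatives of \<open>u\<close> in the role of
  \<open>w\<close>; the boundary term is absent because \<open>v\<close> lies in
  \<open>H10 \<Omega>\<close>.\<close>

lemma green:
  assumes "u \<in> H2 \<Omega>" "v \<in> H10 \<Omega>"
  shows "grad_inner \<Omega> u v = - (laplacian \<Omega> u \<bullet> v)"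
proof -
  have "grad_inner \<Omega> u v = (\<Sum>i\<in>Basis. - (weak_partial \<Omega> i (weak_partial \<Omega> i u) \<bullet> v))"
    unfolding grad_inner_def using assms
    by (intro sum.cong weak_partial_by_parts) (auto simp: H2_def)
  then show ?thesis by (simp add: laplacian_def inner_sum_left sum_negf)
qed

end

section \<open>The energy space and its norm\<close>

locale wave_energy = sobolev_domain \<Omega> for \<Omega> :: "'a::euclidean_space set" +
  fixes \<kappa> :: real
  assumes kappa_pos: "\<kappa> > 0"
begin

sublocale H10: semi_inner "H10 \<Omega>" "H10_inner \<Omega> \<kappa>" "H10_norm \<Omega> \<kappa>"
proof
  show "subspace (H10 \<Omega>)" by (rule subspace_H10)
qed (use kappa_pos in \<open>auto simp: H10_inner_def H10_norm_def grad_inner_add_left H10_mem_H1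
    grad_inner_scaleR_left distrib_left grad_inner_nonneg intro: grad_inner_commute\<close>)

sublocale L2: semi_inner "L2_on \<Omega>" inner norm
  by standard (auto simp: subspace_L2_on inner_add_left inner_add_right inner_commute norm_eq_sqrt_inner)

definition energy_inner :: "'a L2 \<times> 'a L2 \<Rightarrow> 'a L2 \<times> 'a L2 \<Rightarrow> real" where
  "energy_inner x y = H10_inner \<Omega> \<kappa> (fst x) (fst y) + snd x \<bullet> snd y"

lemma mem_energy_space: "x \<in> energy_space \<Omega> \<longleftrightarrow> fst x \<in> H10 \<Omega> \<and> snd x \<in> L2_on \<Omega>"
  by (simp add: energy_space_def mem_Times_iff)

lemma energy_norm_eq: "energy_norm \<Omega> \<kappa> x = sqrt (H10_inner \<Omega> \<kappa> (fst x) (fst x) + snd x \<bullet> snd x)"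
  by (simp add: energy_norm_def case_prod_unfold)

sublocale E: semi_inner "energy_space \<Omega>" energy_inner "energy_norm \<Omega> \<kappa>"
proof
  show "subspace (energy_space \<Omega>)"
    using subspace_Times[OF subspace_H10 subspace_L2_on] by (simp add: energy_space_def)
qed (auto simp: energy_inner_def mem_energy_space energy_norm_eq H10.ip_add_left H10.ip_scaleR_left
    H10.ip_nonneg inner_add_left inner_add_right distrib_left inner_commute intro: H10.ip_commute)

text \<open>The Poincare inequality in one coordinate direction. The constant is divided by
  \<open>sqrt \<kappa>\<close> because \<open>H10_norm\<close> carries the weight \<kappa> under its
  root.\<close>

lemma norm_le_H10_norm:
  obtains C where "C > 0" "\<And>u. u \<in> H10 \<Omega> \<Longrightarrow> norm u \<le> C * H10_norm \<Omega> \<kappa> u"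
proof -
  obtain C where C: "C > 0"
    "\<And>u i. \<lbrakk>u \<in> H10 \<Omega>; i \<in> Basis\<rbrakk> \<Longrightarrow> norm u \<le> C * norm (weak_partial \<Omega> i u)"
    by (rule poincare) auto
  obtain i :: 'a where i: "i \<in> Basis" using nonempty_Basis by blast
  have "norm u \<le> C / sqrt \<kappa> * H10_norm \<Omega> \<kappa> u" if u: "u \<in> H10 \<Omega>" for u
  proof -
    have "(norm (weak_partial \<Omega> i u))\<^sup>2 \<le> grad_inner \<Omega> u u"
      unfolding grad_inner_def power2_norm_eq_inner using i by (intro member_le_sum) auto
    then have "norm (weak_partial \<Omega> i u) \<le> sqrt (grad_inner \<Omega> u u)"
      by (rule real_le_rsqrt)
    then have "C * norm (weak_partial \<Omega> i u) \<le> C * sqrt (grad_inner \<Omega> u u)"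
      using C(1) by (intro mult_left_mono) auto
    also have "\<dots> = C / sqrt \<kappa> * H10_norm \<Omega> \<kappa> u"
      using kappa_pos by (simp add: H10_norm_def H10_inner_def real_sqrt_mult)
    finally show ?thesis using C(2)[OF u i] by simp
  qed
  then show ?thesis using that[of "C / sqrt \<kappa>"] C(1) kappa_pos by auto
qed

lemma H10_norm_eq_0: "u \<in> H10 \<Omega> \<Longrightarrow> H10_norm \<Omega> \<kappa> u = 0 \<Longrightarrow> u = 0"
  by (rule norm_le_H10_norm) fastforce

lemma energy_norm_le: "x \<in> energy_space \<Omega> \<Longrightarrow> energy_norm \<Omega> \<kappa> x \<le> H10_norm \<Omega> \<kappa> (fst x) + norm (snd x)"
  unfolding energy_norm_eq H10_norm_def norm_eq_sqrt_inner mem_energy_space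
  by (intro sqrt_add_le_add_sqrt H10.ip_nonneg) auto

lemma H10_norm_le_energy_norm: "x \<in> energy_space \<Omega> \<Longrightarrow> H10_norm \<Omega> \<kappa> (fst x) \<le> energy_norm \<Omega> \<kappa> x"
  by (simp add: energy_norm_eq H10_norm_def)

lemma norm_snd_le_energy_norm: "x \<in> energy_space \<Omega> \<Longrightarrow> norm (snd x) \<le> energy_norm \<Omega> \<kappa> x"
  by (simp add: energy_norm_eq norm_eq_sqrt_inner mem_energy_space H10.ip_nonneg)

lemma energy_norm_eq_0:
  assumes "x \<in> energy_space \<Omega>" "energy_norm \<Omega> \<kappa> x = 0"
  shows "x = 0"
proof (rule prod_eqI)
  show "fst x = fst 0"
    using H10_norm_eq_0[of "fst x"] H10_norm_le_energy_norm[OF assms(1)] H10.nrm_nonneg[of "fst x"] assms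
    by (simp add: mem_energy_space)
  show "snd x = snd 0"
    using norm_snd_le_energy_norm[OF assms(1)] assms(2) by simp
qed

text \<open>Transfers convergence in the energy norm to the norm of the product type, in which
  \<open>has_vector_derivative\<close> is formulated.\<close>

lemma norm_le_energy_norm:
  obtains C where "C > 0" "\<And>x. x \<in> energy_space \<Omega> \<Longrightarrow> norm x \<le> C * energy_norm \<Omega> \<kappa> x"
proof -
  obtain C where C: "C > 0" "\<And>u. u \<in> H10 \<Omega> \<Longrightarrow> norm u \<le> C * H10_norm \<Omega> \<kappa> u"
    by (rule norm_le_H10_norm) auto
  have "norm x \<le> (C + 1) * energy_norm \<Omega> \<kappa> x" if x: "x \<in> energy_space \<Omega>" for x
  proof -
    have "norm x \<le> norm (fst x) + norm (snd x)"
      by (metis norm_Pair_le prod.collapse)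
    also have "\<dots> \<le> C * energy_norm \<Omega> \<kappa> x + energy_norm \<Omega> \<kappa> x"
    proof (rule add_mono)
      show "norm (fst x) \<le> C * energy_norm \<Omega> \<kappa> x"
        using C x H10_norm_le_energy_norm[OF x]
        by (intro order_trans[OF C(2)] mult_left_mono) (auto simp: mem_energy_space)
    qed (rule norm_snd_le_energy_norm[OF x])
    finally show ?thesis by (simp add: algebra_simps)
  qed
  then show ?thesis using that[of "C + 1"] C(1) by auto
qed

end

section \<open>The semigroup in eigenmodes\<close>

locale damped_wave = wave_energy \<Omega> \<kappa> for \<Omega> :: "'a::euclidean_space set" and \<kappa> +
  fixes \<nu> :: real and T :: "real \<Rightarrow> 'a L2 \<times> 'a L2 \<Rightarrow> 'a L2 \<times> 'a L2" and \<phi> :: "nat \<Rightarrow> 'a L2"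
  assumes nu_pos: "\<nu> > 0"
    and semigroup: "wave_semigroup \<Omega> \<kappa> \<nu> T"
    and eigenbasis: "dirichlet_eigenbasis \<Omega> \<kappa> \<phi>"
begin

abbreviation A :: "'a L2 \<times> 'a L2 \<Rightarrow> 'a L2 \<times> 'a L2" where
  "A \<equiv> wave_operator \<Omega> \<kappa> \<nu>"

lemma
  assumes "t \<ge> 0" "x \<in> energy_space \<Omega>"
  shows T_mem: "T t x \<in> energy_space \<Omega>"
    and T_contract: "energy_norm \<Omega> \<kappa> (T t x) \<le> energy_norm \<Omega> \<kappa> x"
    and T_scaleR: "T t (c *\<^sub>R x) = c *\<^sub>R T t x"
    and T_0: "T 0 x = x"
  using assms semigroup by (auto simp: wave_semigroup_def contraction_semigroup_def)

lemma T_add: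
  "\<lbrakk>t \<ge> 0; x \<in> energy_space \<Omega>; y \<in> energy_space \<Omega>\<rbrakk> \<Longrightarrow> T t (x + y) = T t x + T t y"
  using semigroup by (auto simp: wave_semigroup_def contraction_semigroup_def)

lemma T_plus: "\<lbrakk>s \<ge> 0; t \<ge> 0; x \<in> energy_space \<Omega>\<rbrakk> \<Longrightarrow> T (s + t) x = T s (T t x)"
  using semigroup by (auto simp: wave_semigroup_def contraction_semigroup_def)

lemma T_diff:
  "\<lbrakk>t \<ge> 0; x \<in> energy_space \<Omega>; y \<in> energy_space \<Omega>\<rbrakk> \<Longrightarrow> T t (x - y) = T t x - T t y"
  using T_add[of t x "(-1) *\<^sub>R y"] T_scaleR[of t y "-1"] E.X_scaleR[of y "-1"] by simp

lemma T_sum: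
  "\<lbrakk>t \<ge> 0; \<And>k. k \<in> I \<Longrightarrow> f k \<in> energy_space \<Omega>\<rbrakk> \<Longrightarrow> T t (\<Sum>k\<in>I. f k) = (\<Sum>k\<in>I. T t (f k))"
proof (induction I rule: infinite_finite_induct)
  case (insert k I)
  then have "T t (f k + (\<Sum>k\<in>I. f k)) = T t (f k) + T t (\<Sum>k\<in>I. f k)"
    by (intro T_add E.X_sum) auto
  with insert show ?case by simp
qed (use T_scaleR[OF _ E.X_0, of t 0] in auto)

lemma T_strongly_continuous:
  "x \<in> energy_space \<Omega> \<Longrightarrow> ((\<lambda>h. energy_norm \<Omega> \<kappa> (T h x - x)) \<longlongrightarrow> 0) (at_right 0)"
  using semigroup by (auto simp: wave_semigroup_def contraction_semigroup_def)

lemma generator_iff: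
  "\<lbrakk>x \<in> energy_space \<Omega>; y \<in> energy_space \<Omega>\<rbrakk> \<Longrightarrow>
    ((\<lambda>h. energy_norm \<Omega> \<kappa> (inverse h *\<^sub>R (T h x - x) - y)) \<longlongrightarrow> 0) (at_right 0) \<longleftrightarrow>
      x \<in> wave_domain \<Omega> \<and> y = A x"
  using semigroup unfolding wave_semigroup_def is_generator_def by blast

lemma domain_mem: "x \<in> wave_domain \<Omega> \<Longrightarrow> x \<in> energy_space \<Omega>"
  and A_mem: "x \<in> wave_domain \<Omega> \<Longrightarrow> A x \<in> energy_space \<Omega>"
  using semigroup unfolding wave_semigroup_def is_generator_def by blast+

lemma generator_tendsto:
  "x \<in> wave_domain \<Omega> \<Longrightarrow>
    ((\<lambda>h. energy_norm \<Omega> \<kappa> (inverse h *\<^sub>R (T h x - x) - A x)) \<longlongrightarrow> 0) (at_right 0)"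
  using generator_iff[OF domain_mem A_mem] by blast

lemma T_commute:
  assumes "s \<ge> 0" "t \<ge> 0" "x \<in> energy_space \<Omega>"
  shows "T s (T t x) = T t (T s x)"
  using T_plus[of s t x] T_plus[of t s x] assms by (simp add: add.commute)

text \<open>\<open>T t\<close> is contractive and commutes with the difference quotients at
  \<open>x\<close>, so the quotients at \<open>T t x\<close> converge to \<open>T t (A x)\<close>.
  The generator is characterised by an equivalence, so this limit yields domain and value
  together.\<close>

lemma T_generator:
  assumes t: "t \<ge> 0" and x: "x \<in> wave_domain \<Omega>"
  shows "T t x \<in> wave_domain \<Omega>" "A (T t x) = T t (A x)"
proof -
  have mem: "x \<in> energy_space \<Omega>" "A x \<in> energy_space \<Omega>"
    using x domain_mem A_mem by auto
  have "((\<lambda>h. energy_norm \<Omega> \<kappa> (inverse h *\<^sub>R (T h (T t x) - T t x) - T t (A x))) \<longlongrightarrow> 0) (at_right 0)"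
  proof (rule tendsto_sandwich[OF _ _ tendsto_const generator_tendsto[OF x]])
    have le: "0 \<le> energy_norm \<Omega> \<kappa> (inverse h *\<^sub>R (T h (T t x) - T t x) - T t (A x)) \<and>
      energy_norm \<Omega> \<kappa> (inverse h *\<^sub>R (T h (T t x) - T t x) - T t (A x))
        \<le> energy_norm \<Omega> \<kappa> (inverse h *\<^sub>R (T h x - x) - A x)" if "h > 0" for h
    proof -
      have X: "inverse h *\<^sub>R (T h x - x) - A x \<in> energy_space \<Omega>" "T h x - x \<in> energy_space \<Omega>"
        using mem T_mem[OF less_imp_le[OF that] mem(1)] by (auto intro!: E.X_diff E.X_scaleR)
      have "inverse h *\<^sub>R (T h (T t x) - T t x) - T t (A x) = T t (inverse h *\<^sub>R (T h x - x) - A x)"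
        using mem X t that T_mem E.X_scaleR by (simp add: T_diff T_scaleR T_commute[of h t])
      then show ?thesis
        using T_contract[OF t X(1)] E.nrm_nonneg[OF T_mem[OF t X(1)]] by simp
    qed
    show "\<forall>\<^sub>F h in at_right 0. 0 \<le> energy_norm \<Omega> \<kappa> (inverse h *\<^sub>R (T h (T t x) - T t x) - T t (A x))"
      using le by (auto simp: eventually_at_filter intro!: always_eventually)
    show "\<forall>\<^sub>F h in at_right 0. energy_norm \<Omega> \<kappa> (inverse h *\<^sub>R (T h (T t x) - T t x) - T t (A x))
        \<le> energy_norm \<Omega> \<kappa> (inverse h *\<^sub>R (T h x - x) - A x)"
      using le by (auto simp: eventually_at_filter intro!: always_eventually)
  qed
  then show "T t x \<in> wave_domain \<Omega>" "A (T t x) = T t (A x)"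
    using generator_iff[OF T_mem[OF t mem(1)] T_mem[OF t mem(2)]] by auto
qed

text \<open>The generator only provides a right limit at 0; the semigroup law and contractivity
  carry it to both sides of \<open>t\<close>.\<close>

lemma T_has_vector_derivative:
  assumes t: "t \<ge> 0" and x: "x \<in> wave_domain \<Omega>"
  shows "((\<lambda>t. T t x) has_vector_derivative T t (A x)) (at t within {0..})"
proof -
  let ?N = "energy_norm \<Omega> \<kappa>"
  have mem: "x \<in> energy_space \<Omega>" "A x \<in> energy_space \<Omega>"
    using x domain_mem A_mem by auto
  obtain C where C: "C > 0" "\<And>x. x \<in> energy_space \<Omega> \<Longrightarrow> norm x \<le> C * ?N x"
    by (rule norm_le_energy_norm) auto
  \<comment> \<open>The first term bounds the quotient to the right of \<open>t\<close>. To the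
    left, \<open>T s\<close> is factored out and \<open>A x\<close> must be exchanged for
    \<open>T h (A x)\<close>, which costs the second term.\<close>
  define \<rho> where "\<rho> = (\<lambda>h. ?N (inverse h *\<^sub>R (T h x - x) - A x) + ?N (T h (A x) - A x))"
  have \<rho>0: "(\<rho> \<longlongrightarrow> 0 + 0) (at_right 0)"
    unfolding \<rho>_def using mem x by (intro tendsto_add generator_tendsto T_strongly_continuous)
  \<comment> \<open>Both sides of \<open>t\<close> are treated through
    \<open>h = \<bar>s - t\<bar>\<close>, which tends to 0 from the right.\<close>
  have abs_lim: "filterlim (\<lambda>s. \<bar>s - t\<bar>) (at_right 0) (at t within {0..})"
    unfolding filterlim_at
  proof
    have "((\<lambda>s. \<bar>s - t\<bar>) \<longlongrightarrow> \<bar>t - t\<bar>) (at t within {0..})"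
      by (intro tendsto_intros)
    then show "((\<lambda>s. \<bar>s - t\<bar>) \<longlongrightarrow> 0) (at t within {0..})" by simp
  qed (auto simp: eventually_at_filter)
  have \<rho>_lim: "((\<lambda>s. \<rho> \<bar>s - t\<bar>) \<longlongrightarrow> 0) (at t within {0..})"
    using filterlim_compose[OF \<rho>0 abs_lim] by simp
  have bound: "?N (T s x - T t x - (s - t) *\<^sub>R T t (A x)) \<le> \<bar>s - t\<bar> * \<rho> \<bar>s - t\<bar>" if s: "s \<ge> 0" "s \<noteq> t" for s
  proof -
    define h where "h = \<bar>s - t\<bar>"
    have h: "h > 0" using s by (simp add: h_def)
    let ?d = "inverse h *\<^sub>R (T h x - x) - A x" and ?c = "A x - T h (A x)"
    have X: "?d \<in> energy_space \<Omega>" "?c \<in> energy_space \<Omega>" "T h x - x \<in> energy_space \<Omega>"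
      "T h x \<in> energy_space \<Omega>" "T h (A x) \<in> energy_space \<Omega>"
      "h *\<^sub>R A x \<in> energy_space \<Omega>" "h *\<^sub>R T h (A x) \<in> energy_space \<Omega>"
      using mem T_mem[OF less_imp_le[OF h] mem(1)] T_mem[OF less_imp_le[OF h] mem(2)]
      by (auto intro!: E.X_diff E.X_scaleR)
    have c: "?N ?c = ?N (T h (A x) - A x)"
      using mem X by (intro E.nrm_minus_commute)
    have hd: "h *\<^sub>R ?d = T h x - x - h *\<^sub>R A x"
      using h by (simp add: scaleR_diff_right)
    show ?thesis
    proof (cases "s > t")
      case True
      then have s_eq: "s = t + h" by (simp add: h_def)
      have "T s x - T t x - (s - t) *\<^sub>R T t (A x) = T t (h *\<^sub>R ?d)"
        unfolding hd using mem X t h by (simp add: s_eq T_plus T_diff T_scaleR)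
      then have "?N (T s x - T t x - (s - t) *\<^sub>R T t (A x)) \<le> ?N (h *\<^sub>R ?d)"
        using T_contract[OF t E.X_scaleR[OF X(1)]] by simp
      also have "\<dots> = h * ?N ?d"
        using X h by (simp add: E.nrm_scaleR)
      also have "\<dots> \<le> h * \<rho> h"
        unfolding \<rho>_def c[symmetric] using h E.nrm_nonneg[OF X(2)] by simp
      finally show ?thesis by (simp add: h_def)
    next
      case False
      then have t_eq: "t = s + h" using s by (simp add: h_def)
      have "T s x - T t x - (s - t) *\<^sub>R T t (A x) = (-1) *\<^sub>R T s (h *\<^sub>R ?d + h *\<^sub>R ?c)"
        unfolding hd using mem X s h
        by (simp add: t_eq T_plus T_diff T_scaleR T_add scaleR_diff_right E.X_diff)
      then have "?N (T s x - T t x - (s - t) *\<^sub>R T t (A x)) = ?N (T s (h *\<^sub>R ?d + h *\<^sub>R ?c))"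
        using E.nrm_scaleR[of "T s (h *\<^sub>R ?d + h *\<^sub>R ?c)" "-1"] X s T_mem
        by (simp add: E.X_add E.X_scaleR)
      also have "\<dots> \<le> ?N (h *\<^sub>R ?d + h *\<^sub>R ?c)"
        using X s by (intro T_contract E.X_add E.X_scaleR)
      also have "\<dots> \<le> ?N (h *\<^sub>R ?d) + ?N (h *\<^sub>R ?c)"
        using X by (intro E.nrm_triangle E.X_scaleR)
      also have "\<dots> = h * \<rho> h"
        using X h by (simp add: E.nrm_scaleR \<rho>_def c distrib_left)
      finally show ?thesis by (simp add: h_def)
    qed
  qed
  show ?thesis
    unfolding has_vector_derivative_def has_derivative_iff_norm
  proof
    show "((\<lambda>s. norm (T s x - T t x - (s - t) *\<^sub>R T t (A x)) / norm (s - t)) \<longlongrightarrow> 0) (at t within {0..})"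
    proof (rule tendsto_sandwich[of "\<lambda>_. 0" _ _ "\<lambda>s. C * \<rho> \<bar>s - t\<bar>"])
      have "norm (T s x - T t x - (s - t) *\<^sub>R T t (A x)) / norm (s - t) \<le> C * \<rho> \<bar>s - t\<bar>"
        if s: "s \<ge> 0" "s \<noteq> t" for s
      proof -
        have "norm (T s x - T t x - (s - t) *\<^sub>R T t (A x)) \<le> C * ?N (T s x - T t x - (s - t) *\<^sub>R T t (A x))"
          using mem T_mem t s by (intro C(2) E.X_diff E.X_scaleR) auto
        also have "\<dots> \<le> C * (\<bar>s - t\<bar> * \<rho> \<bar>s - t\<bar>)"
          using bound[OF s] C(1) by (intro mult_left_mono) auto
        finally show ?thesis using s by (simp add: field_simps)
      qed
      then show "\<forall>\<^sub>F s in at t within {0..}.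
          norm (T s x - T t x - (s - t) *\<^sub>R T t (A x)) / norm (s - t) \<le> C * \<rho> \<bar>s - t\<bar>"
        by (auto simp: eventually_at_filter intro!: always_eventually)
      show "((\<lambda>s. C * \<rho> \<bar>s - t\<bar>) \<longlongrightarrow> 0) (at t within {0..})"
        using tendsto_mult_right_zero[OF \<rho>_lim] by simp
    qed auto
  qed (rule bounded_linear_scaleR_left)
qed

lemma T_component_derivative:
  assumes "t \<ge> 0" "x \<in> wave_domain \<Omega>"
  shows "((\<lambda>t. fst (T t x) \<bullet> w) has_real_derivative fst (T t (A x)) \<bullet> w) (at t within {0..})"
    and "((\<lambda>t. snd (T t x) \<bullet> w) has_real_derivative snd (T t (A x)) \<bullet> w) (at t within {0..})"
  unfolding has_real_derivative_iff_has_vector_derivative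
  by (rule bounded_linear.has_vector_derivative[OF bounded_linear_compose[OF
        bounded_linear_inner_left bounded_linear_fst] T_has_vector_derivative[OF assms]],
      rule bounded_linear.has_vector_derivative[OF bounded_linear_compose[OF
        bounded_linear_inner_left bounded_linear_snd] T_has_vector_derivative[OF assms]])

section \<open>Eigenfunctions and eigenvalues\<close>

lemma
  assumes "k \<ge> 1"
  shows phi_H2: "\<phi> k \<in> H2 \<Omega>" and phi_H10: "\<phi> k \<in> H10 \<Omega>" and phi_L2: "\<phi> k \<in> L2_on \<Omega>"
proof -
  show "\<phi> k \<in> H2 \<Omega>" "\<phi> k \<in> H10 \<Omega>"
    using eigenbasis assms by (auto simp: dirichlet_eigenbasis_def dirichlet_eigenfunction_def)
  then show "\<phi> k \<in> L2_on \<Omega>" by (intro H10_mem_L2_on)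
qed

lemma phi_orthonormal: "j \<ge> 1 \<Longrightarrow> k \<ge> 1 \<Longrightarrow> \<phi> j \<bullet> \<phi> k = (if j = k then 1 else 0)"
  using eigenbasis by (auto simp: dirichlet_eigenbasis_def)

text \<open>The eigenvalue of \<open>\<phi> k\<close> as a Rayleigh quotient with
  \<open>norm (\<phi> k) = 1\<close>. In \<open>dirichlet_eigenfunction\<close> the eigenvalue is
  only asserted to exist.\<close>

definition lam :: "nat \<Rightarrow> real" where "lam k = H10_inner \<Omega> \<kappa> (\<phi> k) (\<phi> k)"

text \<open>Green's formula turns the \<open>H10\<close> inner product with \<open>\<phi> k\<close>
  into the eigenvalue times the L2 inner product; testing with \<open>\<phi> k\<close> itself
  identifies the eigenvalue as \<open>lam k\<close>. It is nonzero because \<open>H10_norm\<close>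
  is definite.\<close>

lemma
  assumes k: "k \<ge> 1"
  shows laplacian_phi: "\<kappa> *\<^sub>R laplacian \<Omega> (\<phi> k) = - (lam k *\<^sub>R \<phi> k)"
    and H10_inner_phi: "u \<in> H10 \<Omega> \<Longrightarrow> H10_inner \<Omega> \<kappa> u (\<phi> k) = lam k * (u \<bullet> \<phi> k)"
    and lam_pos: "lam k > 0"
proof -
  obtain l where l: "- (\<kappa> *\<^sub>R laplacian \<Omega> (\<phi> k)) = l *\<^sub>R \<phi> k"
    using eigenbasis k by (auto simp: dirichlet_eigenbasis_def dirichlet_eigenfunction_def)
  have *: "H10_inner \<Omega> \<kappa> u (\<phi> k) = l * (u \<bullet> \<phi> k)" if "u \<in> H10 \<Omega>" for u
  proof -
    have "H10_inner \<Omega> \<kappa> u (\<phi> k) = - (\<kappa> *\<^sub>R laplacian \<Omega> (\<phi> k)) \<bullet> u"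
      using green[OF phi_H2[OF k] that] by (simp add: H10_inner_def grad_inner_commute[of u])
    then show ?thesis by (simp add: l inner_commute)
  qed
  have "lam k = l"
    using *[OF phi_H10[OF k]] phi_orthonormal[OF k k] by (simp add: lam_def)
  then show "\<kappa> *\<^sub>R laplacian \<Omega> (\<phi> k) = - (lam k *\<^sub>R \<phi> k)"
    and "u \<in> H10 \<Omega> \<Longrightarrow> H10_inner \<Omega> \<kappa> u (\<phi> k) = lam k * (u \<bullet> \<phi> k)"
    using l * by (auto simp: minus_equation_iff)
  have "lam k \<noteq> 0"
  proof
    assume "lam k = 0"
    then have "\<phi> k = 0"
      using H10_norm_eq_0[OF phi_H10[OF k]] by (simp add: lam_def H10_norm_def)
    then show False using phi_orthonormal[OF k k] by simp
  qed
  then show "lam k > 0"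
    using H10.ip_nonneg[OF phi_H10[OF k]] by (simp add: lam_def)
qed

text \<open>Symmetry of the Dirichlet Laplacian: Green's formula is applied to \<open>u\<close> and
  to \<open>\<phi> k\<close>. Through it the coefficients of \<open>A x\<close> along
  \<open>\<phi> k\<close> depend only on those of \<open>x\<close>.\<close>

lemma laplacian_inner_phi:
  assumes "u \<in> H2 \<Omega>" "u \<in> H10 \<Omega>" "k \<ge> 1"
  shows "\<kappa> * (laplacian \<Omega> u \<bullet> \<phi> k) = - (lam k * (u \<bullet> \<phi> k))"
  using H10_inner_phi[OF assms(3,2)] green[OF assms(1) phi_H10[OF assms(3)]]
  by (simp add: H10_inner_def)

lemma orthogonal_to_eigenbasis_eq_0:
  assumes "v \<in> L2_on \<Omega>" "\<And>j. j \<ge> 1 \<Longrightarrow> v \<bullet> \<phi> j = 0"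
  shows "v = 0"
proof (rule eq_0_if_orthogonal_to_approximants)
  fix e :: real assume "e > 0"
  moreover have "complete_in \<phi> (L2_on \<Omega>) norm"
    using eigenbasis by (simp only: dirichlet_eigenbasis_def)
  ultimately obtain w where w: "w \<in> span (\<phi> ` {1..})" "norm (v - w) < e"
    using assms(1) unfolding complete_in_def by meson
  have "orthogonal v w"
    using w(1) by (rule orthogonal_to_span) (use assms(2) in \<open>auto simp: orthogonal_def\<close>)
  with w(2) show "\<exists>w. norm (v - w) < e \<and> v \<bullet> w = 0" by (auto simp: orthogonal_def)
qed

lemma single_mode_eq:
  assumes "v \<in> L2_on \<Omega>" "k \<ge> 1" "\<And>j. \<lbrakk>j \<ge> 1; j \<noteq> k\<rbrakk> \<Longrightarrow> v \<bullet> \<phi> j = 0"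
  shows "v = (v \<bullet> \<phi> k) *\<^sub>R \<phi> k"
proof -
  have "v - (v \<bullet> \<phi> k) *\<^sub>R \<phi> k = 0"
  proof (rule orthogonal_to_eigenbasis_eq_0)
    show "v - (v \<bullet> \<phi> k) *\<^sub>R \<phi> k \<in> L2_on \<Omega>"
      using assms phi_L2 by (intro L2.X_diff L2.X_scaleR)
    show "(v - (v \<bullet> \<phi> k) *\<^sub>R \<phi> k) \<bullet> \<phi> j = 0" if "j \<ge> 1" for j
      using assms that phi_orthonormal[OF assms(2) that] by (auto simp: inner_diff_left)
  qed
  then show ?thesis by simp
qed

text \<open>The coefficients of \<open>T t x\<close> along \<open>\<phi> j\<close> solve \<open>a' = b\<close>, \<open>b' = - \<lambda> a - \<nu> b\<close>, whose energy
  \<open>\<lambda> a\<^sup>2 + b\<^sup>2\<close> decays; hence modes absent initially stay absent.\<close>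

lemma T_preserves_vanishing_modes:
  assumes x: "x \<in> wave_domain \<Omega>" and j: "j \<ge> 1" and t: "t \<ge> 0"
    and x0: "fst x \<bullet> \<phi> j = 0" "snd x \<bullet> \<phi> j = 0"
  shows "fst (T t x) \<bullet> \<phi> j = 0" "snd (T t x) \<bullet> \<phi> j = 0"
proof -
  define a where "a = (\<lambda>t. fst (T t x) \<bullet> \<phi> j)"
  define b where "b = (\<lambda>t. snd (T t x) \<bullet> \<phi> j)"
  define e where "e = (\<lambda>t. lam j * (a t)\<^sup>2 + (b t)\<^sup>2)"
  have a': "(a has_real_derivative b s) (at s within {0..})"
    and b': "(b has_real_derivative - lam j * a s - \<nu> * b s) (at s within {0..})" if s: "s \<ge> 0" for s
  proof -
    have Ts: "fst (T s x) \<in> H2 \<Omega>" "fst (T s x) \<in> H10 \<Omega>"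
      using T_generator(1)[OF s x] by (auto simp: wave_domain_def)
    show "(a has_real_derivative b s) (at s within {0..})"
      using T_component_derivative(1)[OF s x, of "\<phi> j"] T_generator(2)[OF s x, symmetric]
      by (simp add: a_def b_def wave_operator_def case_prod_unfold)
    show "(b has_real_derivative - lam j * a s - \<nu> * b s) (at s within {0..})"
      using T_component_derivative(2)[OF s x, of "\<phi> j"] T_generator(2)[OF s x, symmetric]
        laplacian_inner_phi[OF Ts j]
      by (simp add: a_def b_def wave_operator_def case_prod_unfold inner_diff_left)
  qed
  \<comment> \<open>The mixed terms \<open>2 * lam j * a s * b s\<close> cancel, so only the damping
    remains.\<close>
  have e': "(e has_real_derivative - 2 * \<nu> * (b s)\<^sup>2) (at s within {0..})" if "s \<ge> 0" for s
    unfolding e_def using a'[OF that] b'[OF that]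
    by (auto intro!: derivative_eq_intros simp: power2_eq_square algebra_simps)
  have "e t \<le> e 0"
  proof (rule DERIV_nonpos_imp_decreasing_open[OF t])
    show "\<exists>y. (e has_real_derivative y) (at s) \<and> y \<le> 0" if "0 < s" "s < t" for s
    proof -
      have "(e has_real_derivative - 2 * \<nu> * (b s)\<^sup>2) (at s)"
        using e'[of s] that at_within_interior[of s "{0..}"] by simp
      then show ?thesis using nu_pos by (intro exI conjI) auto
    qed
    have "continuous_on {0..} e"
      using e' by (intro DERIV_continuous_on) auto
    then show "continuous_on {0..t} e"
      by (rule continuous_on_subset) auto
  qed
  then have "lam j * (a t)\<^sup>2 + (b t)\<^sup>2 \<le> 0"
    using x0 T_0[OF t domain_mem[OF x]] by (simp add: e_def a_def b_def)
  moreover have "0 \<le> lam j * (a t)\<^sup>2" "0 \<le> (b t)\<^sup>2"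
    using lam_pos[OF j] by auto
  ultimately have "lam j * (a t)\<^sup>2 = 0" "(b t)\<^sup>2 = 0" by linarith+
  then show "fst (T t x) \<bullet> \<phi> j = 0" "snd (T t x) \<bullet> \<phi> j = 0"
    using lam_pos[OF j] by (auto simp: a_def b_def)
qed

section \<open>The propagators of a single mode\<close>

lemma mode_domain: "k \<ge> 1 \<Longrightarrow> (\<phi> k, 0) \<in> wave_domain \<Omega>" "k \<ge> 1 \<Longrightarrow> (0, \<phi> k) \<in> wave_domain \<Omega>"
  using phi_H2 phi_H10 H10.X_0 H1.X_0 by (auto simp: wave_domain_def H2_def weak_partial_0)

text \<open>Entries of the fundamental matrix of mode \<open>k\<close>: the first letter names the
  component carrying the initial mode, the second the component read off. Taking them from
  \<open>T\<close> rather than from a closed formula avoids separating overdamped, critical and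
  underdamped modes.\<close>

definition S_uu where "S_uu k t = fst (T t (\<phi> k, 0)) \<bullet> \<phi> k"
definition S_uv where "S_uv k t = snd (T t (\<phi> k, 0)) \<bullet> \<phi> k"
definition S_vu where "S_vu k t = fst (T t (0, \<phi> k)) \<bullet> \<phi> k"
definition S_vv where "S_vv k t = snd (T t (0, \<phi> k)) \<bullet> \<phi> k"

lemma T_mode:
  assumes k: "k \<ge> 1" and t: "t \<ge> 0"
  shows "T t (\<phi> k, 0) = (S_uu k t *\<^sub>R \<phi> k, S_uv k t *\<^sub>R \<phi> k)"
    and "T t (0, \<phi> k) = (S_vu k t *\<^sub>R \<phi> k, S_vv k t *\<^sub>R \<phi> k)"
proof -
  have *: "T t x = ((fst (T t x) \<bullet> \<phi> k) *\<^sub>R \<phi> k, (snd (T t x) \<bullet> \<phi> k) *\<^sub>R \<phi> k)"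
    if x: "x \<in> wave_domain \<Omega>" "\<And>j. \<lbrakk>j \<ge> 1; j \<noteq> k\<rbrakk> \<Longrightarrow> fst x \<bullet> \<phi> j = 0 \<and> snd x \<bullet> \<phi> j = 0" for x
  proof -
    have "T t x \<in> energy_space \<Omega>"
      using T_mem[OF t domain_mem[OF x(1)]] .
    then have mem: "fst (T t x) \<in> L2_on \<Omega>" "snd (T t x) \<in> L2_on \<Omega>"
      by (auto simp: mem_energy_space H10_mem_L2_on)
    show ?thesis
      using single_mode_eq[OF mem(1) k] single_mode_eq[OF mem(2) k]
        T_preserves_vanishing_modes[OF x(1) _ t] x(2) by (metis prod.collapse)
  qed
  show "T t (\<phi> k, 0) = (S_uu k t *\<^sub>R \<phi> k, S_uv k t *\<^sub>R \<phi> k)"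
    using *[OF mode_domain(1)[OF k]] k phi_orthonormal by (simp add: S_uu_def S_uv_def)
  show "T t (0, \<phi> k) = (S_vu k t *\<^sub>R \<phi> k, S_vv k t *\<^sub>R \<phi> k)"
    using *[OF mode_domain(2)[OF k]] k phi_orthonormal by (simp add: S_vu_def S_vv_def)
qed

lemma propagators_at_0: "k \<ge> 1 \<Longrightarrow> S_uu k 0 = 1" "k \<ge> 1 \<Longrightarrow> S_uv k 0 = 0" "k \<ge> 1 \<Longrightarrow> S_vu k 0 = 0" "k \<ge> 1 \<Longrightarrow> S_vv k 0 = 1"
  using T_0[OF order_refl domain_mem[OF mode_domain(1), of k]]
    T_0[OF order_refl domain_mem[OF mode_domain(2), of k]] phi_orthonormal[of k k]
  by (simp_all add: S_uu_def S_uv_def S_vu_def S_vv_def)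

text \<open>The derivative is written as \<open>T t (A x)\<close> rather than
  \<open>A (T t x)\<close>, which couples propagators with the same output and different initial
  components. This is the form that variation of constants calls for, where they are differentiated
  in \<open>t - x\<close>.\<close>

lemma propagator_derivatives:
  assumes k: "k \<ge> 1" and t: "t \<ge> 0"
  shows "(S_uu k has_real_derivative - lam k * S_vu k t) (at t within {0..})"
    and "(S_uv k has_real_derivative - lam k * S_vv k t) (at t within {0..})"
    and "(S_vu k has_real_derivative S_uu k t - \<nu> * S_vu k t) (at t within {0..})"
    and "(S_vv k has_real_derivative S_uv k t - \<nu> * S_vv k t) (at t within {0..})"
proof -
  note dom = mode_domain(1)[OF k] mode_domain(2)[OF k]
  have "A (\<phi> k, 0) = (- lam k) *\<^sub>R (0, \<phi> k)"
    using laplacian_phi[OF k] by (simp add: wave_operator_def)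
  then have 1: "T t (A (\<phi> k, 0)) = (- lam k) *\<^sub>R T t (0, \<phi> k)"
    using t domain_mem[OF dom(2)] by (simp only: T_scaleR)
  have "A (0, \<phi> k) = (\<phi> k, 0) - \<nu> *\<^sub>R (0, \<phi> k)"
    by (simp add: wave_operator_def laplacian_0)
  then have 2: "T t (A (0, \<phi> k)) = T t (\<phi> k, 0) - \<nu> *\<^sub>R T t (0, \<phi> k)"
    using t domain_mem[OF dom(1)] domain_mem[OF dom(2)] E.X_scaleR by (simp only: T_diff T_scaleR)
  show "(S_uu k has_real_derivative - lam k * S_vu k t) (at t within {0..})"
    and "(S_uv k has_real_derivative - lam k * S_vv k t) (at t within {0..})"
    and "(S_vu k has_real_derivative S_uu k t - \<nu> * S_vu k t) (at t within {0..})"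
    and "(S_vv k has_real_derivative S_uv k t - \<nu> * S_vv k t) (at t within {0..})"
    using T_component_derivative[OF t dom(1), of "\<phi> k"] T_component_derivative[OF t dom(2), of "\<phi> k"]
    unfolding 1 2 S_uu_def[abs_def] S_uv_def[abs_def] S_vu_def[abs_def] S_vv_def[abs_def]
    by (simp_all add: inner_diff_left)
qed

end

section \<open>Variation of constants\<close>

text \<open>The substitution \<open>x = t * y\<close> moves the variable end point into the
  integrand over a fixed interval, where continuity in a parameter applies. At \<open>t = 0\<close>
  both sides vanish.\<close>

lemma
  fixes c f :: "real \<Rightarrow> real"
  assumes c: "continuous_on {0..} c" and f: "continuous_on {0..a} f"
  shows convolution_integrable: "t \<in> {0..a} \<Longrightarrow> (\<lambda>x. c (t - x) * f x) integrable_on {0..t}"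
    and continuous_on_convolution: "continuous_on {0..a} (\<lambda>t. integral {0..t} (\<lambda>x. c (t - x) * f x))"
proof -
  have cont: "continuous_on {0..t} (\<lambda>x. c (t - x) * f x)" if "t \<in> {0..a}" for t
    using that by (intro continuous_on_mult continuous_on_compose2[OF c] continuous_on_subset[OF f]
        continuous_intros) auto
  show *: "(\<lambda>x. c (t - x) * f x) integrable_on {0..t}" if "t \<in> {0..a}" for t
    using cont[OF that] by (rule integrable_continuous_real)
  have eq: "integral {0..t} (\<lambda>x. c (t - x) * f x) =
      t * integral (cbox 0 1) (\<lambda>y. c (t - t * y) * f (t * y))" if t: "t \<in> {0..a}" for t
  proof (cases "t = 0")
    case False
    then have pos: "t > 0" using t by simp
    have "((\<lambda>y. c (t - t * y) * f (t * y)) has_integral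
        (1 / \<bar>t\<bar>) *\<^sub>R integral {0..t} (\<lambda>x. c (t - x) * f x)) ((\<lambda>x. x / t) ` {0..t})"
      using has_integral_stretch_real[OF integrable_integral[OF *[OF t]] False] .
    moreover have "(\<lambda>x. x / t) ` {0..t} = {0..1}"
    proof
      show "{0..1} \<subseteq> (\<lambda>x. x / t) ` {0..t}"
      proof
        fix y :: real assume "y \<in> {0..1}"
        then show "y \<in> (\<lambda>x. x / t) ` {0..t}"
          using pos by (intro image_eqI[of _ _ "t * y"]) (auto simp: mult_left_le)
      qed
    qed (use pos in auto)
    ultimately show ?thesis
      using pos by (simp add: integral_unique)
  qed simp
  have "continuous_on ({0..a} \<times> cbox 0 1) (\<lambda>(t, y). c (t - t * y) * f (t * y))"
    unfolding case_prod_unfold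
  proof (intro continuous_on_mult continuous_on_compose2[OF c] continuous_on_compose2[OF f] continuous_intros)
    show "(\<lambda>z. fst z - fst z * snd z) ` ({0..a} \<times> cbox 0 1) \<subseteq> {0..}"
      by (auto simp: mult_left_le)
    show "(\<lambda>z. fst z * snd z) ` ({0..a} \<times> cbox 0 1) \<subseteq> {0..a}"
    proof (clarsimp)
      fix t y :: real assume "0 \<le> t" "t \<le> a" "0 \<le> y" "y \<le> 1"
      then show "t * y \<le> a" using mult_left_le[of y t] by linarith
    qed
  qed
  then have "continuous_on {0..a} (\<lambda>t. t * integral (cbox 0 1) (\<lambda>y. c (t - t * y) * f (t * y)))"
    by (intro continuous_on_mult continuous_on_id integral_continuous_on_param)
  then show "continuous_on {0..a} (\<lambda>t. integral {0..t} (\<lambda>x. c (t - x) * f x))"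
    by (rule continuous_on_eq) (simp add: eq)
qed

text \<open>The derivative of \<open>c1 (t - x) * \<alpha> x + c2 (t - x) * \<beta> x\<close> in
  \<open>x\<close> is \<open>c2 (t - x) * f x\<close>, because the homogeneous terms cancel. Initial
  values \<open>(1, 0)\<close> and \<open>(0, 1)\<close> of \<open>(c1, c2)\<close> select
  \<open>\<alpha> t\<close> and \<open>\<beta> t\<close>.\<close>

lemma variation_of_constants:
  fixes \<alpha> \<beta> c1 c2 f :: "real \<Rightarrow> real"
  assumes t: "0 \<le> t"
    and c1: "\<And>x. x \<ge> 0 \<Longrightarrow> (c1 has_real_derivative - l * c2 x) (at x within {0..})"
    and c2: "\<And>x. x \<ge> 0 \<Longrightarrow> (c2 has_real_derivative c1 x - \<nu> * c2 x) (at x within {0..})"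
    and \<alpha>: "\<And>x. \<lbrakk>0 < x; x < t\<rbrakk> \<Longrightarrow> (\<alpha> has_real_derivative \<beta> x) (at x)" "continuous_on {0..t} \<alpha>"
    and \<beta>: "\<And>x. \<lbrakk>0 < x; x < t\<rbrakk> \<Longrightarrow> (\<beta> has_real_derivative - l * \<alpha> x - \<nu> * \<beta> x + f x) (at x)"
      "continuous_on {0..t} \<beta>"
  shows "((\<lambda>x. c2 (t - x) * f x) has_integral
    c1 0 * \<alpha> t + c2 0 * \<beta> t - (c1 t * \<alpha> 0 + c2 t * \<beta> 0)) {0..t}"
proof -
  let ?g = "\<lambda>x. c1 (t - x) * \<alpha> x + c2 (t - x) * \<beta> x"
  have cont: "continuous_on {0..} c1" "continuous_on {0..} c2"
    using c1 c2 by (auto intro!: DERIV_continuous_on)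
  have "((\<lambda>x. c2 (t - x) * f x) has_integral ?g t - ?g 0) {0..t}"
  proof (rule fundamental_theorem_of_calculus_interior[OF t])
    show "continuous_on {0..t} ?g"
      by (intro continuous_intros \<alpha>(2) \<beta>(2) continuous_on_compose2[OF cont(1)] continuous_on_compose2[OF cont(2)])
        auto
    fix x assume x: "x \<in> {0<..<t}"
    have 1: "(c1 has_real_derivative - l * c2 (t - x)) (at (t - x))"
      "(c2 has_real_derivative c1 (t - x) - \<nu> * c2 (t - x)) (at (t - x))"
      using c1[of "t - x"] c2[of "t - x"] x at_within_interior[of "t - x" "{0..}"] by auto
    have 3: "((\<lambda>x. t - x) has_real_derivative - 1) (at x)"
      by (auto intro!: derivative_eq_intros)
    have 2: "((\<lambda>x. c1 (t - x)) has_real_derivative - l * c2 (t - x) * (- 1)) (at x)"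
      "((\<lambda>x. c2 (t - x)) has_real_derivative (c1 (t - x) - \<nu> * c2 (t - x)) * (- 1)) (at x)"
      by (rule DERIV_chain2[where f = c1, OF 1(1) 3], rule DERIV_chain2[where f = c2, OF 1(2) 3])
    have "(?g has_real_derivative c2 (t - x) * f x) (at x)"
      using x by (auto intro!: derivative_eq_intros 2 \<alpha>(1) \<beta>(1) simp: algebra_simps)
    then show "(?g has_vector_derivative c2 (t - x) * f x) (at x)"
      by (simp add: has_real_derivative_iff_has_vector_derivative)
  qed
  then show ?thesis by simp
qed

section \<open>The Galerkin approximation\<close>

text \<open>A linear combination involves finitely many modes, so their indices are bounded.\<close>

lemma span_image_atLeast:
  assumes "w \<in> span (\<phi> ` {1..})"
  obtains m where "\<And>n. n \<ge> m \<Longrightarrow> w \<in> eigenspan \<phi> n"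
proof -
  obtain S where S: "finite S" "S \<subseteq> \<phi> ` {1..}" "w \<in> span S"
    using assms unfolding span_explicit by (auto intro: span_sum span_scale span_base)
  then obtain C where C: "C \<subseteq> {1..}" "finite C" "S = \<phi> ` C"
    by (meson finite_subset_image)
  obtain m where m: "\<forall>k\<in>C. k \<le> m"
    using C(2) finite_nat_set_iff_bounded_le by blast
  have "w \<in> eigenspan \<phi> n" if "n \<ge> m" for n
  proof -
    have "C \<subseteq> {1..n}" using C(1) m that by fastforce
    then show ?thesis
      using S(3) span_mono[of S "\<phi> ` {1..n}"] unfolding C(3) eigenspan_def by blast
  qed
  then show ?thesis by (rule that)
qed

section \<open>Pairing with the dual space\<close>

context wave_energy
begin

text \<open>\<open>Hm1_norm\<close> is a supremum of reals and informative only for a bounded set,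
  so some bound \<open>C\<close> comes first; then \<open>w\<close> is normalised. The premises are
  phrased for a bare \<open>l\<close> to fit a difference quotient minus its limit.\<close>

lemma le_Hm1_norm:
  assumes w: "w \<in> H10 \<Omega>"
    and scale: "\<And>c v. v \<in> H10 \<Omega> \<Longrightarrow> l (c *\<^sub>R v) = c * l v"
    and bound: "\<And>v. v \<in> H10 \<Omega> \<Longrightarrow> \<bar>l v\<bar> \<le> C * H10_norm \<Omega> \<kappa> v"
  shows "\<bar>l w\<bar> \<le> Hm1_norm \<Omega> \<kappa> l * H10_norm \<Omega> \<kappa> w"
proof (cases "H10_norm \<Omega> \<kappa> w = 0")
  case True
  then show ?thesis using bound[OF w] by simp
next
  case False
  let ?n = "H10_norm \<Omega> \<kappa> w" and ?v = "inverse (H10_norm \<Omega> \<kappa> w) *\<^sub>R w"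
  have n: "?n > 0" using False H10.nrm_nonneg[OF w] by simp
  have "bdd_above ((\<lambda>v. \<bar>l v\<bar>) ` {v \<in> H10 \<Omega>. H10_norm \<Omega> \<kappa> v \<le> 1})"
  proof (rule bdd_aboveI2)
    fix v assume v: "v \<in> {v \<in> H10 \<Omega>. H10_norm \<Omega> \<kappa> v \<le> 1}"
    have "\<bar>l v\<bar> \<le> \<bar>C\<bar> * H10_norm \<Omega> \<kappa> v"
      using v bound[of v] mult_right_mono[OF abs_ge_self[of C] H10.nrm_nonneg[of v]] by fastforce
    also have "\<dots> \<le> \<bar>C\<bar> * 1"
      using v by (intro mult_left_mono) auto
    finally show "\<bar>l v\<bar> \<le> \<bar>C\<bar>" by simp
  qed
  moreover have "?v \<in> {v \<in> H10 \<Omega>. H10_norm \<Omega> \<kappa> v \<le> 1}"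
    using w n by (simp add: H10.X_scaleR H10.nrm_scaleR)
  ultimately have "\<bar>l ?v\<bar> \<le> Hm1_norm \<Omega> \<kappa> l"
    unfolding Hm1_norm_def by (intro cSUP_upper)
  then show ?thesis
    using n w by (simp add: scale abs_mult field_simps)
qed

end

section \<open>Projections onto spans of eigenfunctions and the Galerkin coefficients\<close>

context damped_wave
begin

text \<open>The truncated expansion with L2 coefficients; it will equal \<open>Q_tilde\<close> on
  \<open>L2_on \<Omega>\<close> and \<open>Q_proj\<close> on \<open>H10 \<Omega>\<close>.\<close>

definition mode_proj :: "nat \<Rightarrow> 'a L2 \<Rightarrow> 'a L2" where
  "mode_proj n v = (\<Sum>k=1..n. (v \<bullet> \<phi> k) *\<^sub>R \<phi> k)"

lemma mode_proj_mem_eigenspan: "mode_proj n v \<in> eigenspan \<phi> n"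
  unfolding mode_proj_def eigenspan_def by (intro span_sum span_scale span_base) auto

lemma eigenspan_H10: "eigenspan \<phi> n \<subseteq> H10 \<Omega>"
  unfolding eigenspan_def using phi_H10 by (intro span_minimal subspace_H10) auto

lemma eigenspan_L2: "eigenspan \<phi> n \<subseteq> L2_on \<Omega>"
  using eigenspan_H10 H10_mem_L2_on by blast

lemma mode_proj_H10: "mode_proj n v \<in> H10 \<Omega>" and mode_proj_L2: "mode_proj n v \<in> L2_on \<Omega>"
  using mode_proj_mem_eigenspan eigenspan_H10 eigenspan_L2 by blast+

lemma mode_proj_diff: "mode_proj n (v - w) = mode_proj n v - mode_proj n w"
  by (simp add: mode_proj_def inner_diff_left scaleR_diff_left sum_subtractf)

lemma mode_proj_inner: "j \<in> {1..n} \<Longrightarrow> mode_proj n v \<bullet> \<phi> j = v \<bullet> \<phi> j"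
proof -
  assume j: "j \<in> {1..n}"
  have "mode_proj n v \<bullet> \<phi> j = (\<Sum>k=1..n. if k = j then v \<bullet> \<phi> k else 0)"
    unfolding mode_proj_def inner_sum_left using j by (intro sum.cong) (auto simp: phi_orthonormal)
  then show ?thesis using j by simp
qed

lemma inner_mode_proj_eq_0:
  assumes "w \<in> eigenspan \<phi> n"
  shows "(v - mode_proj n v) \<bullet> w = 0"
proof -
  have "orthogonal (v - mode_proj n v) w"
    using assms unfolding eigenspan_def
    by (rule orthogonal_to_span) (auto simp: orthogonal_def inner_diff_left mode_proj_inner)
  then show ?thesis by (simp add: orthogonal_def)
qed

text \<open>The \<open>H10\<close> inner product with \<open>\<phi> k\<close> is
  \<open>lam k\<close> times the L2 one, so the residual, orthogonal to the first \<open>n\<close>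
  modes in L2, is so in \<open>H10\<close> too.\<close>

lemma H10_inner_mode_proj_eq_0:
  assumes u: "u \<in> H10 \<Omega>" and w: "w \<in> eigenspan \<phi> n"
  shows "H10_inner \<Omega> \<kappa> (u - mode_proj n u) w = 0"
proof -
  let ?d = "u - mode_proj n u"
  have d: "?d \<in> H10 \<Omega>" using u mode_proj_H10 by (intro H10.X_diff)
  \<comment> \<open>Membership is carried through the induction because linearity of
    \<open>H10_inner\<close> is available only on \<open>H10 \<Omega>\<close>.\<close>
  have "w \<in> H10 \<Omega> \<and> H10_inner \<Omega> \<kappa> ?d w = 0"
    using w unfolding eigenspan_def
  proof (induction rule: span_induct)
    case base
    show ?case
      using d by (auto simp: subspace_def H10.X_0 H10.X_add H10.X_scaleR H10.ip_add_right
          H10.ip_scaleR_right H10.ip_commute[OF _ H10.X_0] H10.ip_0_left)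
  next
    case (step x)
    then obtain k where k: "k \<in> {1..n}" "x = \<phi> k" by auto
    then show ?case
      using H10_inner_phi[OF _ d, of k] phi_H10[of k] by (simp add: inner_diff_left mode_proj_inner)
  qed
  then show ?thesis by simp
qed

lemma Q_tilde_eq: "v \<in> L2_on \<Omega> \<Longrightarrow> Q_tilde \<phi> n v = mode_proj n v"
  unfolding Q_tilde_def
  by (rule L2.orthogonal_projection_eq)
    (auto simp: eigenspan_def[symmetric] mode_proj_mem_eigenspan inner_mode_proj_eq_0
      subspace_span[of "\<phi> ` {1..n}", folded eigenspan_def] subsetD[OF eigenspan_L2])

lemma Q_proj_eq: "u \<in> H10 \<Omega> \<Longrightarrow> Q_proj \<Omega> \<kappa> \<phi> n u = mode_proj n u"
  unfolding Q_proj_def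
  by (rule H10.orthogonal_projection_eq)
    (auto simp: mode_proj_mem_eigenspan H10_inner_mode_proj_eq_0 H10_norm_eq_0
      subspace_span[of "\<phi> ` {1..n}", folded eigenspan_def] subsetD[OF eigenspan_H10])

definition energy_proj :: "nat \<Rightarrow> 'a L2 \<times> 'a L2 \<Rightarrow> 'a L2 \<times> 'a L2" where
  "energy_proj n x = (mode_proj n (fst x), mode_proj n (snd x))"

lemma energy_proj_mem: "energy_proj n x \<in> energy_space \<Omega>"
  by (simp add: energy_proj_def mem_energy_space mode_proj_H10 mode_proj_L2)

lemma energy_proj_orthogonal:
  assumes "x \<in> energy_space \<Omega>" "w1 \<in> eigenspan \<phi> n" "w2 \<in> eigenspan \<phi> n"
  shows "energy_inner (x - energy_proj n x) (w1, w2) = 0"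
  using assms by (simp add: energy_inner_def energy_proj_def mem_energy_space
      H10_inner_mode_proj_eq_0 inner_mode_proj_eq_0)

text \<open>Best approximation: the error is orthogonal to
  \<open>energy_proj n x - (w1, w2)\<close>, so Pythagoras applies to \<open>x - (w1, w2)\<close>.
  The choice \<open>(0, 0)\<close> shows that the error map is a contraction.\<close>

lemma energy_norm_diff_energy_proj_le:
  assumes x: "x \<in> energy_space \<Omega>" and w: "w1 \<in> eigenspan \<phi> n" "w2 \<in> eigenspan \<phi> n"
  shows "energy_norm \<Omega> \<kappa> (x - energy_proj n x) \<le> energy_norm \<Omega> \<kappa> (x - (w1, w2))"
proof -
  have sub: "subspace (eigenspan \<phi> n)" by (simp add: eigenspan_def)
  have W: "(w1, w2) \<in> energy_space \<Omega>"
    using w eigenspan_H10 eigenspan_L2 by (auto simp: energy_space_def)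
  have p: "energy_proj n x - (w1, w2) = (mode_proj n (fst x) - w1, mode_proj n (snd x) - w2)"
    by (simp add: energy_proj_def)
  have "energy_inner (x - energy_proj n x) (energy_proj n x - (w1, w2)) = 0"
    unfolding p using x w by (intro energy_proj_orthogonal subspace_diff[OF sub] mode_proj_mem_eigenspan)
  moreover have eq: "x - (w1, w2) - (energy_proj n x - (w1, w2)) = x - energy_proj n x"
    by simp
  ultimately show ?thesis
    using E.nrm_diff_projection_le[OF E.X_diff[OF x W] E.X_diff[OF energy_proj_mem W], of n x]
    unfolding eq by blast
qed

text \<open>Completeness supplies some approximant of each component from finitely many modes; by
  best approximation \<open>energy_proj n x\<close> does at least as well for all large
  \<open>n\<close>.\<close>

lemma energy_proj_tendsto:
  assumes x: "x \<in> energy_space \<Omega>"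
  shows "(\<lambda>n. energy_norm \<Omega> \<kappa> (x - energy_proj n x)) \<longlonglongrightarrow> 0"
proof (rule LIMSEQ_I)
  fix e :: real assume e: "e > 0"
  have complete: "complete_in \<phi> (H10 \<Omega>) (H10_norm \<Omega> \<kappa>)" "complete_in \<phi> (L2_on \<Omega>) norm"
    using eigenbasis by (simp_all only: dirichlet_eigenbasis_def)
  have comp: "fst x \<in> H10 \<Omega>" "snd x \<in> L2_on \<Omega>" using x by (auto simp: mem_energy_space)
  obtain w1 where w1: "w1 \<in> span (\<phi> ` {1..})" "H10_norm \<Omega> \<kappa> (fst x - w1) < e / 2"
    using complete(1) comp(1) half_gt_zero[OF e] unfolding complete_in_def by meson
  obtain w2 where w2: "w2 \<in> span (\<phi> ` {1..})" "norm (snd x - w2) < e / 2"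
    using complete(2) comp(2) half_gt_zero[OF e] unfolding complete_in_def by meson
  obtain m1 where m1: "\<And>n. n \<ge> m1 \<Longrightarrow> w1 \<in> eigenspan \<phi> n" using span_image_atLeast[OF w1(1)] by blast
  obtain m2 where m2: "\<And>n. n \<ge> m2 \<Longrightarrow> w2 \<in> eigenspan \<phi> n" using span_image_atLeast[OF w2(1)] by blast
  have "norm (energy_norm \<Omega> \<kappa> (x - energy_proj n x) - 0) < e" if n: "n \<ge> max m1 m2" for n
  proof -
    have w: "w1 \<in> eigenspan \<phi> n" "w2 \<in> eigenspan \<phi> n" using m1 m2 n by auto
    then have W: "x - (w1, w2) \<in> energy_space \<Omega>"
      using x eigenspan_H10 eigenspan_L2 by (intro E.X_diff) (auto simp: energy_space_def)
    have "energy_norm \<Omega> \<kappa> (x - energy_proj n x) \<le> energy_norm \<Omega> \<kappa> (x - (w1, w2))"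
      using x w by (rule energy_norm_diff_energy_proj_le)
    also have "\<dots> < e"
      using energy_norm_le[OF W] w1(2) w2(2) by simp
    finally show ?thesis
      using E.nrm_nonneg[OF E.X_diff[OF x energy_proj_mem]] by simp
  qed
  then show "\<exists>m. \<forall>n\<ge>m. norm (energy_norm \<Omega> \<kappa> (x - energy_proj n x) - 0) < e" by blast
qed

text \<open>Duhamel's formula in mode \<open>k\<close>. The force enters only the second component,
  so it is convolved with \<open>S_vu\<close> here and with \<open>S_vv\<close> in
  \<open>galerkin_v\<close>.\<close>

definition galerkin_u :: "(real \<Rightarrow> 'a L2) \<Rightarrow> 'a L2 \<times> 'a L2 \<Rightarrow> nat \<Rightarrow> real \<Rightarrow> real" where
  "galerkin_u F G k t = S_uu k t * (fst G \<bullet> \<phi> k) + S_vu k t * (snd G \<bullet> \<phi> k) +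
    integral {0..t} (\<lambda>x. S_vu k (t - x) * (F x \<bullet> \<phi> k))"

definition galerkin_v :: "(real \<Rightarrow> 'a L2) \<Rightarrow> 'a L2 \<times> 'a L2 \<Rightarrow> nat \<Rightarrow> real \<Rightarrow> real" where
  "galerkin_v F G k t = S_uv k t * (fst G \<bullet> \<phi> k) + S_vv k t * (snd G \<bullet> \<phi> k) +
    integral {0..t} (\<lambda>x. S_vv k (t - x) * (F x \<bullet> \<phi> k))"

lemma continuous_on_propagators:
  assumes "k \<ge> 1"
  shows "continuous_on {0..} (S_uu k)" "continuous_on {0..} (S_uv k)"
    "continuous_on {0..} (S_vu k)" "continuous_on {0..} (S_vv k)"
  using propagator_derivatives[OF assms] by (auto intro!: DERIV_continuous_on)

lemma continuous_on_inner_C_on: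
  fixes F :: "real \<Rightarrow> 'a L2"
  assumes "F \<in> C_on J X norm"
  shows "continuous_on J (\<lambda>t. F t \<bullet> w)"
proof -
  have "continuous_on J F"
    unfolding continuous_on_def
  proof
    fix t assume "t \<in> J"
    then have "((\<lambda>s. norm (F s - F t)) \<longlongrightarrow> 0) (at t within J)"
      using assms by (simp add: C_on_def)
    then show "(F \<longlongrightarrow> F t) (at t within J)"
      by (simp add: tendsto_norm_zero_iff LIM_zero_iff)
  qed
  then show ?thesis by (intro continuous_intros)
qed

lemma continuous_on_galerkin_coefficients:
  assumes "k \<ge> 1" and F: "F \<in> C_on {0..T1} (L2_on \<Omega>) norm"
  shows "continuous_on {0..T1} (galerkin_u F G k)" "continuous_on {0..T1} (galerkin_v F G k)"
proof -
  have sub: "{0..T1} \<subseteq> {0..}" by auto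
  note S = continuous_on_propagators[OF assms(1)]
  note S' = S[THEN continuous_on_subset[OF _ sub]]
  show "continuous_on {0..T1} (galerkin_u F G k)"
    unfolding galerkin_u_def[abs_def]
    by (intro continuous_on_add continuous_on_mult continuous_on_const S'
        continuous_on_convolution[OF S(3) continuous_on_inner_C_on[OF F]])
  show "continuous_on {0..T1} (galerkin_v F G k)"
    unfolding galerkin_v_def[abs_def]
    by (intro continuous_on_add continuous_on_mult continuous_on_const S'
        continuous_on_convolution[OF S(4) continuous_on_inner_C_on[OF F]])
qed

lemma pair_sum_modes:
  "(\<Sum>k\<in>I. a k *\<^sub>R (\<phi> k, 0)) + (\<Sum>k\<in>I. b k *\<^sub>R (0, \<phi> k)) =
    (\<Sum>k\<in>I. a k *\<^sub>R \<phi> k, \<Sum>k\<in>I. b k *\<^sub>R \<phi> k)"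
  by (rule prod_eqI) (simp_all add: fst_sum snd_sum)

lemma T_pair_sum_modes:
  assumes "t \<ge> 0"
  shows "T t (\<Sum>k=1..n. a k *\<^sub>R \<phi> k, \<Sum>k=1..n. b k *\<^sub>R \<phi> k) =
    (\<Sum>k=1..n. (S_uu k t * a k + S_vu k t * b k) *\<^sub>R \<phi> k, \<Sum>k=1..n. (S_uv k t * a k + S_vv k t * b k) *\<^sub>R \<phi> k)"
proof -
  have mem: "(\<phi> k, 0) \<in> energy_space \<Omega>" "(0, \<phi> k) \<in> energy_space \<Omega>" if "k \<in> {1..n}" for k
    using that by (auto intro!: domain_mem mode_domain)
  have "T t (\<Sum>k=1..n. a k *\<^sub>R \<phi> k, \<Sum>k=1..n. b k *\<^sub>R \<phi> k) =
      (\<Sum>k=1..n. T t (a k *\<^sub>R (\<phi> k, 0))) + (\<Sum>k=1..n. T t (b k *\<^sub>R (0, \<phi> k)))"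
    unfolding pair_sum_modes[symmetric] using assms mem
    by (simp only: T_add T_sum E.X_sum E.X_scaleR)
  also have "\<dots> = (\<Sum>k=1..n. a k *\<^sub>R (S_uu k t *\<^sub>R \<phi> k, S_uv k t *\<^sub>R \<phi> k)) +
      (\<Sum>k=1..n. b k *\<^sub>R (S_vu k t *\<^sub>R \<phi> k, S_vv k t *\<^sub>R \<phi> k))"
    using assms mem T_mode[OF _ assms] by (intro arg_cong2[of _ _ _ _ "(+)"] sum.cong refl) (simp_all only: T_scaleR atLeastAtMost_iff)
  also have "\<dots> = (\<Sum>k=1..n. (S_uu k t * a k + S_vu k t * b k) *\<^sub>R \<phi> k,
      \<Sum>k=1..n. (S_uv k t * a k + S_vv k t * b k) *\<^sub>R \<phi> k)"
    by (rule prod_eqI) (simp_all add: fst_sum snd_sum scaleR_add_left sum.distrib mult.commute)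
  finally show ?thesis .
qed

text \<open>The integrand stays in the span of the fixed vectors \<open>(\<phi> k, 0)\<close> and
  \<open>(0, \<phi> k)\<close> with \<open>k \<le> n\<close>, so its integral is assembled from the
  scalar integrals of the coefficients.\<close>

lemma galerkin_eq:
  assumes F: "F \<in> C_on {0..T1} (L2_on \<Omega>) norm" and G: "G \<in> energy_space \<Omega>" and t: "t \<in> {0..T1}"
  shows "galerkin \<Omega> \<kappa> T \<phi> F G n t =
    (\<Sum>k=1..n. galerkin_u F G k t *\<^sub>R \<phi> k, \<Sum>k=1..n. galerkin_v F G k t *\<^sub>R \<phi> k)"
proof -
  let ?f = "\<lambda>x. T (t - x) (0, P_tilde \<phi> n F x)"
  let ?I = "\<lambda>S k. integral {0..t} (\<lambda>x. S k (t - x) * (F x \<bullet> \<phi> k))"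
  have mem: "(\<phi> k, 0) \<in> energy_space \<Omega>" "(0, \<phi> k) \<in> energy_space \<Omega>" if "k \<in> {1..n}" for k
    using that by (auto intro!: domain_mem mode_domain)
  have f: "?f x = (\<Sum>k=1..n. (S_vu k (t - x) * (F x \<bullet> \<phi> k)) *\<^sub>R (\<phi> k, 0)) +
      (\<Sum>k=1..n. (S_vv k (t - x) * (F x \<bullet> \<phi> k)) *\<^sub>R (0, \<phi> k))" if x: "x \<in> {0..t}" for x
  proof -
    have "F x \<in> L2_on \<Omega>" using F x t by (auto simp: C_on_def)
    then have "(0, P_tilde \<phi> n F x) = (\<Sum>k=1..n. 0 *\<^sub>R \<phi> k, \<Sum>k=1..n. (F x \<bullet> \<phi> k) *\<^sub>R \<phi> k)"
      by (simp add: P_tilde_def Q_tilde_eq mode_proj_def)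
    then show ?thesis
      unfolding pair_sum_modes using T_pair_sum_modes[of "t - x" "\<lambda>_. 0" n "\<lambda>k. F x \<bullet> \<phi> k"] x by simp
  qed
  have has_int: "((\<lambda>x. S k (t - x) * (F x \<bullet> \<phi> k)) has_integral ?I S k) {0..t}"
    if "continuous_on {0..} (S k)" for S k
    using convolution_integrable[OF that continuous_on_inner_C_on[OF F] t] by (rule integrable_integral)
  have "integral_wrt (energy_space \<Omega>) (energy_norm \<Omega> \<kappa>) 0 t ?f =
      (\<Sum>k=1..n. ?I S_vu k *\<^sub>R (\<phi> k, 0)) + (\<Sum>k=1..n. ?I S_vv k *\<^sub>R (0, \<phi> k))"
  proof (rule E.integral_wrt_eq[OF _ _ _ energy_norm_eq_0])
    show "has_integral_wrt (energy_norm \<Omega> \<kappa>) ?f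
        ((\<Sum>k=1..n. ?I S_vu k *\<^sub>R (\<phi> k, 0)) + (\<Sum>k=1..n. ?I S_vv k *\<^sub>R (0, \<phi> k))) 0 t"
    \<comment> \<open>The expansion \<open>f\<close> holds only on \<open>{0..t}\<close>, where
      \<open>t - x\<close> is nonnegative.\<close>
    proof (rule iffD2[OF E.has_integral_wrt_cong[OF f]])
      show "has_integral_wrt (energy_norm \<Omega> \<kappa>)
        (\<lambda>x. (\<Sum>k=1..n. (S_vu k (t - x) * (F x \<bullet> \<phi> k)) *\<^sub>R (\<phi> k, 0)) +
          (\<Sum>k=1..n. (S_vv k (t - x) * (F x \<bullet> \<phi> k)) *\<^sub>R (0, \<phi> k)))
        ((\<Sum>k=1..n. ?I S_vu k *\<^sub>R (\<phi> k, 0)) + (\<Sum>k=1..n. ?I S_vv k *\<^sub>R (0, \<phi> k))) 0 t"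
        using mem continuous_on_propagators
        by (intro E.has_integral_wrt_add E.has_integral_wrt_sum_scaleR has_int E.X_sum E.X_scaleR) auto
    qed
    show "?f x \<in> energy_space \<Omega>" if "x \<in> {0..t}" for x
      unfolding f[OF that] using mem by (intro E.X_add E.X_sum E.X_scaleR)
    show "(\<Sum>k=1..n. ?I S_vu k *\<^sub>R (\<phi> k, 0)) + (\<Sum>k=1..n. ?I S_vv k *\<^sub>R (0, \<phi> k)) \<in> energy_space \<Omega>"
      using mem by (intro E.X_add E.X_sum E.X_scaleR)
  qed
  moreover have "T t (Q_proj \<Omega> \<kappa> \<phi> n (fst G), Q_tilde \<phi> n (snd G)) =
      (\<Sum>k=1..n. (S_uu k t * (fst G \<bullet> \<phi> k) + S_vu k t * (snd G \<bullet> \<phi> k)) *\<^sub>R \<phi> k,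
       \<Sum>k=1..n. (S_uv k t * (fst G \<bullet> \<phi> k) + S_vv k t * (snd G \<bullet> \<phi> k)) *\<^sub>R \<phi> k)"
    using G t T_pair_sum_modes[of t "\<lambda>k. fst G \<bullet> \<phi> k" n "\<lambda>k. snd G \<bullet> \<phi> k"]
    by (simp add: mem_energy_space Q_proj_eq Q_tilde_eq mode_proj_def)
  ultimately show ?thesis
    unfolding pair_sum_modes
    by (simp only: galerkin_def galerkin_u_def galerkin_v_def add_Pair scaleR_add_left sum.distrib)
qed

text \<open>The constant curve \<open>\<phi> k\<close> as test function turns the weak equation into
  the scalar system of mode \<open>k\<close>. Variation of constants with
  \<open>(S_uu, S_vu)\<close> then yields the first coefficient and with \<open>(S_uv, S_vv)\<close>
  the second.\<close>

lemma weak_solution_coefficients: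
  assumes F: "F \<in> C_on {0..T1} (L2_on \<Omega>) norm" and sol: "weak_solution \<Omega> \<kappa> \<nu> T1 F G u ut"
    and k: "k \<ge> 1" and t: "t \<in> {0..T1}"
  shows "galerkin_u F G k t = u t \<bullet> \<phi> k" "galerkin_v F G k t = ut t \<bullet> \<phi> k"
proof -
  let ?J = "{0..T1}"
  let ?\<alpha> = "\<lambda>t. u t \<bullet> \<phi> k" and ?\<beta> = "\<lambda>t. ut t \<bullet> \<phi> k"
  have u': "(u has_vector_derivative ut t) (at t within ?J)"
    and mem: "u t \<in> H10 \<Omega>" if "t \<in> ?J" for t
    using sol that by (auto simp: weak_solution_def C_on_def energy_space_def)
  have init: "u 0 = fst G" "ut 0 = snd G"
    using sol by (auto simp: weak_solution_def)
  obtain utt where utt: "utt \<in> C_on ?J (Hm1 \<Omega> \<kappa>) (Hm1_norm \<Omega> \<kappa>)"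
    and utt_lim: "\<And>t. t \<in> ?J \<Longrightarrow>
      ((\<lambda>s. Hm1_norm \<Omega> \<kappa> (\<lambda>w. inverse (s - t) * ((ut s - ut t) \<bullet> w) - utt t w)) \<longlongrightarrow> 0) (at t within ?J)"
    and utt_eq: "\<And>\<psi> t. \<psi> \<in> C_on ?J (H10 \<Omega>) (H10_norm \<Omega> \<kappa>) \<Longrightarrow> t \<in> {0<..T1} \<Longrightarrow>
      utt t (\<psi> t) = - \<nu> * (ut t \<bullet> \<psi> t) - \<kappa> * grad_inner \<Omega> (u t) (\<psi> t) + F t \<bullet> \<psi> t"
    using sol unfolding weak_solution_def by blast
  obtain C where C: "C > 0" "\<And>u. u \<in> H10 \<Omega> \<Longrightarrow> norm u \<le> C * H10_norm \<Omega> \<kappa> u"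
    by (rule norm_le_H10_norm) auto
  have \<alpha>': "(?\<alpha> has_real_derivative ?\<beta> t) (at t within ?J)" if "t \<in> ?J" for t
    unfolding has_real_derivative_iff_has_vector_derivative
    by (rule bounded_linear.has_vector_derivative[OF bounded_linear_inner_left u'[OF that]])
  \<comment> \<open>Convergence of the difference quotients in the dual norm, evaluated at the
    single vector \<open>\<phi> k\<close>, is convergence of scalars.\<close>
  have \<beta>': "(?\<beta> has_real_derivative utt t (\<phi> k)) (at t within ?J)" if t: "t \<in> ?J" for t
  proof -
    let ?l = "\<lambda>s w. inverse (s - t) * ((ut s - ut t) \<bullet> w) - utt t w"
    have utt_t: "utt t \<in> Hm1 \<Omega> \<kappa>" using utt t by (simp add: C_on_def)
    then obtain B where B: "\<And>w. w \<in> H10 \<Omega> \<Longrightarrow> \<bar>utt t w\<bar> \<le> B * H10_norm \<Omega> \<kappa> w"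
      unfolding Hm1_def by blast
    have le: "\<bar>?l s (\<phi> k)\<bar> \<le> Hm1_norm \<Omega> \<kappa> (?l s) * H10_norm \<Omega> \<kappa> (\<phi> k)" for s
    proof (rule le_Hm1_norm[OF phi_H10[OF k]])
      show "?l s (c *\<^sub>R w) = c * ?l s w" if "w \<in> H10 \<Omega>" for c w
        using utt_t that by (simp add: Hm1_def algebra_simps)
      \<comment> \<open>The L2 part is bounded on \<open>H10 \<Omega>\<close> by Cauchy-Schwarz and
        the Poincare constant \<open>C\<close>. That the bound depends on \<open>s\<close> is
        harmless: it only ensures that the supremum in \<open>Hm1_norm\<close> is finite.\<close>
      show "\<bar>?l s w\<bar> \<le> (\<bar>inverse (s - t)\<bar> * norm (ut s - ut t) * C + B) * H10_norm \<Omega> \<kappa> w"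
        if w: "w \<in> H10 \<Omega>" for w
      proof -
        have "\<bar>?l s w\<bar> \<le> \<bar>inverse (s - t)\<bar> * \<bar>(ut s - ut t) \<bullet> w\<bar> + \<bar>utt t w\<bar>"
          unfolding abs_mult[symmetric] by (rule abs_triangle_ineq4)
        also have "\<dots> \<le> \<bar>inverse (s - t)\<bar> * (norm (ut s - ut t) * (C * H10_norm \<Omega> \<kappa> w)) + B * H10_norm \<Omega> \<kappa> w"
          using C(2)[OF w] B[OF w]
          by (intro add_mono mult_left_mono order_trans[OF Cauchy_Schwarz_ineq2]) auto
        finally show ?thesis by (simp add: algebra_simps)
      qed
    qed
    have "((\<lambda>s. ?l s (\<phi> k)) \<longlongrightarrow> 0) (at t within ?J)"
    proof (rule Lim_null_comparison)
      show "\<forall>\<^sub>F s in at t within ?J. norm (?l s (\<phi> k)) \<le> Hm1_norm \<Omega> \<kappa> (?l s) * H10_norm \<Omega> \<kappa> (\<phi> k)"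
        using le by simp
      show "((\<lambda>s. Hm1_norm \<Omega> \<kappa> (?l s) * H10_norm \<Omega> \<kappa> (\<phi> k)) \<longlongrightarrow> 0) (at t within ?J)"
        using tendsto_mult_left_zero[OF utt_lim[OF t]] .
    qed
    then have "((\<lambda>s. inverse (s - t) * ((ut s - ut t) \<bullet> \<phi> k)) \<longlongrightarrow> utt t (\<phi> k)) (at t within ?J)"
      by (rule LIM_zero_cancel)
    then show ?thesis
      by (simp add: has_field_derivative_iff inner_diff_left divide_inverse mult.commute)
  qed
  have utt_phi: "utt t (\<phi> k) = - lam k * ?\<alpha> t - \<nu> * ?\<beta> t + F t \<bullet> \<phi> k" if t: "t \<in> {0<..T1}" for t
  proof -
    have "(\<lambda>_. \<phi> k) \<in> C_on ?J (H10 \<Omega>) (H10_norm \<Omega> \<kappa>)"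
      using phi_H10[OF k] by (simp add: C_on_def H10.nrm_0)
    moreover have "\<kappa> * grad_inner \<Omega> (u t) (\<phi> k) = lam k * (u t \<bullet> \<phi> k)"
      using H10_inner_phi[OF k mem[of t]] t by (simp add: H10_inner_def)
    ultimately show ?thesis using utt_eq[of "\<lambda>_. \<phi> k" t] t by simp
  qed
  have sub: "{0..t} \<subseteq> ?J" using t by auto
  have cont: "continuous_on {0..t} ?\<alpha>" "continuous_on {0..t} ?\<beta>"
    using continuous_on_subset[OF DERIV_continuous_on[OF \<alpha>'] sub]
      continuous_on_subset[OF DERIV_continuous_on[OF \<beta>'] sub] by auto
  \<comment> \<open>The weak equation is given for positive times and derivatives at end points are
    one-sided, so variation of constants is fed with interior derivatives only.\<close>
  have int: "at x within ?J = at x" if "0 < x" "x < t" for x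
    using that t by (intro at_within_interior) auto
  have \<alpha>_int: "(?\<alpha> has_real_derivative ?\<beta> x) (at x)" if "0 < x" "x < t" for x
    using \<alpha>'[of x] that t int[OF that] by auto
  have \<beta>_int: "(?\<beta> has_real_derivative - lam k * ?\<alpha> x - \<nu> * ?\<beta> x + F x \<bullet> \<phi> k) (at x)"
    if "0 < x" "x < t" for x
    using \<beta>'[of x] utt_phi[of x] that t int[OF that] by auto
  have t0: "0 \<le> t" using t by simp
  note voc = variation_of_constants[OF t0 _ _ \<alpha>_int cont(1) \<beta>_int cont(2), THEN integral_unique]
  show "galerkin_u F G k t = u t \<bullet> \<phi> k"
    unfolding galerkin_u_def using voc[OF propagator_derivatives(1,3)[OF k]]
    by (simp add: propagators_at_0[OF k] init)
  show "galerkin_v F G k t = ut t \<bullet> \<phi> k"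
    unfolding galerkin_v_def using voc[OF propagator_derivatives(2,4)[OF k]]
    by (simp add: propagators_at_0[OF k] init)
qed

lemma galerkin_in_P_spaces:
  assumes F: "F \<in> C_on {0..T1} (L2_on \<Omega>) norm" and G: "G \<in> energy_space \<Omega>"
  shows "(\<lambda>t. fst (galerkin \<Omega> \<kappa> T \<phi> F G n t)) \<in> P_space \<Omega> \<kappa> {0..T1} \<phi> n"
    and "(\<lambda>t. snd (galerkin \<Omega> \<kappa> T \<phi> F G n t)) \<in> P_tilde_space \<Omega> {0..T1} \<phi> n"
proof -
  have cont: "continuous_on {0..T1} (galerkin_u F G k)" "continuous_on {0..T1} (galerkin_v F G k)"
    if "k \<in> {1..n}" for k
    using continuous_on_galerkin_coefficients[OF _ F] that by auto
  note eq = galerkin_eq[OF F G]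
  have "(\<lambda>t. fst (galerkin \<Omega> \<kappa> T \<phi> F G n t)) \<in> C_on {0..T1} (H10 \<Omega>) (H10_norm \<Omega> \<kappa>)"
    by (rule H10.C_on_sum_scaleR[where A = "{1..n}" and e = \<phi> and \<alpha> = "galerkin_u F G"])
      (simp_all add: phi_H10 cont eq)
  moreover have "(\<lambda>t. fst (galerkin \<Omega> \<kappa> T \<phi> F G n t)) \<in> eigen_combinations {0..T1} \<phi> n"
    unfolding eigen_combinations_def using cont eq by (auto intro!: exI[of _ "galerkin_u F G"])
  ultimately show "(\<lambda>t. fst (galerkin \<Omega> \<kappa> T \<phi> F G n t)) \<in> P_space \<Omega> \<kappa> {0..T1} \<phi> n"
    by (simp add: P_space_def)
  have "(\<lambda>t. snd (galerkin \<Omega> \<kappa> T \<phi> F G n t)) \<in> C_on {0..T1} (L2_on \<Omega>) norm"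
    by (rule L2.C_on_sum_scaleR[where A = "{1..n}" and e = \<phi> and \<alpha> = "galerkin_v F G"])
      (simp_all add: phi_L2 cont eq)
  moreover have "(\<lambda>t. snd (galerkin \<Omega> \<kappa> T \<phi> F G n t)) \<in> eigen_combinations {0..T1} \<phi> n"
    unfolding eigen_combinations_def using cont eq by (auto intro!: exI[of _ "galerkin_v F G"])
  ultimately show "(\<lambda>t. snd (galerkin \<Omega> \<kappa> T \<phi> F G n t)) \<in> P_tilde_space \<Omega> {0..T1} \<phi> n"
    by (simp add: P_tilde_space_def)
qed

lemma galerkin_tendsto_weak_solution:
  assumes F: "F \<in> C_on {0..T1} (L2_on \<Omega>) norm" and G: "G \<in> energy_space \<Omega>"
    and sol: "weak_solution \<Omega> \<kappa> \<nu> T1 F G u ut"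
  shows "uniform_limit {0..T1} (\<lambda>n t. energy_norm \<Omega> \<kappa> (galerkin \<Omega> \<kappa> T \<phi> F G n t - (u t, ut t)))
    (\<lambda>_. 0) sequentially"
proof -
  have V: "(\<lambda>t. (u t, ut t)) \<in> C_on {0..T1} (energy_space \<Omega>) (energy_norm \<Omega> \<kappa>)"
    using sol by (simp add: weak_solution_def)
  have lim: "uniform_limit {0..T1} (\<lambda>n t. energy_norm \<Omega> \<kappa> ((u t, ut t) - energy_proj n (u t, ut t)))
      (\<lambda>_. 0) sequentially"
  proof (rule E.uniform_limit_contractions[where R = "\<lambda>n x. x - energy_proj n x", OF compact_Icc V])
    show "energy_norm \<Omega> \<kappa> (x - energy_proj n x) \<le> energy_norm \<Omega> \<kappa> x" if "x \<in> energy_space \<Omega>" for n x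
      using energy_norm_diff_energy_proj_le[OF that, of 0 n 0]
      by (simp add: eigenspan_def span_0 zero_prod_def[symmetric])
    show "x - y - energy_proj n (x - y) = x - energy_proj n x - (y - energy_proj n y)" for n x y
      by (simp add: energy_proj_def mode_proj_diff prod_eq_iff)
  qed (auto intro: E.X_diff energy_proj_mem energy_proj_tendsto)
  have eq: "energy_norm \<Omega> \<kappa> (galerkin \<Omega> \<kappa> T \<phi> F G n t - (u t, ut t)) =
      energy_norm \<Omega> \<kappa> ((u t, ut t) - energy_proj n (u t, ut t))" if t: "t \<in> {0..T1}" for n t
  proof -
    have "galerkin \<Omega> \<kappa> T \<phi> F G n t = energy_proj n (u t, ut t)"
      using galerkin_eq[OF F G t] weak_solution_coefficients[OF F sol _ t]
      by (simp add: energy_proj_def mode_proj_def)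
    moreover have "(u t, ut t) \<in> energy_space \<Omega>" using V t by (simp add: C_on_def)
    ultimately show ?thesis using E.nrm_minus_commute energy_proj_mem by simp
  qed
  show ?thesis
  proof (rule uniform_limitI)
    fix e :: real assume "e > 0"
    from uniform_limitD[OF lim this]
    show "\<forall>\<^sub>F n in sequentially. \<forall>t\<in>{0..T1}.
        dist (energy_norm \<Omega> \<kappa> (galerkin \<Omega> \<kappa> T \<phi> F G n t - (u t, ut t))) 0 < e"
      by (rule eventually_mono) (simp add: eq)
  qed
qed

end

section \<open>Density of the test functions and the conclusion\<close>

lemma subspace_closure:
  fixes S :: "'b::real_normed_vector set"
  assumes "subspace S"
  shows "subspace (closure S)"
proof (rule subspaceI)
  show "0 \<in> closure S" using subspace_0[OF assms] closure_subset by blast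
next
  fix x y assume "x \<in> closure S" "y \<in> closure S"
  then obtain f g where "\<And>n. f n \<in> S" "f \<longlonglongrightarrow> x" "\<And>n. g n \<in> S" "g \<longlonglongrightarrow> y"
    unfolding closure_sequential by blast
  then show "x + y \<in> closure S"
    unfolding closure_sequential using subspace_add[OF assms]
    by (intro exI[of _ "\<lambda>n. f n + g n"]) (auto intro: tendsto_add)
next
  fix c x assume "x \<in> closure S"
  then obtain f where "\<And>n. f n \<in> S" "f \<longlonglongrightarrow> x"
    unfolding closure_sequential by blast
  then show "c *\<^sub>R x \<in> closure S"
    unfolding closure_sequential using subspace_scale[OF assms]
    by (intro exI[of _ "\<lambda>n. c *\<^sub>R f n"]) (auto intro: tendsto_scaleR)
qed

text \<open>The L2 closure of the test functions is a subspace and contains every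
  \<open>\<phi> k\<close>, because \<open>H1_norm\<close> dominates \<open>norm\<close>. So it
  contains the span of the eigenfunctions, which is dense in \<open>L2_on \<Omega>\<close>.\<close>

lemma test_functions_dense_of_eigenbasis:
  assumes "dirichlet_eigenbasis \<Omega> \<kappa> \<phi>" "f \<in> L2_on \<Omega>" "e > 0"
  shows "\<exists>\<psi>. test_function \<Omega> \<psi> \<and> norm (f - abs_L2 \<psi>) < e"
proof -
  have tests: "subspace (abs_L2 ` Collect (test_function \<Omega>))"
  proof (rule subspaceI)
    have "0 = abs_L2 (\<lambda>_. 0)" by (simp add: zero_L2.abs_eq)
    then show "0 \<in> abs_L2 ` Collect (test_function \<Omega>)"
      using test_function_zero by blast
  next
    fix v w assume "v \<in> abs_L2 ` Collect (test_function \<Omega>)" "w \<in> abs_L2 ` Collect (test_function \<Omega>)"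
    then obtain \<psi> \<eta> where *: "test_function \<Omega> \<psi>" "test_function \<Omega> \<eta>" "v = abs_L2 \<psi>" "w = abs_L2 \<eta>"
      by auto
    then have "v + w = abs_L2 (\<lambda>x. \<psi> x + \<eta> x)"
      by (simp add: abs_L2_add square_integrable_test_function)
    then show "v + w \<in> abs_L2 ` Collect (test_function \<Omega>)"
      using test_function_add[OF *(1,2)] by blast
  next
    fix c v assume "v \<in> abs_L2 ` Collect (test_function \<Omega>)"
    then obtain \<psi> where *: "test_function \<Omega> \<psi>" "v = abs_L2 \<psi>" by auto
    then have "c *\<^sub>R v = abs_L2 (\<lambda>x. c * \<psi> x)"
      by (simp add: abs_L2_cmult square_integrable_test_function)
    then show "c *\<^sub>R v \<in> abs_L2 ` Collect (test_function \<Omega>)"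
      using test_function_cmult[OF *(1)] by blast
  qed
  have sub: "subspace (closure (abs_L2 ` Collect (test_function \<Omega>)))"
    by (rule subspace_closure[OF tests])
  have "\<phi> k \<in> closure (abs_L2 ` Collect (test_function \<Omega>))" if "k \<ge> 1" for k
    unfolding closure_approachable
  proof (intro allI impI)
    fix e :: real assume "e > 0"
    moreover have "\<phi> k \<in> H10 \<Omega>"
      using assms(1) that by (simp add: dirichlet_eigenbasis_def dirichlet_eigenfunction_def)
    ultimately obtain \<psi> where "test_function \<Omega> \<psi>" "H1_norm \<Omega> (\<phi> k - abs_L2 \<psi>) < e"
      by (auto simp: H10_def)
    then show "\<exists>v\<in>abs_L2 ` Collect (test_function \<Omega>). dist v (\<phi> k) < e"
      using norm_le_H1_norm[of "\<phi> k - abs_L2 \<psi>" \<Omega>] by (auto simp: dist_norm norm_minus_commute)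
  qed
  then have span: "span (\<phi> ` {1..}) \<subseteq> closure (abs_L2 ` Collect (test_function \<Omega>))"
    using sub by (intro span_minimal) auto
  have "complete_in \<phi> (L2_on \<Omega>) norm"
    using assms(1) by (simp only: dirichlet_eigenbasis_def)
  then obtain w where w: "w \<in> span (\<phi> ` {1..})" "norm (f - w) < e / 2"
    using assms(2) half_gt_zero[OF assms(3)] unfolding complete_in_def by meson
  then have "w \<in> closure (abs_L2 ` Collect (test_function \<Omega>))" using span by blast
  then obtain \<psi> where "test_function \<Omega> \<psi>" "norm (abs_L2 \<psi> - w) < e / 2"
    using half_gt_zero[OF assms(3)] unfolding closure_approachable dist_norm by blast
  moreover have "norm (f - abs_L2 \<psi>) \<le> norm (f - w) + norm (abs_L2 \<psi> - w)"
    using norm_triangle_ineq4[of "f - w" "abs_L2 \<psi> - w"] by simp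
  ultimately show ?thesis using w(2) by (intro exI[of _ \<psi>]) auto
qed

theorem theorem3p2:
  fixes \<Omega> :: "'a::euclidean_space set"
    and \<nu> \<kappa> T1 :: real
    and F :: "real \<Rightarrow> 'a L2"
    and G :: "'a L2 \<times> 'a L2"
    and T :: "real \<Rightarrow> 'a L2 \<times> 'a L2 \<Rightarrow> 'a L2 \<times> 'a L2"
    and \<phi> :: "nat \<Rightarrow> 'a L2"
  assumes "bounded_domain \<Omega>"
    and "convex \<Omega> \<or> class_C 2 \<Omega>"
    and "\<nu> > 0" and "\<kappa> > 0" and "T1 > 0"
    and "F \<in> C_on {0..T1} (L2_on \<Omega>) norm"
    and "G \<in> energy_space \<Omega>"
    and "wave_semigroup \<Omega> \<kappa> \<nu> T"
    and "dirichlet_eigenbasis \<Omega> \<kappa> \<phi>"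
  shows "(\<forall>n\<ge>1.
            (\<lambda>t. fst (galerkin \<Omega> \<kappa> T \<phi> F G n t)) \<in> P_space \<Omega> \<kappa> {0..T1} \<phi> n \<and>
            (\<lambda>t. snd (galerkin \<Omega> \<kappa> T \<phi> F G n t)) \<in> P_tilde_space \<Omega> {0..T1} \<phi> n) \<and>
         (\<forall>u ut. weak_solution \<Omega> \<kappa> \<nu> T1 F G u ut \<longrightarrow>
            uniform_limit {0..T1}
              (\<lambda>n t. energy_norm \<Omega> \<kappa> (galerkin \<Omega> \<kappa> T \<phi> F G n t - (u t, ut t)))
              (\<lambda>_. 0) sequentially)"
proof -
  interpret damped_wave \<Omega> \<kappa> \<nu> T \<phi>
  proof
    show "bounded \<Omega>" using assms by (simp add: bounded_domain_def)
  qed (use assms test_functions_dense_of_eigenbasis in blast)+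
  show ?thesis
    using galerkin_in_P_spaces galerkin_tendsto_weak_solution assms by blast
qed

end
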